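(* Let $\Lambda_{10}=\{\frac{i}{1024}: i=0,1,\dots,1023\}$ and $$\Lambda_{10}^{U}=\left\{\tfrac{192}{1024},\tfrac{309}{1024},\tfrac{390}{1024},\tfrac{391}{1024},\tfrac{832}{1024},\tfrac{715}{1024},\tfrac{634}{1024},\tfrac{633}{1024}\right\}.$$ Then the Gelfond exponent function $c\mapsto\Delta^{(c)}$ is real analytic at every $c\in\Lambda_{10}\setminus\Lambda_{10}^{U}$.
   Context: For $n\in\mathbb{N}$ (including $n=0$) let $s(n)$ be the sum of the binary digits of $n$, and let $t^{(c)}(n):=e^{2\pi i c\,s(n)}$ (the weighted $(c)$-Thue-Morse sequence, $1$-periodic in $c$). The Gelfond exponent $\Delta^{(c)}$ is the smallest $\alpha$ such that $\max_{0\le t\le1}\left|\sum_{n=0}^{N-1}t^{(c)}(n)e^{2\pi i nt}\right|=O(N^{\alpha})$ as $N\to\infty$. The function $c\mapsto\Delta^{(c)}$ is regarded as a $1$-periodic function of $c\in\mathbb{R}$. A function is real analytic at $c$ if it agrees with a convergent power series on an open neighbourhood of $c$. *)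

theory Defs
  imports "HOL-Analysis.Analysis" "HOL-Library.Landau_Symbols"
begin

fun binary_digit_sum :: "nat \<Rightarrow> nat" where
  "binary_digit_sum n = (if n = 0 then 0 else n mod 2 + binary_digit_sum (n div 2))"

declare binary_digit_sum.simps [simp del]

definition thue_morse :: "real \<Rightarrow> nat \<Rightarrow> complex" where
  "thue_morse c n = exp (2 * of_real pi * \<i> * of_real c * of_nat (binary_digit_sum n))"

definition thue_morse_poly :: "real \<Rightarrow> nat \<Rightarrow> real \<Rightarrow> complex" where
  "thue_morse_poly c N t =
     (\<Sum>n<N. thue_morse c n * exp (2 * of_real pi * \<i> * of_nat n * of_real t))"

(* The maximum over [0,1] is written as a supremum; thue_morse_max_attained shows that it is one. *)
definition thue_morse_max :: "real \<Rightarrow> nat \<Rightarrow> real" where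
  "thue_morse_max c N = (SUP t\<in>{0..1}. norm (thue_morse_poly c N t))"

lemma thue_morse_max_attained:
  "\<exists>t\<in>{0..1}. thue_morse_max c N = norm (thue_morse_poly c N t) \<and>
     (\<forall>u\<in>{0..1}. norm (thue_morse_poly c N u) \<le> norm (thue_morse_poly c N t))"
proof -
  have "continuous_on {0..1} (\<lambda>t. norm (thue_morse_poly c N t))"
    unfolding thue_morse_poly_def by (intro continuous_intros)
  then obtain t where t: "t \<in> {0..1::real}"
    and ub: "\<forall>u\<in>{0..1}. norm (thue_morse_poly c N u) \<le> norm (thue_morse_poly c N t)"
    using continuous_attains_sup[of "{0..1::real}" "\<lambda>t. norm (thue_morse_poly c N t)"] by auto
  have "thue_morse_max c N = norm (thue_morse_poly c N t)"
    unfolding thue_morse_max_def using t ub by (intro cSup_eq_maximum) auto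
  then show ?thesis using t ub by blast
qed

definition gelfond_exponent :: "real \<Rightarrow> real" where
  "gelfond_exponent c =
     (LEAST \<alpha>. (\<lambda>N. thue_morse_max c N) \<in> O(\<lambda>N. real N powr \<alpha>))"

definition real_analytic_at :: "(real \<Rightarrow> real) \<Rightarrow> real \<Rightarrow> bool" where
  "real_analytic_at f c \<longleftrightarrow>
     (\<exists>a r. r > 0 \<and> (\<forall>x. \<bar>x - c\<bar> < r \<longrightarrow> (\<lambda>n. a n * (x - c) ^ n) sums f x))"

definition Lambda10 :: "real set" where
  "Lambda10 = (\<lambda>i. real i / 1024) ` {0..1023}"

definition Lambda10U :: "real set" where
  "Lambda10U = {192/1024, 309/1024, 390/1024, 391/1024, 832/1024, 715/1024, 634/1024, 633/1024}"

end

theory Submission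
  imports Defs "HOL-Complex_Analysis.Complex_Analysis"
begin

text \<open>
  On blocks of length \<open>2 ^ n\<close> the exponential sum is, up to phases, the product of the factors
  \<open>2 \<bar>cos (\<pi> (2 ^ j t + c))\<bar>\<close>, so \<open>\<Delta>\<close> is governed by the invariant measure of the doubling map
  that maximises the integral of \<open>f(x) = ln \<bar>cos (\<pi> (x - c))\<bar>\<close> (\<open>\<Delta>\<close> is even in \<open>c\<close>). It equals
  \<open>1 + \<beta> / ln 2\<close> as soon as some orbit of mean \<open>\<beta>\<close> is optimal, and optimality is witnessed by a bounded
  \<open>\<phi>\<close> with \<open>f(x) + \<phi>(x) - \<phi>(2 x) \<le> \<beta>\<close>.

  For a Sturmian orbit with rotation number \<open>p / q\<close> one tries to make this an equality on a closed semicircle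
  containing the orbit. This forces \<open>\<phi>\<close>, up to constants, on intervals \<open>piece j\<close> around the orbit points, as the sum
  of \<open>f\<close> along the preimages that follow the orbit. The cut points \<open>d j\<close> between these intervals depend on a parameter
  \<open>t \<in> [0,1]\<close>, the pieces fit together to a continuous periodic function iff one number \<open>series t c\<close>
  vanishes, and then the inequality off the semicircle holds because \<open>ln \<bar>tan\<bar>\<close> is steeper
  than \<open>\<phi>(x) - \<phi>(x + 1/2)\<close> can be. Since \<open>series t c\<close> increases with \<open>c\<close> and is continuous in \<open>t\<close>, two signs
  \<open>0 \<le> series t1 clo\<close> and \<open>series t2 chi \<le> 0\<close> show that the same periodic orbit is optimal for all
  \<open>c\<close> in \<open>[clo, chi]\<close>, where \<open>\<Delta>\<close> is therefore an explicit analytic function. By concavity of \<open>f\<close>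
  each sign follows from an inequality between finite products of cosines, verified in fixed-point arithmetic.
\<close>

section \<open>Products of cosines and the Gelfond exponent\<close>

text \<open>The argument lives on a numerical margin. On an antipodal pair,
  \<open>lncos c x - lncos c (x + 1/2)\<close> has slope of absolute value at least
  \<open>2 * pi\<close>, and the slope of \<open>\<phi> x - \<phi> (x + 1/2)\<close> must stay below
  it. Each term of the series for the latter is controlled by the spread of the derivative of
  \<open>lncos c\<close> over the semicircle; summing this spread alone gives
  \<open>12/5 * pi\<close>, which is too much. Sharpening only the first term yields
  \<open>3/4 * pi\<close> for it and \<open>6/5 * pi\<close> for the rest, together
  \<open>39/20 * pi\<close>. These constants rest on the semicircle being centred at
  \<open>c\<close> up to \<open>1/12\<close>, and this tolerance is why \<open>t\<close> cannot
  always run through all of \<open>{0..1}\<close>. The other obstacle is to read off the sign of an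
  infinite series from finitely many cosines. This works because the distance between the orbit and
  the preimages of a cut point changes only once per period, by a factor \<open>2 ^ q\<close>, so
  the series consists of blocks that shrink at this rate.\<close>

lemma binary_digit_sum_double [simp]:
  "binary_digit_sum (2 * n) = binary_digit_sum n"
  "binary_digit_sum (Suc (2 * n)) = Suc (binary_digit_sum n)"
  by (simp_all add: binary_digit_sum.simps[of "2 * n"] binary_digit_sum.simps[of "Suc (2 * n)"]
      binary_digit_sum.simps[of 0])

lemma thue_morse_poly_alt:
  fixes c t :: real
  shows "thue_morse_poly c N t = (\<Sum>n<N. cis (2 * pi * (c * binary_digit_sum n + n * t)))"
  unfolding thue_morse_poly_def thue_morse_def
  by (simp add: cis_conv_exp exp_add[symmetric] algebra_simps)

lemma sum_lessThan_double:
  fixes g :: "nat \<Rightarrow> 'a::comm_monoid_add"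
  shows "(\<Sum>n<2 * N. g n) = (\<Sum>n<N. g (2 * n) + g (Suc (2 * n)))"
  by (induction N) (simp_all add: add.assoc)

lemma thue_morse_poly_double:
  "thue_morse_poly c (2 * N) t = (1 + cis (2 * pi * (c + t))) * thue_morse_poly c N (2 * t)"
  unfolding thue_morse_poly_alt sum_lessThan_double sum_distrib_left
  by (intro sum.cong refl, simp only: binary_digit_sum_double distrib_right cis_mult mult_1)
     (simp add: algebra_simps)

lemma norm_one_plus_cis: "norm (1 + cis (2 * pi * x)) = 2 * \<bar>cos (pi * x)\<bar>"
proof -
  have "1 + cis (2 * y) = cis y * (2 * of_real (cos y))" for y
    by (simp add: complex_eq_iff cos_double_cos sin_double power2_eq_square)
  from this[of "pi * x"] have "1 + cis (2 * pi * x) = cis (pi * x) * (2 * of_real (cos (pi * x)))"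
    by (simp add: mult.assoc)
  then show ?thesis by (simp add: norm_mult)
qed

lemma norm_thue_morse_poly_double:
  "norm (thue_morse_poly c (2 * N) t) = 2 * \<bar>cos (pi * (t + c))\<bar> * norm (thue_morse_poly c N (2 * t))"
  by (simp add: thue_morse_poly_double norm_mult norm_one_plus_cis add.commute)

lemma norm_thue_morse_poly_Suc_double:
  "norm (thue_morse_poly c (Suc (2 * N)) t)
     \<le> 2 * \<bar>cos (pi * (t + c))\<bar> * norm (thue_morse_poly c N (2 * t)) + 1"
proof -
  have "thue_morse_poly c (Suc (2 * N)) t = thue_morse_poly c (2 * N) t
      + cis (2 * pi * (c * binary_digit_sum (2 * N) + (2 * N) * t))"
    unfolding thue_morse_poly_alt by simp
  then have "norm (thue_morse_poly c (Suc (2 * N)) t) \<le> norm (thue_morse_poly c (2 * N) t) + 1"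
    using norm_triangle_ineq[of "thue_morse_poly c (2 * N) t"
        "cis (2 * pi * (c * binary_digit_sum (2 * N) + (2 * N) * t))"] by simp
  then show ?thesis by (simp add: norm_thue_morse_poly_double)
qed

lemma norm_thue_morse_poly_power2:
  "norm (thue_morse_poly c (2 ^ n) t) = (\<Prod>j<n. 2 * \<bar>cos (pi * (2 ^ j * t + c))\<bar>)"
proof (induction n arbitrary: t)
  case 0
  then show ?case by (simp add: thue_morse_poly_alt)
next
  case (Suc n)
  show ?case
    by (simp add: norm_thue_morse_poly_double Suc prod.lessThan_Suc_shift mult.assoc o_def
        mult.left_commute[of 2] del: prod.lessThan_Suc)
qed

section \<open>Periodicity in the frequency and symmetries in \<open>c\<close>\<close>

lemma thue_morse_poly_add_1_right: "thue_morse_poly c N (t + 1) = thue_morse_poly c N t"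
proof -
  have "cis (2 * pi * (c * binary_digit_sum n + n * (t + 1)))
      = cis (2 * pi * (c * binary_digit_sum n + n * t)) * cis (2 * pi * real n)" for n
    by (simp add: cis_mult algebra_simps)
  moreover have "cis (2 * pi * real n) = 1" for n
    using cis_multiple_2pi[of "real n"] by (simp add: mult.commute)
  ultimately show ?thesis by (simp add: thue_morse_poly_alt)
qed

lemma thue_morse_poly_add_int: "thue_morse_poly c N (t + of_int k) = thue_morse_poly c N t"
proof (induction k rule: int_induct[where k = 0])
  case (step1 i)
  then show ?case using thue_morse_poly_add_1_right[of c N "t + of_int i"] by (simp add: add.assoc)
next
  case (step2 i)
  then show ?case using thue_morse_poly_add_1_right[of c N "t + of_int (i - 1)"] by simp
qed simp

lemma thue_morse_add_1: "thue_morse (c + 1) n = thue_morse c n"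
proof -
  have "exp (2 * of_real pi * \<i> * of_nat k) = (1::complex)" for k :: nat
    using exp_integer_2pi[of "of_nat k"] by (simp add: algebra_simps)
  then show ?thesis by (simp add: thue_morse_def ring_distribs exp_add)
qed

lemma gelfond_exponent_add_1: "gelfond_exponent (c + 1) = gelfond_exponent c"
  by (simp add: gelfond_exponent_def thue_morse_max_def thue_morse_poly_def thue_morse_add_1)

lemma norm_thue_morse_poly_minus:
  "norm (thue_morse_poly (- c) N (- t)) = norm (thue_morse_poly c N t)"
proof -
  have "thue_morse_poly (- c) N (- t) = cnj (thue_morse_poly c N t)"
    unfolding thue_morse_poly_alt cnj_sum
    by (intro sum.cong refl) (simp add: cis_cnj algebra_simps flip: cis_inverse)
  then show ?thesis by simp
qed

lemma gelfond_exponent_minus: "gelfond_exponent (- c) = gelfond_exponent c"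
proof -
  have "thue_morse_max (- c) N = thue_morse_max c N" for N
  proof -
    have "(\<lambda>t::real. 1 - t) ` {0..1} = {0..1}"
      by simp
    moreover have "norm (thue_morse_poly (- c) N (1 - t)) = norm (thue_morse_poly c N t)" for t
      using thue_morse_poly_add_1_right[of "- c" N "- t"] norm_thue_morse_poly_minus[of c N t] by simp
    ultimately show ?thesis
      unfolding thue_morse_max_def
      using image_image[of "\<lambda>t. norm (thue_morse_poly (- c) N t)" "\<lambda>t. 1 - t" "{0..1}"] by simp
  qed
  then show ?thesis by (simp add: gelfond_exponent_def)
qed

lemma norm_thue_morse_poly_le_max: "norm (thue_morse_poly c N t) \<le> thue_morse_max c N"
proof -
  have "thue_morse_poly c N t = thue_morse_poly c N (frac t)"
    using thue_morse_poly_add_int[of c N "frac t" "\<lfloor>t\<rfloor>"] by (simp add: frac_def)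
  moreover have "frac t \<in> {0..1}"
    by (simp add: frac_lt_1 less_imp_le)
  ultimately show ?thesis
    using thue_morse_max_attained[of c N] by metis
qed

text \<open>The affine shift in the induction absorbs the additive error \<open>1\<close> of odd lengths.\<close>

lemma subaction_imp_upper_bound:
  fixes h :: "real \<Rightarrow> real"
  assumes lam: "\<mu> > 1" and m: "m > 0"
    and h: "\<And>x. m \<le> h x" "\<And>x. h x \<le> B"
    and sub: "\<And>x. 2 * \<bar>cos (pi * (x + c))\<bar> * h x \<le> \<mu> * h (2 * x)"
  shows "\<exists>C. \<forall>N\<ge>1. \<forall>t. norm (thue_morse_poly c N t) \<le> C * real N powr (log 2 \<mu>)"
proof -
  define b where "b = B / (\<mu> - 1)"
  define a where "a = b + B"
  have B: "B > 0" using h[of 0] m by linarith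
  have b: "b > 0" "B = (\<mu> - 1) * b" using lam B by (auto simp: b_def)
  have a: "a > 0" using b(1) B by (simp add: a_def)
  have al: "log 2 \<mu> > 0" using lam by simp
  have key: "norm (thue_morse_poly c N t) * h t \<le> a * real N powr (log 2 \<mu>) - b" if "N \<ge> 1" for N t
    using that
  proof (induction N arbitrary: t rule: less_induct)
    case (less N)
    show ?case
    proof (cases "N = 1")
      case True
      then show ?thesis using h(2)[of t] by (simp add: thue_morse_poly_alt a_def binary_digit_sum.simps)
    next
      case False
      define M where "M = N div 2"
      have M: "M \<ge> 1" "M < N" using less.prems False by (auto simp: M_def)
      have IH: "norm (thue_morse_poly c M (2 * t)) * h (2 * t) \<le> a * real M powr (log 2 \<mu>) - b"
        using less.IH M by blast
      have pw: "real (2 * M) powr (log 2 \<mu>) = \<mu> * real M powr (log 2 \<mu>)"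
        using lam by (simp add: powr_mult)
      have st: "2 * \<bar>cos (pi * (t + c))\<bar> * norm (thue_morse_poly c M (2 * t)) * h t
          \<le> a * real (2 * M) powr (log 2 \<mu>) - \<mu> * b"
      proof -
        have "2 * \<bar>cos (pi * (t + c))\<bar> * norm (thue_morse_poly c M (2 * t)) * h t
            = norm (thue_morse_poly c M (2 * t)) * (2 * \<bar>cos (pi * (t + c))\<bar> * h t)" by simp
        also have "\<dots> \<le> norm (thue_morse_poly c M (2 * t)) * (\<mu> * h (2 * t))"
          by (intro mult_left_mono sub) auto
        also have "\<dots> = \<mu> * (norm (thue_morse_poly c M (2 * t)) * h (2 * t))" by simp
        also have "\<dots> \<le> \<mu> * (a * real M powr (log 2 \<mu>) - b)"
          using IH lam by (intro mult_left_mono) auto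
        finally show ?thesis by (simp only: pw) (simp add: algebra_simps)
      qed
      have mono: "a * real (2 * M) powr (log 2 \<mu>) \<le> a * real N powr (log 2 \<mu>)"
        using a al by (intro mult_left_mono powr_mono2) (auto simp: M_def)
      have "norm (thue_morse_poly c N t) \<le> 2 * \<bar>cos (pi * (t + c))\<bar> * norm (thue_morse_poly c M (2 * t)) + 1"
      proof (cases "even N")
        case True
        then have "N = 2 * M" by (simp add: M_def)
        then show ?thesis by (simp add: norm_thue_morse_poly_double)
      next
        case False
        then have "N = Suc (2 * M)" by (simp add: M_def)
        then show ?thesis using norm_thue_morse_poly_Suc_double[of c M t] by simp
      qed
      then have "norm (thue_morse_poly c N t) * h t
          \<le> (2 * \<bar>cos (pi * (t + c))\<bar> * norm (thue_morse_poly c M (2 * t)) + 1) * h t"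
        using h(1)[of t] m by (intro mult_right_mono) auto
      also have "\<dots> \<le> a * real (2 * M) powr (log 2 \<mu>) - \<mu> * b + B"
        using st h(2)[of t] by (simp add: algebra_simps)
      also have "\<dots> \<le> a * real N powr (log 2 \<mu>) - b"
        using mono b by (simp add: algebra_simps)
      finally show ?thesis .
    qed
  qed
  show ?thesis
  proof (intro exI[of _ "a / m"] allI impI)
    fix N t assume "N \<ge> (1::nat)"
    have "norm (thue_morse_poly c N t) * m \<le> norm (thue_morse_poly c N t) * h t"
      using h by (intro mult_left_mono) auto
    also have "\<dots> \<le> a * real N powr (log 2 \<mu>)"
      using key[OF \<open>N \<ge> 1\<close>, of t] b by linarith
    finally show "norm (thue_morse_poly c N t) \<le> a / m * real N powr (log 2 \<mu>)"
      using m by (simp add: field_simps)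
  qed
qed

section \<open>Growth along a periodic orbit\<close>

lemma power2_orbit_mod_int:
  fixes x :: real
  assumes "2 ^ q * x = x + of_int k"
  shows "\<exists>l. 2 ^ (q * n) * x = x + of_int l"
proof (induction n)
  case 0
  then show ?case by (auto intro: exI[of _ 0])
next
  case (Suc n)
  then obtain l where l: "2 ^ (q * n) * x = x + of_int l" by blast
  have "2 ^ (q * Suc n) * x = 2 ^ q * (2 ^ (q * n) * x)" by (simp add: power_add)
  also have "\<dots> = 2 ^ q * x + 2 ^ q * of_int l" by (simp only: l distrib_left)
  also have "\<dots> = x + of_int (k + 2 ^ q * l)" by (simp add: assms)
  finally show ?case by blast
qed

lemma abs_cos_pi_add_int: "\<bar>cos (pi * (x + of_int k))\<bar> = \<bar>cos (pi * x)\<bar>"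
proof -
  have "cos (pi * (x + of_int k)) = cos (pi * x) * cos (pi * of_int k)"
    using sin_npi_int[of k] by (simp add: distrib_left cos_add mult.commute)
  moreover have "\<bar>cos (pi * of_int k)\<bar> = 1"
    using cos_int_times_real[of k] by (simp add: mult.commute)
  ultimately show ?thesis by (simp add: abs_mult)
qed

lemma prod_lessThan_add:
  fixes g :: "nat \<Rightarrow> 'a::comm_monoid_mult"
  shows "(\<Prod>j<q + n. g j) = (\<Prod>j<n. g j) * (\<Prod>j<q. g (n + j))"
  by (induction q) (simp_all add: mult.assoc add.commute)

lemma periodic_orbit_norm:
  assumes x: "2 ^ q * x = x + of_int k"
    and prod: "(\<Prod>j<q. 2 * \<bar>cos (pi * (2 ^ j * x + c))\<bar>) = L"
  shows "norm (thue_morse_poly c (2 ^ (q * n)) x) = L ^ n"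
  unfolding norm_thue_morse_poly_power2
proof (induction n)
  case (Suc n)
  obtain l where l: "2 ^ (q * n) * x = x + of_int l" using power2_orbit_mod_int[OF x] by blast
  have "(\<Prod>j<q * Suc n. 2 * \<bar>cos (pi * (2 ^ j * x + c))\<bar>)
      = (\<Prod>j<q * n. 2 * \<bar>cos (pi * (2 ^ j * x + c))\<bar>) * (\<Prod>j<q. 2 * \<bar>cos (pi * (2 ^ (q * n + j) * x + c))\<bar>)"
    by (simp add: prod_lessThan_add)
  also have "(\<Prod>j<q. 2 * \<bar>cos (pi * (2 ^ (q * n + j) * x + c))\<bar>) = L"
  proof -
    have "2 ^ (q * n + j) * x + c = (2 ^ j * x + c) + of_int (2 ^ j * l)" for j
    proof -
      have "2 ^ (q * n + j) * x = 2 ^ j * (2 ^ (q * n) * x)" by (simp add: power_add)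
      then show ?thesis by (simp add: l distrib_left)
    qed
    then show ?thesis by (simp only: abs_cos_pi_add_int prod)
  qed
  finally show ?case using Suc by simp
qed simp

text \<open>The weight \<open>h\<close> bounds the sums of every length by a multiple of
  \<open>N powr log 2 \<mu>\<close>, so this exponent is admissible itself and the
  \<open>LEAST\<close> exists. Along \<open>N = 2 ^ (q * n)\<close> the periodic point gives the
  norm \<open>\<mu> ^ (q * n)\<close>, which is exactly \<open>N powr log 2 \<mu>\<close>. The
  factors contain \<open>x - c\<close>, so both estimates concern \<open>- c\<close>, and evenness
  brings them back to \<open>c\<close>.\<close>

lemma gelfond_exponent_eqI:
  fixes h :: "real \<Rightarrow> real"
  assumes lam: "\<mu> > 1" and m: "m > 0"
    and h: "\<And>x. m \<le> h x" "\<And>x. h x \<le> B"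
    and sub: "\<And>x. 2 * \<bar>cos (pi * (x - c))\<bar> * h x \<le> \<mu> * h (2 * x)"
    and q: "q > 0" and x: "2 ^ q * x = x + of_int k"
    and prod: "(\<Prod>j<q. 2 * \<bar>cos (pi * (2 ^ j * x - c))\<bar>) = \<mu> ^ q"
  shows "gelfond_exponent c = log 2 \<mu>"
proof -
  have "2 * \<bar>cos (pi * (x + - c))\<bar> * h x \<le> \<mu> * h (2 * x)" for x
    using sub[of x] by simp
  from subaction_imp_upper_bound[OF lam m h this]
  obtain C where C: "\<And>N t. N \<ge> 1 \<Longrightarrow> norm (thue_morse_poly (- c) N t) \<le> C * real N powr (log 2 \<mu>)"
    by blast
  have nonneg: "thue_morse_max (- c) N \<ge> 0" for N
    using norm_thue_morse_poly_le_max[of "- c" N 0] norm_ge_zero order_trans by blast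
  have upper: "(\<lambda>N. thue_morse_max (- c) N) \<in> O(\<lambda>N. real N powr (log 2 \<mu>))"
  proof (rule bigoI[of _ C], rule eventually_mono[OF eventually_ge_at_top[of 1]])
    fix N :: nat assume "N \<ge> 1"
    then show "norm (thue_morse_max (- c) N) \<le> C * norm (real N powr (log 2 \<mu>))"
      using thue_morse_max_attained[of "- c" N] C[of N] nonneg[of N] by auto
  qed
  have lower: "log 2 \<mu> \<le> \<alpha>" if O: "(\<lambda>N. thue_morse_max (- c) N) \<in> O(\<lambda>N. real N powr \<alpha>)" for \<alpha>
  proof (rule ccontr)
    assume "\<not> log 2 \<mu> \<le> \<alpha>"
    then have lt: "\<alpha> < log 2 \<mu>" by simp
    obtain D where D: "eventually (\<lambda>N. norm (thue_morse_max (- c) N) \<le> D * norm (real N powr \<alpha>)) at_top"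
      using landau_o.bigE[OF O] by blast
    then obtain N0 where N0: "\<And>N. N \<ge> N0 \<Longrightarrow> norm (thue_morse_max (- c) N) \<le> D * norm (real N powr \<alpha>)"
      by (auto simp: eventually_at_top_linorder)
    \<comment> \<open>The gain of the orbit over \<open>N powr \<alpha>\<close> per period; it
      exceeds 1 as soon as \<open>\<alpha>\<close> is below \<open>log 2 \<mu>\<close>.\<close>
    define \<rho> where "\<rho> = \<mu> ^ q / (2 ^ q) powr \<alpha>"
    have "((2::real) ^ q) powr \<alpha> < (2 ^ q) powr (log 2 \<mu>)"
      using lt q by (intro powr_less_mono) (auto intro: one_less_power)
    also have "\<dots> = (2 powr (log 2 \<mu>)) powr q"
      by (simp add: powr_powr mult.commute flip: powr_realpow)
    also have "\<dots> = \<mu> ^ q"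
      using lam by (simp add: powr_realpow)
    finally have rho: "\<rho> > 1" by (simp add: \<rho>_def)
    obtain n where n: "\<rho> ^ n > max D 0" "n \<ge> N0"
    proof -
      from real_arch_pow[OF rho] obtain n0 where "max D 0 < \<rho> ^ n0" by blast
      moreover have "\<rho> ^ n0 \<le> \<rho> ^ (max n0 N0)" using rho by (intro power_increasing) auto
      ultimately show ?thesis using that[of "max n0 N0"] by auto
    qed
    have "n \<le> q * n" using q by simp
    also have "q * n < 2 ^ (q * n)" by simp
    finally have big: "2 ^ (q * n) \<ge> N0" using n(2) by linarith
    have "(\<mu> ^ q) ^ n = norm (thue_morse_poly (- c) (2 ^ (q * n)) x)"
      using periodic_orbit_norm[OF x, of "- c" "\<mu> ^ q" n] prod by simp
    also have "\<dots> \<le> thue_morse_max (- c) (2 ^ (q * n))" by (rule norm_thue_morse_poly_le_max)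
    also have "\<dots> \<le> D * real (2 ^ (q * n)) powr \<alpha>" using N0[OF big] by simp
    also have "real (2 ^ (q * n)) powr \<alpha> = ((2 ^ q) powr \<alpha>) ^ n"
      by (simp add: powr_powr mult_ac flip: powr_realpow)
    finally have "\<rho> ^ n \<le> D" by (simp add: \<rho>_def power_divide field_simps)
    then show False using n by simp
  qed
  have "gelfond_exponent (- c) = log 2 \<mu>"
    unfolding gelfond_exponent_def by (rule Least_equality) (use upper lower in auto)
  then show ?thesis by (simp add: gelfond_exponent_minus)
qed

section \<open>The function \<open>ln \<bar>cos\<bar>\<close>\<close>

text \<open>Written with a square to get a smooth formula; junk value \<open>0\<close> at the zeros of the cosine.\<close>

definition lncos :: "real \<Rightarrow> real \<Rightarrow> real" where
  "lncos c x = ln ((cos (pi * (x - c)))\<^sup>2) / 2"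

lemma cos_pi_sq_add_int: "(cos (pi * (x + of_int k)))\<^sup>2 = (cos (pi * x))\<^sup>2"
  by (metis abs_cos_pi_add_int power2_abs)

lemma lncos_add_int [simp]: "lncos c (x + of_int k) = lncos c x"
proof -
  have "x + of_int k - c = (x - c) + of_int k" by simp
  then show ?thesis by (simp only: lncos_def cos_pi_sq_add_int)
qed

lemma lncos_add_1 [simp]: "lncos c (x + 1) = lncos c x"
  using lncos_add_int[of c x 1] by simp

lemma lncos_diff_int: "lncos c (x - of_int k) = lncos c x"
  using lncos_add_int[of c x "- k"] by simp

lemma cos_pi_pos: "\<bar>y\<bar> < 1/2 \<Longrightarrow> cos (pi * y) > 0"
proof -
  assume "\<bar>y\<bar> < 1/2"
  then have "pi * \<bar>y\<bar> < pi * (1/2)" by (intro mult_strict_left_mono) auto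
  then have "\<bar>pi * y\<bar> < pi / 2" by (simp add: abs_mult)
  then have "- (pi / 2) < pi * y" "pi * y < pi / 2" by linarith+
  then show ?thesis by (intro cos_gt_zero_pi)
qed

lemma lncos_eq_ln_abs:
  assumes "cos (pi * (x - c)) \<noteq> 0"
  shows "lncos c x = ln \<bar>cos (pi * (x - c))\<bar>"
proof -
  have "ln (\<bar>cos (pi * (x - c))\<bar>\<^sup>2) = 2 * ln \<bar>cos (pi * (x - c))\<bar>"
    using assms by (subst ln_realpow) auto
  then show ?thesis by (simp add: lncos_def)
qed

lemma exp_lncos: "cos (pi * (x - c)) \<noteq> 0 \<Longrightarrow> exp (lncos c x) = \<bar>cos (pi * (x - c))\<bar>"
  by (simp add: lncos_eq_ln_abs)

lemma lncos_eq: "\<bar>x - c\<bar> < 1/2 \<Longrightarrow> lncos c x = ln (cos (pi * (x - c)))"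
  using cos_pi_pos[of "x - c"] lncos_eq_ln_abs[of x c] by simp

lemma DERIV_lncos:
  assumes "cos (pi * (x - c)) \<noteq> 0"
  shows "(lncos c has_real_derivative - pi * tan (pi * (x - c))) (at x within S)"
proof -
  have "((\<lambda>x. cos (pi * (x - c))) has_real_derivative - sin (pi * (x - c)) * pi) (at x within S)"
    by (auto intro!: derivative_eq_intros)
  then have "((\<lambda>x. (cos (pi * (x - c)))\<^sup>2) has_real_derivative
      2 * cos (pi * (x - c)) * (- sin (pi * (x - c)) * pi)) (at x within S)"
    by (rule DERIV_power[where n = 2, THEN DERIV_cong]) simp
  from DERIV_chain2[OF DERIV_ln_divide this]
  have "((\<lambda>x. ln ((cos (pi * (x - c)))\<^sup>2)) has_real_derivative
      1 / (cos (pi * (x - c)))\<^sup>2 * (2 * cos (pi * (x - c)) * (- sin (pi * (x - c)) * pi))) (at x within S)"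
    using assms by simp
  from DERIV_cdivide[OF this, of 2] show ?thesis
    unfolding lncos_def [abs_def] tan_def using assms by (simp add: power2_eq_square mult_ac)
qed

lemma tan_diff_cos_sum:
  assumes "cos a \<noteq> 0" "cos b \<noteq> 0"
  shows "tan b - tan a = 2 * sin (b - a) / (cos (a + b) + cos (b - a))"
proof -
  have "cos (a + b) + cos (b - a) = 2 * cos a * cos b" by (simp add: cos_add cos_diff)
  moreover have "tan b - tan a = sin (b - a) / (cos a * cos b)"
    using assms by (simp add: tan_def sin_diff field_simps)
  ultimately show ?thesis by simp
qed

text \<open>Concavity in usable form: the derivative \<open>- pi * tan (pi * (x - c))\<close>
  decreases, so its values at the ends of any enclosing interval bound the difference quotients
  inside.\<close>

lemma lncos_diff_bounds:
  assumes uv: "u \<le> v" and K: "lo \<le> u" "v \<le> hi" "\<bar>lo - c\<bar> < 1/2" "\<bar>hi - c\<bar> < 1/2"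
  shows "lncos c v - lncos c u \<le> (v - u) * (- pi * tan (pi * (lo - c)))"
    and "(v - u) * (- pi * tan (pi * (hi - c))) \<le> lncos c v - lncos c u"
proof -
  have in_half: "\<bar>x - c\<bar> < 1/2" if "lo \<le> x" "x \<le> hi" for x using that K by linarith
  have tan_mono: "tan (pi * (x - c)) \<le> tan (pi * (y - c))" if "lo \<le> x" "x \<le> y" "y \<le> hi" for x y
  proof (cases "x = y")
    case False
    have "- (1/2) < x - c" "y - c < 1/2" using in_half[of x] in_half[of y] that by linarith+
    then have "pi * (x - c) > - (pi / 2)" "pi * (y - c) < pi / 2"
      using mult_strict_left_mono[of "- (1/2)" "x - c" pi]
        mult_strict_left_mono[of "y - c" "1/2" pi] by simp_all
    with False that show ?thesis by (intro less_imp_le tan_monotone) auto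
  qed simp
  have "\<exists>\<xi>. u \<le> \<xi> \<and> \<xi> \<le> v \<and> lncos c v - lncos c u = (v - u) * (- pi * tan (pi * (\<xi> - c)))"
  proof (cases "u = v")
    case False
    with uv have "u < v" by simp
    have "\<exists>z>u. z < v \<and> lncos c v - lncos c u = (v - u) * (- pi * tan (pi * (z - c)))"
    proof (rule MVT2[OF \<open>u < v\<close>])
      fix x assume "u \<le> x" "x \<le> v"
      then have "cos (pi * (x - c)) \<noteq> 0" using K cos_pi_pos[OF in_half[of x]] by simp
      then show "(lncos c has_real_derivative - pi * tan (pi * (x - c))) (at x)"
        by (rule DERIV_lncos)
    qed
    then show ?thesis using less_imp_le by blast
  qed auto
  then obtain \<xi> where \<xi>: "u \<le> \<xi>" "\<xi> \<le> v"
    "lncos c v - lncos c u = (v - u) * (- pi * tan (pi * (\<xi> - c)))" by blast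
  show "lncos c v - lncos c u \<le> (v - u) * (- pi * tan (pi * (lo - c)))"
    unfolding \<xi>(3) using tan_mono[of lo \<xi>] uv K \<xi> by (intro mult_left_mono mult_left_mono_neg) auto
  show "(v - u) * (- pi * tan (pi * (hi - c))) \<le> lncos c v - lncos c u"
    unfolding \<xi>(3) using tan_mono[of \<xi> hi] uv K \<xi> by (intro mult_left_mono mult_left_mono_neg) auto
qed

lemma sqrt3_bounds: "17/10 < sqrt 3" "sqrt 3 < 174/100"
  by (rule real_less_rsqrt real_less_lsqrt; simp add: power2_eq_square)+

lemma sqrt2_bounds: "141/100 < sqrt 2" "sqrt 2 < 142/100"
  by (rule real_less_rsqrt real_less_lsqrt; simp add: power2_eq_square)+

lemma cos_ge_cos_abs: "\<bar>x\<bar> \<le> y \<Longrightarrow> y \<le> pi \<Longrightarrow> cos y \<le> cos x"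
  using cos_monotone_0_pi_le[of "\<bar>x\<bar>" y] by (simp add: cos_abs_real)

text \<open>For angles \<open>pi / 2\<close> apart the difference of tangents is
  \<open>2 / cos (a + b)\<close>. The tolerance \<open>1/12\<close> bounds \<open>a + b\<close> by
  \<open>pi / 6\<close> in absolute value, and \<open>2 / (17/20)\<close> is below
  \<open>12/5\<close>.\<close>

lemma lncos_slope_range:
  assumes "\<bar>\<theta> - c + 1/4\<bar> < 1/12"
  shows "pi * tan (pi * (\<theta> + 1/2 - c)) - pi * tan (pi * (\<theta> - c)) \<le> 12/5 * pi"
proof -
  let ?a = "pi * (\<theta> - c)" and ?b = "pi * (\<theta> + 1/2 - c)"
  have "cos ?a > 0" "cos ?b > 0" by (rule cos_pi_pos, use assms in linarith)+
  then have "tan ?b - tan ?a = 2 * sin (?b - ?a) / (cos (?a + ?b) + cos (?b - ?a))"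
    by (intro tan_diff_cos_sum) auto
  also have "?b - ?a = pi / 2" by (simp add: algebra_simps)
  also have "?a + ?b = 2 * pi * (\<theta> - c + 1/4)" by (simp add: algebra_simps)
  finally have eq: "tan ?b - tan ?a = 2 / cos (2 * pi * (\<theta> - c + 1/4))" by simp
  have "2 * pi * \<bar>\<theta> - c + 1/4\<bar> \<le> 2 * pi * (1/12)" using assms by (intro mult_left_mono) auto
  then have "\<bar>2 * pi * (\<theta> - c + 1/4)\<bar> \<le> pi / 6" by (simp add: abs_mult)
  then have "sqrt 3 / 2 \<le> cos (2 * pi * (\<theta> - c + 1/4))"
    using cos_ge_cos_abs[of "2 * pi * (\<theta> - c + 1/4)" "pi / 6"] by (simp add: cos_30)
  then have "17/20 \<le> cos (2 * pi * (\<theta> - c + 1/4))" using sqrt3_bounds by linarith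
  then have "tan ?b - tan ?a \<le> 12/5" unfolding eq by (simp add: field_simps)
  then have "pi * (tan ?b - tan ?a) \<le> pi * (12/5)" by (intro mult_left_mono) auto
  then show ?thesis by (simp add: algebra_simps)
qed

text \<open>The range of \<open>x - c\<close> is what remains when \<open>x\<close> and
  \<open>x + 1/4\<close> both lie within \<open>1/3\<close> of \<open>c\<close>. It is symmetric
  about \<open>-1/8\<close> with radius \<open>5/24\<close>, so the worst angle is
  \<open>pi / 4 + pi / 6\<close>.\<close>

lemma lncos_quarter_slope:
  assumes y: "-1/3 \<le> x - c" "x - c \<le> 1/12"
  shows "0 \<le> pi * tan (pi * (x + 1/4 - c)) - pi * tan (pi * (x - c))"
    and "pi * tan (pi * (x + 1/4 - c)) - pi * tan (pi * (x - c)) \<le> 3/2 * pi"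
proof -
  let ?a = "pi * (x - c)" and ?b = "pi * (x + 1/4 - c)"
  have "cos ?a > 0" "cos ?b > 0" by (rule cos_pi_pos, use y in linarith)+
  then have "tan ?b - tan ?a = 2 * sin (?b - ?a) / (cos (?a + ?b) + cos (?b - ?a))"
    by (intro tan_diff_cos_sum) auto
  also have "?b - ?a = pi / 4" by (simp add: algebra_simps)
  also have "?a + ?b = 2 * pi * (x - c + 1/8)" by (simp add: algebra_simps)
  finally have eq: "tan ?b - tan ?a = sqrt 2 / (cos (2 * pi * (x - c + 1/8)) + sqrt 2 / 2)"
    by (simp add: sin_45 cos_45)
  have "\<bar>x - c + 1/8\<bar> \<le> 5/24" using y by linarith
  then have "2 * pi * \<bar>x - c + 1/8\<bar> \<le> 2 * pi * (5/24)" by (intro mult_left_mono) auto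
  then have "\<bar>2 * pi * (x - c + 1/8)\<bar> \<le> pi / 4 + pi / 6" by (simp add: abs_mult)
  then have "cos (pi / 4 + pi / 6) \<le> cos (2 * pi * (x - c + 1/8))"
    using cos_ge_cos_abs[of "2 * pi * (x - c + 1/8)" "pi / 4 + pi / 6"] by simp
  moreover have "cos (pi / 4 + pi / 6) = sqrt 2 * (sqrt 3 - 1) / 4"
    unfolding cos_add cos_45 sin_45 cos_30 sin_30 by (simp add: field_simps)
  moreover have "sqrt 2 * (sqrt 3 - 1) \<ge> 141/100 * (7/10)"
    using sqrt2_bounds sqrt3_bounds by (intro mult_mono) auto
  ultimately have c: "cos (2 * pi * (x - c + 1/8)) \<ge> 24/100" by simp
  then have "0 \<le> tan ?b - tan ?a" unfolding eq using sqrt2_bounds by (intro divide_nonneg_pos) auto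
  moreover have "tan ?b - tan ?a \<le> 3/2"
    unfolding eq using c sqrt2_bounds by (simp add: divide_le_eq)
  ultimately have "0 \<le> pi * (tan ?b - tan ?a)" "pi * (tan ?b - tan ?a) \<le> pi * (3/2)"
    by (simp_all only: mult_left_mono zero_le_mult_iff pi_ge_zero simp_thms)
  then show "0 \<le> pi * tan ?b - pi * tan ?a" "pi * tan ?b - pi * tan ?a \<le> 3/2 * pi"
    by (simp_all add: algebra_simps)
qed

lemma lncos_quarter_diff:
  assumes uv: "u \<le> v" and y: "-1/3 \<le> u - c" "v - c \<le> 1/12"
  shows "\<bar>(lncos c v - lncos c u) - (lncos c (v + 1/4) - lncos c (u + 1/4))\<bar> \<le> 3/2 * pi * (v - u)"
proof (cases "u = v")
  case False
  with uv have "u < v" by simp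
  let ?D = "\<lambda>x. pi * tan (pi * (x + 1/4 - c)) - pi * tan (pi * (x - c))"
  have "\<exists>z>u. z < v \<and> (\<lambda>x. lncos c x - lncos c (x + 1/4)) v - (\<lambda>x. lncos c x - lncos c (x + 1/4)) u
      = (v - u) * ?D z"
  proof (rule MVT2[OF \<open>u < v\<close>])
    fix x assume x: "u \<le> x" "x \<le> v"
    have "cos (pi * (x - c)) > 0" "cos (pi * (x + 1/4 - c)) > 0"
      by (rule cos_pi_pos, use x y in linarith)+
    then have "cos (pi * (x - c)) \<noteq> 0" "cos (pi * (x + 1/4 - c)) \<noteq> 0" by simp_all
    note D = DERIV_lncos[OF this(1), of UNIV] DERIV_lncos[OF this(2), of UNIV]
    have "((\<lambda>x. lncos c (x + 1/4)) has_real_derivative - pi * tan (pi * (x + 1/4 - c))) (at x)"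
      using D(2) by (simp add: DERIV_shift)
    then show "((\<lambda>x. lncos c x - lncos c (x + 1/4)) has_real_derivative ?D x) (at x)"
      using DERIV_diff[OF D(1)] by force
  qed
  then obtain z where z: "u < z" "z < v"
    "lncos c v - lncos c (v + 1/4) - (lncos c u - lncos c (u + 1/4)) = (v - u) * ?D z" by auto
  then have "\<bar>?D z\<bar> \<le> 3/2 * pi" using lncos_quarter_slope[of z c] y by simp
  then have "\<bar>(v - u) * ?D z\<bar> \<le> (v - u) * (3/2 * pi)"
    unfolding abs_mult using \<open>u < v\<close> by (intro mult_mono) auto
  also have "(v - u) * ?D z = (lncos c v - lncos c u) - (lncos c (v + 1/4) - lncos c (u + 1/4))"
    using z(3) by linarith
  finally show ?thesis by (simp only: mult.commute)
qed simp

text \<open>The derivative of \<open>lncos c x - lncos c (x + 1/2) = - ln \<bar>tan (\<pi> (x - c))\<bar>\<close> is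
  \<open>- 2 \<pi> / sin (2 \<pi> (x - c))\<close>, hence the slope \<open>2 \<pi>\<close>.\<close>

lemma lncos_half_diff:
  assumes uv: "u \<le> v" and s: "-1/2 < u - c" "v - c < 0"
  shows "2 * pi * (v - u) \<le> (lncos c v - lncos c (v + 1/2)) - (lncos c u - lncos c (u + 1/2))"
proof (cases "u = v")
  case False
  with uv have "u < v" by simp
  let ?D = "\<lambda>x. - pi * tan (pi * (x - c)) - (- pi * tan (pi * (x + 1/2 - c)))"
  have D_ge: "(lncos c has_real_derivative - pi * tan (pi * (x - c))) (at x)"
      "((\<lambda>x. lncos c (x + 1/2)) has_real_derivative - pi * tan (pi * (x + 1/2 - c))) (at x)"
      "?D x \<ge> 2 * pi" if x: "u \<le> x" "x \<le> v" for x
  proof -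
    have c: "cos (pi * (x - c)) > 0" "cos (pi * (x + 1/2 - c)) > 0"
      by (rule cos_pi_pos, use x s in linarith)+
    show "(lncos c has_real_derivative - pi * tan (pi * (x - c))) (at x)"
      using c by (intro DERIV_lncos) auto
    have "(lncos c has_real_derivative - pi * tan (pi * (x + 1/2 - c))) (at (x + 1/2))"
      using c by (intro DERIV_lncos) auto
    then show "((\<lambda>x. lncos c (x + 1/2)) has_real_derivative - pi * tan (pi * (x + 1/2 - c))) (at x)"
      by (simp add: DERIV_shift)
    let ?a = "pi * (x - c)" and ?b = "pi * (x + 1/2 - c)"
    have eq: "?b - ?a = pi / 2" by (simp add: algebra_simps)
    have "cos (?a + ?b) + cos (?b - ?a) = 2 * cos ?a * cos ?b" by (simp add: cos_add cos_diff)
    then have pos: "cos (?a + ?b) > 0" using c by (simp add: eq)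
    have "tan ?b - tan ?a = 2 / cos (?a + ?b)"
      using c by (subst tan_diff_cos_sum) (auto simp: eq)
    moreover have "2 / cos (?a + ?b) \<ge> 2" using pos by (simp add: field_simps)
    ultimately have "pi * (tan ?b - tan ?a) \<ge> pi * 2"
      by (intro mult_left_mono) auto
    then show "?D x \<ge> 2 * pi" by (simp add: algebra_simps)
  qed
  have "\<exists>z>u. z < v \<and> (\<lambda>x. lncos c x - lncos c (x + 1/2)) v - (\<lambda>x. lncos c x - lncos c (x + 1/2)) u
      = (v - u) * ?D z"
    by (rule MVT2[OF \<open>u < v\<close>]) (intro DERIV_diff D_ge)
  then obtain z where z: "u < z" "z < v"
    "lncos c v - lncos c (v + 1/2) - (lncos c u - lncos c (u + 1/2)) = (v - u) * ?D z" by auto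
  have "(v - u) * (2 * pi) \<le> (v - u) * ?D z"
    using D_ge(3)[of z] z \<open>u < v\<close> by (intro mult_left_mono) auto
  with z(3) show ?thesis by (simp add: algebra_simps)
qed simp

section \<open>Sturmian periodic orbits\<close>

lemma sum_int_periodic_shift:
  fixes F :: "int \<Rightarrow> 'a::ab_group_add"
  assumes per: "\<And>j. F (j + int q) = F j"
  shows "(\<Sum>j<q. F (int j + k)) = (\<Sum>j<q. F (int j))"
proof -
  have step: "(\<Sum>j<q. F (int j + (k + 1))) = (\<Sum>j<q. F (int j + k))" for k
  proof -
    have "(\<Sum>j<q. F (int j + (k + 1))) - (\<Sum>j<q. F (int j + k))
        = (\<Sum>j<q. F (int (Suc j) + k) - F (int j + k))"
      by (simp add: sum_subtractf algebra_simps)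
    also have "\<dots> = F (int q + k) - F (int 0 + k)" by (rule sum_lessThan_telescope)
    also have "\<dots> = 0" using per[of k] by (simp add: add.commute)
    finally show ?thesis by simp
  qed
  show ?thesis
  proof (induction k rule: int_induct[where k = 0])
    case (step1 i)
    then show ?case using step[of i] by simp
  next
    case (step2 i)
    then show ?case using step[of "i - 1"] by simp
  qed simp
qed

lemma int_div_add_1:
  fixes j q :: int
  assumes "q > 0"
  shows "(j + 1) div q = j div q + (if q dvd j + 1 then 1 else 0)"
proof (cases "q dvd j + 1")
  case True
  then obtain k where k: "j + 1 = q * k" by blast
  then have "j = q * (k - 1) + (q - 1)" by (simp add: algebra_simps)
  then have "j div q = k - 1" using assms by (intro int_div_pos_eq[where r = "q - 1"]) auto
  then show ?thesis using k assms True by simp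
next
  case False
  then have "j mod q + 1 \<noteq> q" using assms by (metis mod_add_left_eq mod_self dvd_eq_mod_eq_0)
  then have "j mod q + 1 < q" using assms pos_mod_bound[of q j] by linarith
  then have "(j + 1) div q = j div q"
    using assms by (intro int_div_pos_eq[where r = "j mod q + 1"]) (auto simp: add.assoc[symmetric])
  then show ?thesis using False by simp
qed

text \<open>The points \<open>orbit_pt p q j\<close>, \<open>0 \<le> j < q\<close>, form the orbit of the doubling map with
  rotation number \<open>p / q\<close> in increasing order; \<open>orbit_pt p q j = (\<Sum>n. \<lfloor>(j + n p) / q\<rfloor> / 2 ^ (n + 1))\<close>
  continues this order to a lift to the real line.\<close>

definition orbit_num :: "nat \<Rightarrow> nat \<Rightarrow> int \<Rightarrow> int" where
  "orbit_num p q j = (\<Sum>n<q. 2 ^ (q - 1 - n) * ((j + int n * int p) div int q)) + int p"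

definition orbit_pt :: "nat \<Rightarrow> nat \<Rightarrow> int \<Rightarrow> real" where
  "orbit_pt p q j = of_int (orbit_num p q j) / (2 ^ q - 1)"

lemma sum_power2_rev: "(\<Sum>n<q. 2 ^ (q - Suc n)) = (2 ^ q - 1 :: int)"
  by (induction q) (simp_all add: sum.lessThan_Suc_shift del: sum.lessThan_Suc)

locale rotation =
  fixes p q :: nat
  assumes p_less: "p < q" and coprime: "coprime p q"
begin

abbreviation "M \<equiv> (2 ^ q - 1 :: real)"
abbreviation "num \<equiv> orbit_num p q"
abbreviation "z \<equiv> orbit_pt p q"
definition "gap j = z (j + 1) - z j"

lemma q_pos: "q > 0" using p_less by simp
lemma M_ge_1: "M \<ge> 1"
proof -
  have "(2::real) ^ 1 \<le> 2 ^ q" using q_pos by (intro power_increasing) auto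
  then show ?thesis by simp
qed

lemma num_add_q: "num (j + int q) = num j + (2 ^ q - 1)"
proof -
  have "(j + int q + int n * int p) div int q = (j + int n * int p) div int q + 1" for n
    using q_pos by (metis add.assoc add.commute div_add_self2 of_nat_0_eq_iff less_irrefl)
  then show ?thesis by (simp add: orbit_num_def distrib_left sum.distrib sum_power2_rev)
qed

lemma z_add_q: "z (j + int q) = z j + 1"
  using M_ge_1 by (simp add: orbit_pt_def num_add_q field_simps)

text \<open>Doubling shifts the summation index by one. The boundary terms are
  \<open>2 ^ q * (j div int q)\<close> and \<open>j div int q + int p\<close>, since the floor grows
  by \<open>int p\<close> over a full period; the summand \<open>int p\<close> in
  \<open>orbit_num\<close> absorbs this growth.\<close>

lemma num_double: "2 * num j = num (j + int p) + (2 ^ q - 1) * (j div int q)"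
proof -
  obtain r where r: "q = Suc r" using q_pos gr0_implies_Suc by blast
  define F where "F n = 2 ^ (q - n) * ((j + int n * int p) div int q)" for n
  have "2 * num j = (\<Sum>n<q. F n) + 2 * int p"
    unfolding orbit_num_def distrib_left sum_distrib_left F_def
    by (intro arg_cong2[of _ _ _ _ "(+)"] sum.cong refl) (simp add: r Suc_diff_le)
  also have "(\<Sum>n<q. F n) + F q = (\<Sum>n<q. F (Suc n)) + F 0"
    using sum.lessThan_Suc[of F q] sum.lessThan_Suc_shift[of F q] by simp
  then have "(\<Sum>n<q. F n) = (\<Sum>n<q. F (Suc n)) + F 0 - F q" by simp
  also have "F q = j div int q + int p" using q_pos by (simp add: F_def)
  also have "F 0 = 2 ^ q * (j div int q)" by (simp add: F_def)
  also have "(\<Sum>n<q. F (Suc n)) = num (j + int p) - int p"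
    unfolding orbit_num_def F_def by (simp add: algebra_simps)
  finally show ?thesis by (simp add: algebra_simps)
qed

lemma z_double: "2 * z j = z (j + int p) + of_int (j div int q)"
proof -
  have "real_of_int (2 * num j) = real_of_int (num (j + int p) + (2 ^ q - 1) * (j div int q))"
    by (simp only: num_double)
  then have "2 * real_of_int (num j) = of_int (num (j + int p)) + M * of_int (j div int q)" by simp
  then show ?thesis using M_ge_1 by (simp add: orbit_pt_def field_simps)
qed

text \<open>The number of doubling steps that take the gap right of \<open>z j\<close> to the largest gap.\<close>

definition "idx j = (THE n. n < q \<and> int q dvd j + 1 + int n * int p)"

lemma idx_ex1: "\<exists>!n. n < q \<and> int q dvd j + 1 + int n * int p"
proof -
  have cp: "coprime (int p) (int q)" using coprime by simp
  obtain u v where uv: "u * int p + v * int q = 1"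
    using bezout_int[of "int p" "int q"] cp by (auto simp: coprime_iff_gcd_eq_1)
  define n where "n = nat ((- (j + 1) * u) mod int q)"
  have n: "int n = (- (j + 1) * u) mod int q" using q_pos by (simp add: n_def)
  then have "n < q" using q_pos by (metis of_nat_0_less_iff of_nat_less_iff pos_mod_bound)
  obtain k where k: "int n = - (j + 1) * u - int q * k"
    using n by (metis minus_mult_div_eq_mod)
  have "j + 1 + int n * int p = (j + 1) * (u * int p + v * int q) + int n * int p"
    using uv by simp
  also have "\<dots> = int q * ((j + 1) * v - k * int p)"
    unfolding k by (simp add: algebra_simps)
  finally have ex: "int q dvd j + 1 + int n * int p" by (rule dvdI)
  show ?thesis
  proof (intro ex1I[of _ n] conjI \<open>n < q\<close> ex)
    fix m assume m: "m < q \<and> int q dvd j + 1 + int m * int p"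
    then have "int q dvd (j + 1 + int m * int p) - (j + 1 + int n * int p)" using ex by (intro dvd_diff) auto
    also have "(j + 1 + int m * int p) - (j + 1 + int n * int p) = (int m - int n) * int p"
      by (simp add: algebra_simps)
    finally have "int q dvd int m - int n" using cp by (simp add: coprime_dvd_mult_left_iff coprime_commute)
    then have "int m mod int q = int n mod int q" by (simp add: mod_eq_dvd_iff)
    then show "m = n" using m \<open>n < q\<close> by simp
  qed
qed

lemma idx_less: "idx j < q" and idx_dvd: "int q dvd j + 1 + int (idx j) * int p"
  using theI'[OF idx_ex1[of j]] by (auto simp: idx_def)

lemma idx_eqI: "n < q \<Longrightarrow> int q dvd j + 1 + int n * int p \<Longrightarrow> idx j = n"
  using idx_ex1[of j] idx_less[of j] idx_dvd[of j] by blast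

text \<open>Between \<open>j\<close> and \<open>j + 1\<close> the floor jumps only when
  \<open>int q\<close> divides \<open>j + 1 + int n * int p\<close>, which happens for exactly one
  \<open>n < q\<close>. So a single power of 2 survives in the difference of numerators.\<close>

lemma gap_eq: "gap j = 2 ^ (q - 1 - idx j) / M"
proof -
  have div: "(j + 1 + int n * int p) div int q - (j + int n * int p) div int q
      = (if int q dvd j + 1 + int n * int p then 1 else 0)" for n
    using int_div_add_1[of "int q" "j + int n * int p"] q_pos by (simp add: algebra_simps)
  have "num (j + 1) - num j
      = (\<Sum>n<q. 2 ^ (q - 1 - n) * ((j + 1 + int n * int p) div int q - (j + int n * int p) div int q))"
    unfolding orbit_num_def right_diff_distrib sum_subtractf by simp
  also have "\<dots> = (\<Sum>n<q. if n = idx j then 2 ^ (q - 1 - n) else 0)"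
  proof (intro sum.cong refl)
    fix n assume "n \<in> {..<q}"
    then have "int q dvd j + 1 + int n * int p \<longleftrightarrow> n = idx j"
      using idx_dvd[of j] idx_eqI[of n j] by blast
    then show "2 ^ (q - 1 - n) * ((j + 1 + int n * int p) div int q - (j + int n * int p) div int q)
        = (if n = idx j then 2 ^ (q - 1 - n) else (0::int))"
      unfolding div by (simp del: dvd_add_right_iff dvd_add_left_iff)
  qed
  also have "\<dots> = 2 ^ (q - 1 - idx j)" using idx_less[of j] by simp
  finally show ?thesis by (simp add: gap_def orbit_pt_def flip: diff_divide_distrib of_int_diff)
qed

lemma gap_pos: "gap j > 0" using M_ge_1 by (simp add: gap_eq)

lemma gap_add_q: "gap (j + int q) = gap j"
  using z_add_q[of j] z_add_q[of "j + 1"] by (simp add: gap_def algebra_simps)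

lemma gap_double: "2 * gap j = gap (j + int p) + (if int q dvd j + 1 then 1 else 0)"
  using z_double[of j] z_double[of "j + 1"] int_div_add_1[of "int q" j] q_pos
  by (simp add: gap_def algebra_simps)

lemma gap_last: "gap (-1) = 2 ^ (q - 1) / M"
proof -
  have "idx (-1) = 0" using q_pos by (intro idx_eqI) auto
  then show ?thesis by (simp add: gap_eq)
qed

lemma power_q: "(2::real) ^ q = 2 * 2 ^ (q - 1)" using q_pos by (cases q) auto

text \<open>The largest gap is longer than half of the circle; doubling wraps it around once and
  leaves this excess. Half of the excess is the distance by which the semicircle can move as
  \<open>t\<close> varies.\<close>

lemma gap_p: "gap (int p - 1) = 1 / M"
proof -
  have "gap (int p - 1) = 2 * gap (-1) - 1" using gap_double[of "-1"] by simp
  moreover have "2 * (N / (2 * N - 1)) - 1 = 1 / (2 * N - 1)" if "N \<ge> 1" for N :: real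
    using that by (simp add: field_simps)
  from this[of "2 ^ (q - 1)"] have "2 * (2 ^ (q - 1) / M) - 1 = 1 / M" unfolding power_q by simp
  ultimately show ?thesis by (simp add: gap_last)
qed

end

section \<open>The sub-action\<close>

locale rotation_cut = rotation +
  fixes t c :: real
  assumes t01: "0 \<le> t" "t \<le> 1"
    and tol: "\<bar>orbit_pt p q 0 - (1 - t) / (2 * (2 ^ q - 1)) - c + 1/4\<bar> < 1/12"
begin

text \<open>\<open>{\<theta>..\<theta> + 1/2}\<close> is the semicircle; the inverse branch of the doubling map into it is
  discontinuous at \<open>2 * \<theta> = d (p - 1)\<close>.\<close>

definition "\<theta> = z 0 - (1 - t) / (2 * M)"
definition "d j = z j + t * gap j"
definition "piece j = {d (j - 1)..d j}"
definition "back n j x = z (j - int n * int p) + (x - z j) / 2 ^ n"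

section \<open>Cut points, pieces and inverse branches\<close>

lemma theta_tol: "\<bar>\<theta> - c + 1/4\<bar> < 1/12"
  using tol by (simp add: \<theta>_def)

lemma d_add_q: "d (j + int q) = d j + 1"
  by (simp add: d_def z_add_q gap_add_q)

lemma d_add_mult_q: "d (j + int q * m) = d j + of_int m"
proof (induction m rule: int_induct[where k = 0])
  case (step1 i)
  then show ?case using d_add_q[of "j + int q * i"] by (simp add: algebra_simps)
next
  case (step2 i)
  then show ?case using d_add_q[of "j + int q * (i - 1)"] by (simp add: algebra_simps)
qed simp

text \<open>Doubling carries cut points to cut points, except in the largest gap. That gap contains
  the complement of the semicircle and its image wraps around, which produces the extra
  \<open>t\<close>.\<close>

lemma d_double: "2 * d j = d (j + int p) + of_int (j div int q) + (if int q dvd j + 1 then t else 0)"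
  using z_double[of j] gap_double[of j] by (simp add: d_def algebra_simps)

lemma z_le_d: "z j \<le> d j"
  using gap_pos[of j] t01 by (simp add: d_def)

lemma d_le_z: "d (j - 1) \<le> z j"
proof -
  have "t * gap (j - 1) \<le> 1 * gap (j - 1)" using gap_pos[of "j - 1"] t01 by (intro mult_right_mono) auto
  then show ?thesis by (simp add: d_def gap_def)
qed

lemma d_less_Suc: "d j < d (j + 1)"
proof (cases "t = 0")
  case True
  then show ?thesis using gap_pos[of j] unfolding d_def by (simp add: gap_def)
next
  case False
  then have "t * gap (j + 1) > 0" using t01 gap_pos by simp
  then show ?thesis using d_le_z[of "j + 1"] by (simp add: d_def)
qed

lemma d_strict_mono: "i < j \<Longrightarrow> d i < d j"
proof (induction j rule: int_gr_induct[where k = i])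
  case base
  then show ?case by (rule d_less_Suc)
next
  case (step j)
  then show ?case using d_less_Suc[of j] by simp
qed

lemma d_mono: "i \<le> j \<Longrightarrow> d i \<le> d j"
  using d_strict_mono[of i j] by (cases "i = j") auto

lemma d_less_iff: "d i < d j \<longleftrightarrow> i < j"
  using d_strict_mono d_mono by (meson linorder_not_le)

lemma ex_tile: "\<exists>j. d (j - 1) \<le> x \<and> x < d j"
proof -
  define m where "m = \<lfloor>x - d 0\<rfloor>"
  have m: "d (int q * m) \<le> x" "x < d (int q * m + int q)"
    using d_add_mult_q[of 0 m] d_add_q[of "int q * m"] by (simp_all add: m_def) linarith+
  have "\<exists>k<q. d (int q * m + int k) \<le> x \<and> x < d (int q * m + int (Suc k))"
  proof (rule ccontr)
    assume n: "\<not> ?thesis"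
    have "d (int q * m + int k) \<le> x" if "k \<le> q" for k
      using that
    proof (induction k)
      case (Suc k)
      then show ?case using n by (meson Suc_le_lessD Suc_leD not_le_imp_less)
    qed (use m in simp)
    then show False using m by fastforce
  qed
  then obtain k where "d (int q * m + int k) \<le> x" "x < d (int q * m + int (Suc k))" by blast
  then show ?thesis by (intro exI[of _ "int q * m + int (Suc k)"]) simp
qed

lemma ex_piece: "\<exists>j. x \<in> piece j"
  using ex_tile[of x] by (auto simp: piece_def less_imp_le)

lemma piece_cases:
  assumes "x \<in> piece i" "x \<in> piece j" "i < j"
  shows "j = i + 1" "x = d i"
proof -
  have "d (j - 1) \<le> d i" using assms by (simp add: piece_def)
  then have "j - 1 \<le> i" using d_strict_mono[of i "j - 1"] by (meson linorder_not_le)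
  then show "j = i + 1" using assms by simp
  then show "x = d i" using assms by (simp add: piece_def)
qed

lemma z_in_piece: "z j \<in> piece j"
  by (simp add: piece_def z_le_d d_le_z)

lemma d_in_piece: "d j \<in> piece j" "d j \<in> piece (j + 1)"
  using d_less_Suc[of j] d_less_Suc[of "j - 1"] by (auto simp: piece_def)

lemma piece_add_q: "x + 1 \<in> piece (j + int q) \<longleftrightarrow> x \<in> piece j"
  using d_add_q[of j] d_add_q[of "j - 1"] by (simp add: piece_def algebra_simps)

lemma back_0 [simp]: "back 0 j x = x"
  by (simp add: back_def)

lemma back_z: "back n j (z j) = z (j - int n * int p)"
  by (simp add: back_def)

lemma back_Suc: "back (Suc n) j x = back 1 (j - int n * int p) (back n j x)"
  by (simp add: back_def algebra_simps)

lemma back_Suc': "back (Suc n) j x = back n (j - int p) (back 1 j x)"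
  by (simp add: back_def algebra_simps)

lemma back_diff: "back n j x - back n j y = (x - y) / 2 ^ n"
  by (simp add: back_def diff_divide_distrib)

lemma back_1_eq: "back 1 j x = (x + of_int ((j - int p) div int q)) / 2"
  using z_double[of "j - int p"] by (simp add: back_def field_simps)

lemma theta_double: "2 * \<theta> = d (int p - 1)"
proof -
  define r where "r = 1 / M"
  have "z (int p - 1) = 2 * z 0 - r"
    using z_double[of 0] gap_p by (simp add: gap_def r_def)
  moreover have "\<theta> = z 0 - (1 - t) / 2 * r" by (simp add: \<theta>_def r_def)
  then have "2 * \<theta> = 2 * z 0 - (1 - t) * r" by simp
  ultimately show ?thesis by (simp add: d_def gap_p algebra_simps flip: r_def)
qed

text \<open>The two ends of the piece follow from \<open>d_double\<close>, the upper one because the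
  extra term is nonnegative and the lower one because it is at most 1. The semicircle is reached
  because the pieces from \<open>p\<close> to \<open>p + q - 1\<close> tile exactly one turn,
  \<open>{2 * \<theta>..2 * \<theta> + 1}\<close>.\<close>

lemma back_1_in:
  assumes "x \<in> piece j"
  defines "m \<equiv> (j - int p) div int q"
  shows "back 1 j x \<in> piece (j - int p)"
    and "back 1 j x - of_int m \<in> {\<theta>..\<theta> + 1/2}"
proof -
  let ?i = "j - int p"
  have x: "d (j - 1) \<le> x" "x \<le> d j" using assms(1) by (auto simp: piece_def)
  have "d j + of_int m \<le> 2 * d ?i" using d_double[of ?i] t01 by (simp add: m_def)
  moreover have "2 * d (?i - 1) \<le> d (j - 1) + of_int m"
  proof -
    have "?i div int q = (?i - 1) div int q + (if int q dvd ?i then 1 else 0)"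
      using int_div_add_1[of "int q" "?i - 1"] q_pos by simp
    then have m: "real_of_int m = of_int ((?i - 1) div int q) + (if int q dvd ?i then 1 else 0)"
      by (simp add: m_def)
    have "2 * d (?i - 1) = d (j - 1) + of_int ((?i - 1) div int q) + (if int q dvd ?i then t else 0)"
      using d_double[of "?i - 1"] by (simp add: algebra_simps)
    also have "\<dots> \<le> d (j - 1) + of_int m" using m t01 by simp
    finally show ?thesis .
  qed
  ultimately show "back 1 j x \<in> piece ?i"
    using x unfolding piece_def back_1_eq m_def[symmetric] by simp
  have "?i = int q * m + ?i mod int q" by (simp add: m_def)
  moreover have "0 \<le> ?i mod int q" "?i mod int q < int q" using q_pos by simp_all
  ultimately have "int p - 1 + int q * m \<le> j - 1" "j \<le> int p - 1 + int q * (m + 1)"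
    by (simp_all add: algebra_simps)
  from d_mono[OF this(1)] d_mono[OF this(2)]
  have "2 * \<theta> + of_int m \<le> d (j - 1)" "d j \<le> 2 * \<theta> + of_int m + 1"
    unfolding d_add_mult_q theta_double by simp_all
  with x show "back 1 j x - of_int m \<in> {\<theta>..\<theta> + 1/2}"
    unfolding back_1_eq m_def[symmetric] by simp
qed

lemma back_in_piece: "x \<in> piece j \<Longrightarrow> back n j x \<in> piece (j - int n * int p)"
proof (induction n)
  case (Suc n)
  then have "back 1 (j - int n * int p) (back n j x) \<in> piece (j - int n * int p - int p)"
    by (intro back_1_in(1)) auto
  then show ?case unfolding back_Suc by (simp add: algebra_simps)
qed simp

lemma back_in_K:
  assumes "x \<in> piece j"
  shows "back (Suc n) j x - of_int ((j - int (Suc n) * int p) div int q) \<in> {\<theta>..\<theta> + 1/2}"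
  using back_1_in(2)[OF back_in_piece[OF assms, of n]] unfolding back_Suc by (simp add: algebra_simps)

text \<open>The derivative of \<open>lncos c\<close> at the left and, in \<open>g_min\<close>, at
  the right end of the semicircle; by concavity these are its extreme values there.\<close>

definition "g_max = - pi * tan (pi * (\<theta> - c))"
definition "g_min = - pi * tan (pi * (\<theta> + 1/2 - c))"

lemma g_range: "g_max - g_min \<le> 12/5 * pi"
  using lncos_slope_range[OF theta_tol] by (simp add: g_max_def g_min_def)

lemma K_bounds: "\<bar>\<theta> - c\<bar> < 1/2" "\<bar>\<theta> + 1/2 - c\<bar> < 1/2"
  using theta_tol by linarith+

lemma K_diff:
  assumes "u \<le> v" "u - of_int k \<in> {\<theta>..\<theta> + 1/2}" "v - of_int k \<in> {\<theta>..\<theta> + 1/2}"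
  shows "lncos c v - lncos c u \<le> (v - u) * g_max" "(v - u) * g_min \<le> lncos c v - lncos c u"
  using lncos_diff_bounds[of "u - of_int k" "v - of_int k" \<theta> "\<theta> + 1/2" c] assms K_bounds
  by (auto simp: g_max_def g_min_def lncos_diff_int)

lemma back_diff_bounds:
  assumes "x \<in> piece j" "y \<in> piece j" "x \<le> y"
  shows "lncos c (back (Suc n) j y) - lncos c (back (Suc n) j x) \<le> (y - x) / 2 ^ Suc n * g_max"
    and "(y - x) / 2 ^ Suc n * g_min \<le> lncos c (back (Suc n) j y) - lncos c (back (Suc n) j x)"
proof -
  have "back (Suc n) j x \<le> back (Suc n) j y"
    using assms by (simp add: back_def divide_right_mono)
  from K_diff[OF this back_in_K[OF assms(1)] back_in_K[OF assms(2)]]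
  show "lncos c (back (Suc n) j y) - lncos c (back (Suc n) j x) \<le> (y - x) / 2 ^ Suc n * g_max"
    and "(y - x) / 2 ^ Suc n * g_min \<le> lncos c (back (Suc n) j y) - lncos c (back (Suc n) j x)"
    unfolding back_diff by auto
qed

definition "lip = max \<bar>g_max\<bar> \<bar>g_min\<bar>"

lemma back_lip:
  assumes "x \<in> piece j" "y \<in> piece j"
  shows "\<bar>lncos c (back (Suc n) j y) - lncos c (back (Suc n) j x)\<bar> \<le> lip * \<bar>y - x\<bar> / 2 ^ Suc n"
proof -
  have *: "\<bar>lncos c (back (Suc n) j y) - lncos c (back (Suc n) j x)\<bar> \<le> lip * \<bar>y - x\<bar> / 2 ^ Suc n"
    if "x \<in> piece j" "y \<in> piece j" "x \<le> y" for x y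
  proof -
    have s: "(y - x) / 2 ^ Suc n \<ge> 0" using that by simp
    have "(y - x) / 2 ^ Suc n * g_max \<le> (y - x) / 2 ^ Suc n * lip"
      "(y - x) / 2 ^ Suc n * (- lip) \<le> (y - x) / 2 ^ Suc n * g_min"
      by (intro mult_left_mono s; simp add: lip_def; linarith)+
    then show ?thesis using back_diff_bounds[OF that, of n] \<open>x \<le> y\<close>
      by (simp add: abs_le_iff mult.commute)
  qed
  show ?thesis
  proof (cases "x \<le> y")
    case False
    then show ?thesis using *[of y x] assms by (simp add: abs_minus_commute)
  qed (use * assms in auto)
qed

lemma summable_geo: "summable (\<lambda>n. C / 2 ^ Suc n :: real)"
  using sums_mult[OF power_half_series, of C] by (auto simp: summable_def power_divide)

lemma suminf_geo: "(\<Sum>n. C / 2 ^ Suc n :: real) = C"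
  using sums_unique[OF sums_mult[OF power_half_series, of C]] by (simp add: power_divide)

lemma summable_back:
  assumes "x \<in> piece j" "y \<in> piece j"
  shows "summable (\<lambda>n. lncos c (back (Suc n) j y) - lncos c (back (Suc n) j x))"
  by (rule summable_comparison_test'[OF summable_geo[of "lip * \<bar>y - x\<bar>"], of 0])
     (use back_lip[OF assms] in simp)

text \<open>The plain sum of \<open>lncos c\<close> along the preimages need not converge.
  Subtracting the values along the orbit leaves differences over distances that halve at each step,
  and normalises \<open>\<Phi> j\<close> to vanish at \<open>z j\<close>. The constants lost here
  return in \<open>a\<close>.\<close>

definition "\<Phi> j x = (\<Sum>n. lncos c (back (Suc n) j x) - lncos c (back (Suc n) j (z j)))"

lemma Phi_diff:
  assumes "x \<in> piece j" "y \<in> piece j"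
  shows "\<Phi> j y - \<Phi> j x = (\<Sum>n. lncos c (back (Suc n) j y) - lncos c (back (Suc n) j x))"
  unfolding \<Phi>_def
  by (subst suminf_diff) (use assms z_in_piece in \<open>auto intro!: summable_back\<close>)

lemma Phi_bound:
  assumes "x \<in> piece j"
  shows "\<bar>\<Phi> j x\<bar> \<le> lip * \<bar>x - z j\<bar>"
proof -
  let ?f = "\<lambda>n. lncos c (back (Suc n) j x) - lncos c (back (Suc n) j (z j))"
  note b = back_lip[OF z_in_piece assms]
  have s: "summable (\<lambda>n. \<bar>?f n\<bar>)"
    by (rule summable_comparison_test'[OF summable_geo[of "lip * \<bar>x - z j\<bar>"], of 0]) (use b in simp)
  have "\<bar>\<Phi> j x\<bar> \<le> (\<Sum>n. \<bar>?f n\<bar>)" unfolding \<Phi>_def by (rule summable_rabs[OF s])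
  also have "\<dots> \<le> (\<Sum>n. lip * \<bar>x - z j\<bar> / 2 ^ Suc n)" by (rule suminf_le[OF b s summable_geo])
  finally show ?thesis by (simp only: suminf_geo)
qed

lemma Phi_add_q: "\<Phi> (j + int q) (x + 1) = \<Phi> j x"
proof -
  have "back n (j + int q) (x + 1) = back n j x + 1" for n x
    using z_add_q[of "j - int n * int p"] z_add_q[of j] by (simp add: back_def algebra_simps)
  then show ?thesis by (simp add: \<Phi>_def z_add_q)
qed

text \<open>For \<open>j\<close> in this range the inverse branch at \<open>2 * x\<close> is plain
  halving without an integer shift, so \<open>x\<close> is the first preimage, and splitting off the
  head of the series gives the functional equation.\<close>

lemma Phi_double:
  assumes "2 * x \<in> piece (j + int p)" "0 \<le> j" "j < int q"
  shows "\<Phi> (j + int p) (2 * x) = lncos c x - lncos c (z j) + \<Phi> j x"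
    and "x \<in> piece j" and "x \<in> {\<theta>..\<theta> + 1/2}"
proof -
  have b: "back 1 (j + int p) (2 * x) = x" using assms unfolding back_1_eq by simp
  show "x \<in> piece j" "x \<in> {\<theta>..\<theta> + 1/2}" using back_1_in[OF assms(1)] assms(2,3) unfolding b by simp_all
  have b': "back (Suc n) (j + int p) (2 * x) = back n j x" for n
    unfolding back_Suc' b by simp
  have bz: "back (Suc n) (j + int p) (z (j + int p)) = back n j (z j)" for n
    unfolding back_z by (simp add: algebra_simps)
  have "summable (\<lambda>n. lncos c (back n j x) - lncos c (back n j (z j)))"
    using summable_back[OF z_in_piece assms(1)] unfolding b' bz .
  from suminf_split_head[OF this] show "\<Phi> (j + int p) (2 * x) = lncos c x - lncos c (z j) + \<Phi> j x"
    unfolding \<Phi>_def b' bz by simp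
qed

end

section \<open>Gluing the pieces and the inequality off the semicircle\<close>

locale rotation_balanced = rotation_cut +
  assumes balanced: "(\<Sum>j<q. \<Phi> (int j) (d (int j)) - \<Phi> (int j + 1) (d (int j))) = 0"
begin

definition "jump j = \<Phi> j (d j) - \<Phi> (j + 1) (d j)"
text \<open>Constants that make neighbouring pieces agree at their common cut point. Periodicity is
  built in by \<open>mod\<close>, so the consistency condition moves to the wrap-around.\<close>

definition "a j = (\<Sum>i<nat (j mod int q). jump (int i))"
definition "\<phi> x = (let j = (SOME j. x \<in> piece j) in a j + \<Phi> j x)"

lemma jump_add_q: "jump (j + int q) = jump j"
  using Phi_add_q[of j "d j"] Phi_add_q[of "j + 1" "d j"]
  by (simp add: jump_def d_add_q algebra_simps)

lemma jump_mod: "jump (j mod int q) = jump j"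
proof -
  have "jump (i + int q * m) = jump i" for i m
  proof (induction m rule: int_induct[where k = 0])
    case (step1 m)
    then show ?case using jump_add_q[of "i + int q * m"] by (simp add: algebra_simps)
  next
    case (step2 m)
    then show ?case using jump_add_q[of "i + int q * (m - 1)"] by (simp add: algebra_simps)
  qed simp
  from this[of "j mod int q" "j div int q"] show ?thesis by (simp add: add.commute)
qed

lemma a_add_q: "a (j + int q) = a j"
  by (simp add: a_def)

lemma a_Suc: "a (j + 1) = a j + jump j"
proof -
  have m: "0 \<le> j mod int q" "j mod int q < int q" using q_pos by simp_all
  have s: "a j + jump j = (\<Sum>i<Suc (nat (j mod int q)). jump (int i))"
    using m by (simp add: a_def jump_mod)
  have mod: "(j + 1) mod int q = (j mod int q + 1) mod int q" by (simp add: mod_add_left_eq)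
  show ?thesis
  proof (cases "j mod int q + 1 = int q")
    case True
    then have "Suc (nat (j mod int q)) = q" using m by linarith
    \<comment> \<open>One full turn is completed here: the accumulated jumps return to 0 because of
      \<open>balanced\<close>.\<close>
    then have "a j + jump j = 0" using s balanced by (simp add: jump_def)
    moreover have "a (j + 1) = 0" unfolding a_def mod True by simp
    ultimately show ?thesis by simp
  next
    case False
    then have "(j + 1) mod int q = j mod int q + 1" using m unfolding mod by simp
    then have "nat ((j + 1) mod int q) = Suc (nat (j mod int q))" using m by simp
    then show ?thesis using s by (simp add: a_def)
  qed
qed

text \<open>The choice by \<open>SOME\<close> is harmless: distinct pieces meet at most in a cut
  point, and there \<open>a_Suc\<close> makes both values equal.\<close>

lemma phi_eq:
  assumes "x \<in> piece j"
  shows "\<phi> x = a j + \<Phi> j x"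
proof -
  have eq: "a i + \<Phi> i x = a j + \<Phi> j x" if "x \<in> piece i" "x \<in> piece j" "i < j" for i j
    using piece_cases[OF that] a_Suc[of i] by (simp add: jump_def)
  define i where "i = (SOME j. x \<in> piece j)"
  have "x \<in> piece i" unfolding i_def using assms by (rule someI)
  then have "a i + \<Phi> i x = a j + \<Phi> j x"
  proof (cases i j rule: linorder_cases)
    case less
    then show ?thesis using eq \<open>x \<in> piece i\<close> assms by blast
  next
    case greater
    then show ?thesis using eq[symmetric] \<open>x \<in> piece i\<close> assms by blast
  qed simp
  then show ?thesis by (simp add: \<phi>_def flip: i_def)
qed

lemma phi_add_1: "\<phi> (x + 1) = \<phi> x"
proof -
  obtain j where "x \<in> piece j" using ex_piece by blast
  then show ?thesis
    using phi_eq[of x j] phi_eq[of "x + 1" "j + int q"] by (simp add: piece_add_q a_add_q Phi_add_q)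
qed

lemma phi_add_int: "\<phi> (x + of_int k) = \<phi> x"
proof (induction k rule: int_induct[where k = 0])
  case (step1 i)
  then show ?case using phi_add_1[of "x + of_int i"] by (simp add: add.assoc)
next
  case (step2 i)
  then show ?case using phi_add_1[of "x + of_int (i - 1)"] by simp
qed simp

definition "\<beta>0 j = a j + lncos c (z j) - a (j + int p)"

lemma phi_double_aux:
  assumes "2 * x \<in> piece (j + int p)" "0 \<le> j" "j < int q"
  shows "\<phi> (2 * x) = \<phi> x + lncos c x - \<beta>0 j"
  using phi_eq[OF assms(1)] phi_eq[OF Phi_double(2)[OF assms]] Phi_double(1)[OF assms]
  by (simp add: \<beta>0_def)

text \<open>Neighbouring pieces share a cut point whose double is again a cut point and lies in both
  image pieces; comparing the two formulas for \<open>\<phi>\<close> there equates the constants.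
  The range \<open>j < q\<close> avoids crossing the largest gap, where the extra \<open>t\<close>
  would enter.\<close>

lemma beta0_const: "j < q \<Longrightarrow> \<beta>0 (int j) = \<beta>0 0"
proof (induction j)
  case (Suc j)
  have nd: "\<not> int q dvd int j + 1"
    using Suc.prems zdvd_imp_le[of "int q" "int j + 1"] by auto
  have dd: "2 * d (int j) = d (int j + int p)"
    using d_double[of "int j"] Suc.prems nd by simp
  have "2 * d (int j) \<in> piece (int j + int p)" "2 * d (int j) \<in> piece (int (Suc j) + int p)"
    unfolding dd using d_in_piece[of "int j + int p"] by (simp_all add: algebra_simps)
  from phi_double_aux[OF this(1)] phi_double_aux[OF this(2)] Suc
  show ?case by simp
qed simp

definition "\<beta> = \<beta>0 0"

lemma beta_mean: "real q * \<beta> = (\<Sum>j<q. lncos c (z (int j)))"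
proof -
  have "real q * \<beta> = (\<Sum>j<q. \<beta>0 (int j))"
    using beta0_const by (simp add: \<beta>_def)
  also have "\<dots> = (\<Sum>j<q. a (int j)) + (\<Sum>j<q. lncos c (z (int j))) - (\<Sum>j<q. a (int j + int p))"
    by (simp add: \<beta>0_def sum.distrib sum_subtractf)
  also have "(\<Sum>j<q. a (int j + int p)) = (\<Sum>j<q. a (int j))"
    by (rule sum_int_periodic_shift) (rule a_add_q)
  finally show ?thesis by simp
qed

lemma phi_double:
  assumes x: "x \<in> {\<theta>..\<theta> + 1/2}"
  shows "\<phi> (2 * x) = \<phi> x + lncos c x - \<beta>"
proof -
  have b: "d (int p - 1) \<le> 2 * x" "2 * x \<le> d (int p + int q - 1)"
    using x theta_double d_add_q[of "int p - 1"] by (auto simp: algebra_simps)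
  have "\<exists>j. 2 * x \<in> piece (j + int p) \<and> 0 \<le> j \<and> j < int q"
  \<comment> \<open>Tiles from \<open>ex_tile\<close> are open on the right and would assign the end
    of the turn to the next piece, outside the range of \<open>j\<close>; its closed left neighbour
    contains it too.\<close>
  proof (cases "2 * x = d (int p + int q - 1)")
    case True
    then show ?thesis using d_in_piece(1)[of "int p + int q - 1"] q_pos
      by (intro exI[of _ "int q - 1"]) (simp add: algebra_simps)
  next
    case False
    obtain k where k: "d (k - 1) \<le> 2 * x" "2 * x < d k" using ex_tile by blast
    have "d (int p - 1) < d k" "d (k - 1) < d (int p + int q - 1)" using b k False by linarith+
    then have "int p - 1 < k" "k - 1 < int p + int q - 1" by (simp_all add: d_less_iff)
    then show ?thesis using k by (intro exI[of _ "k - int p"]) (simp add: piece_def)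
  qed
  then obtain j where "2 * x \<in> piece (j + int p)" "0 \<le> j" "j < int q" by blast
  from phi_double_aux[OF this] beta0_const[of "nat j"] \<open>0 \<le> j\<close> \<open>j < int q\<close>
  show ?thesis by (simp add: \<beta>_def)
qed

lemma phi_bounded: "\<exists>B. \<forall>x. \<bar>\<phi> x\<bar> \<le> B"
proof -
  define B where "B = (\<Sum>j<q. \<bar>a (int j)\<bar>) + lip * (d (int q) - d (-1))"
  have lip: "lip \<ge> 0" by (simp add: lip_def)
  have "\<bar>\<phi> x\<bar> \<le> B" for x
  proof -
    obtain j where j: "x \<in> piece j" using ex_piece by blast
    define i where "i = nat (j mod int q)"
    have i: "i < q" "int i = j mod int q" using q_pos by (auto simp: i_def nat_less_iff)
    have "\<bar>a j\<bar> = \<bar>a (int i)\<bar>" by (simp add: a_def i)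
    also have "\<dots> \<le> (\<Sum>j<q. \<bar>a (int j)\<bar>)" using i by (intro member_le_sum) auto
    finally have "\<bar>a j\<bar> \<le> (\<Sum>j<q. \<bar>a (int j)\<bar>)" .
    moreover have "\<bar>x - z j\<bar> \<le> d j - d (j - 1)"
      using j z_in_piece[of j] by (auto simp: piece_def)
    moreover have "d j - d (j - 1) \<le> d (int q) - d (-1)"
    proof -
      have "j = int i + int q * (j div int q)" "j - 1 = (int i - 1) + int q * (j div int q)"
        by (simp_all add: i)
      then have "d j - d (j - 1) = d (int i) - d (int i - 1)" by (metis add_diff_cancel_right d_add_mult_q)
      also have "\<dots> \<le> d (int q) - d (-1)" using i d_mono[of "int i" "int q"] d_mono[of "-1" "int i - 1"] by simp
      finally show ?thesis .
    qed
    ultimately have "\<bar>\<Phi> j x\<bar> \<le> lip * (d (int q) - d (-1))"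
      using Phi_bound[OF j] mult_left_mono[OF _ lip, of "\<bar>x - z j\<bar>" "d (int q) - d (-1)"] by linarith
    then show ?thesis using \<open>\<bar>a j\<bar> \<le> _\<close> phi_eq[OF j] by (simp add: B_def)
  qed
  then show ?thesis by blast
qed

definition "\<psi> x = \<phi> x - \<phi> (x + 1/2)"

text \<open>The first preimages of \<open>x\<close> and \<open>x + 1/2\<close> in the semicircle differ by exactly \<open>1/4\<close>,
  which is why the first term of the series is estimated separately.\<close>

lemma psi_local:
  assumes uv: "u \<le> v" and u: "u \<in> piece j" "u + 1/2 \<in> piece k" and v: "v \<in> piece j" "v + 1/2 \<in> piece k"
  shows "\<bar>\<psi> v - \<psi> u\<bar> \<le> 39/20 * pi * (v - u)"
proof -
  define D where "D n = (lncos c (back (Suc n) j v) - lncos c (back (Suc n) j u))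
      - (lncos c (back (Suc n) k (v + 1/2)) - lncos c (back (Suc n) k (u + 1/2)))" for n
  have sD: "summable D" unfolding D_def by (intro summable_diff summable_back u v)
  have "\<psi> v - \<psi> u = (\<Phi> j v - \<Phi> j u) - (\<Phi> k (v + 1/2) - \<Phi> k (u + 1/2))"
    unfolding \<psi>_def using phi_eq u v by simp
  also have "\<dots> = suminf D"
    unfolding Phi_diff[OF u(1) v(1)] Phi_diff[OF u(2) v(2)] D_def
    by (intro suminf_diff summable_back u v)
  also have "\<dots> = D 0 + (\<Sum>n. D (Suc n))" using suminf_split_head[OF sD] by simp
  finally have eq: "\<psi> v - \<psi> u = D 0 + (\<Sum>n. D (Suc n))" .
  \<comment> \<open>Both differences are the same distance times a slope between
    \<open>g_min\<close> and \<open>g_max\<close>, so only the spread of the slopes enters and not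
    their size.\<close>
  have D_bound: "\<bar>D n\<bar> \<le> 12/5 * pi * (v - u) / 2 ^ Suc n" for n
  proof -
    have w: "(v + 1/2) - (u + 1/2) = v - u" by simp
    have "\<bar>D n\<bar> \<le> (v - u) / 2 ^ Suc n * (g_max - g_min)"
      unfolding D_def using back_diff_bounds[OF u(1) v(1) uv, of n]
        back_diff_bounds[OF u(2) v(2), of n] uv unfolding w
      by (simp only: right_diff_distrib) (auto simp: abs_le_iff)
    also have "\<dots> \<le> (v - u) / 2 ^ Suc n * (12/5 * pi)"
      using uv g_range by (intro mult_left_mono) auto
    finally show ?thesis by (simp add: mult_ac)
  qed
  have "\<bar>D (Suc n)\<bar> \<le> (6/5 * pi * (v - u)) / 2 ^ Suc n" for n
    using D_bound[of "Suc n"] by simp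
  note tail = this
  have s: "summable (\<lambda>n. \<bar>D (Suc n)\<bar>)"
    by (rule summable_comparison_test'[OF summable_geo[of "6/5 * pi * (v - u)"], of 0]) (use tail in simp)
  have "\<bar>\<Sum>n. D (Suc n)\<bar> \<le> (\<Sum>n. \<bar>D (Suc n)\<bar>)" by (rule summable_rabs[OF s])
  also have "\<dots> \<le> (\<Sum>n. (6/5 * pi * (v - u)) / 2 ^ Suc n)" by (rule suminf_le[OF tail s summable_geo])
  finally have t: "\<bar>\<Sum>n. D (Suc n)\<bar> \<le> 6/5 * pi * (v - u)" by (simp only: suminf_geo)
  have h: "\<bar>D 0\<bar> \<le> 3/4 * pi * (v - u)"
  proof -
    define m m' where "m = (j - int p) div int q" and "m' = (k - int p) div int q"
    define U V U' V' where "U = back 1 j u - of_int m" and "V = back 1 j v - of_int m"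
      and "U' = back 1 k (u + 1/2) - of_int m'" and "V' = back 1 k (v + 1/2) - of_int m'"
    have in_K: "U \<in> {\<theta>..\<theta> + 1/2}" "V \<in> {\<theta>..\<theta> + 1/2}" "U' \<in> {\<theta>..\<theta> + 1/2}" "V' \<in> {\<theta>..\<theta> + 1/2}"
      unfolding U_def V_def U'_def V'_def m_def m'_def by (intro back_1_in(2) u v)+
    have D0: "D 0 = (lncos c V - lncos c U) - (lncos c V' - lncos c U')"
      by (simp add: D_def U_def V_def U'_def V'_def lncos_diff_int)
    have eqs: "U = (u - of_int m) / 2" "V = (v - of_int m) / 2"
      "U' = (u - of_int m') / 2 + 1/4" "V' = (v - of_int m') / 2 + 1/4"
      unfolding U_def V_def U'_def V'_def back_1_eq m_def[symmetric] m'_def[symmetric]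
      by (simp_all add: field_simps)
    \<comment> \<open>The two preimages differ by \<open>1/4\<close> modulo \<open>1/2\<close> and
      lie in an interval of length \<open>1/2\<close>, so the difference is \<open>1/4\<close> or
      \<open>- 1/4\<close>.\<close>
    have "U' - U = (of_int m - of_int m') / 2 + 1/4" unfolding eqs by (simp add: field_simps)
    moreover have "\<bar>U' - U\<bar> \<le> 1/2" using in_K unfolding atLeastAtMost_iff by linarith
    ultimately have s: "\<bar>(of_int m - of_int m') / 2 + 1/4\<bar> \<le> (1/2::real)" by simp
    have "\<bar>s / 2 + 1/4\<bar> \<le> 1/2 \<Longrightarrow> s < 1 \<and> - 2 < s" for s :: real by linarith
    from this[OF s] have "m - m' \<le> 0" "m - m' \<ge> -1" by linarith+
    then consider "m' = m" | "m' = m + 1" by linarith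
    then show ?thesis
    proof cases
      case 1
      then have e: "U' = U + 1/4" "V' = V + 1/4" unfolding eqs by simp_all
      have "U \<le> V" "V - U = (v - u) / 2" unfolding eqs using uv by (simp_all add: field_simps)
      moreover have "-1/3 \<le> U - c" "V - c \<le> 1/12" using in_K e theta_tol unfolding atLeastAtMost_iff by linarith+
      ultimately have "\<bar>(lncos c V - lncos c U) - (lncos c (V + 1/4) - lncos c (U + 1/4))\<bar> \<le> 3/2 * pi * ((v - u) / 2)"
        using lncos_quarter_diff[of U V c] by metis
      then show ?thesis unfolding D0 e by (simp add: abs_minus_commute)
    next
      case 2
      then have e: "U = U' + 1/4" "V = V' + 1/4" unfolding eqs by (simp_all add: field_simps)
      have "U' \<le> V'" "V' - U' = (v - u) / 2" unfolding eqs using uv by (simp_all add: field_simps)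
      moreover have "-1/3 \<le> U' - c" "V' - c \<le> 1/12" using in_K e theta_tol unfolding atLeastAtMost_iff by linarith+
      ultimately have "\<bar>(lncos c V' - lncos c U') - (lncos c (V' + 1/4) - lncos c (U' + 1/4))\<bar> \<le> 3/2 * pi * ((v - u) / 2)"
        using lncos_quarter_diff[of U' V' c] by metis
      then show ?thesis unfolding D0 e by (simp add: abs_minus_commute)
    qed
  qed
  show ?thesis unfolding eq using h t by linarith
qed

text \<open>\<open>psi_local\<close> compares points only if they share a piece and their antipodes
  do. Bolzano's principle reduces the claim to short intervals around a point \<open>x\<close>: the
  part left of \<open>x\<close> lies in the pieces covering left neighbourhoods of \<open>x\<close>
  and \<open>x + 1/2\<close>, the part to the right in possibly different ones, and the two
  estimates add up.\<close>

lemma psi_lipschitz: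
  assumes "u \<le> v"
  shows "\<bar>\<psi> v - \<psi> u\<bar> \<le> 39/20 * pi * (v - u)"
proof -
  have "\<exists>j. x \<in> {d (j - 1)<..d j}" for x
  proof -
    obtain j where j: "d (j - 1) \<le> x" "x < d j" using ex_tile by blast
    show ?thesis
    proof (cases "d (j - 1) = x")
      case True
      then show ?thesis using d_less_Suc[of "j - 2"] by (intro exI[of _ "j - 1"]) simp
    next
      case False
      with j show ?thesis by (intro exI[of _ j]) simp
    qed
  qed
  note left_tile = this
  from assms show ?thesis
  proof (induction rule: Bolzano)
    case (trans a b c)
    have "39/20 * pi * (c - a) = 39/20 * pi * (b - a) + 39/20 * pi * (c - b)" unfolding distrib_left[symmetric] by simp
    then show ?case using trans(1,2) by linarith
  next
    case (local x)
    obtain j k where jk: "x \<in> {d (j - 1)<..d j}" "x + 1/2 \<in> {d (k - 1)<..d k}"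
      using left_tile by blast
    obtain j' k' where jk': "d (j' - 1) \<le> x" "x < d j'" "d (k' - 1) \<le> x + 1/2" "x + 1/2 < d k'"
      using ex_tile by blast
    define e where "e = Min {x - d (j - 1), x + 1/2 - d (k - 1), d j' - x, d k' - (x + 1/2)}"
    have "e > 0" using jk jk' by (simp add: e_def)
    moreover have "\<bar>\<psi> b - \<psi> a\<bar> \<le> 39/20 * pi * (b - a)" if ab: "a \<le> x" "x \<le> b" "b - a < e" for a b
    proof -
      have "e \<le> x - d (j - 1)" "e \<le> x + 1/2 - d (k - 1)" "e \<le> d j' - x" "e \<le> d k' - (x + 1/2)"
        by (simp_all add: e_def)
      then have "a \<in> piece j" "a + 1/2 \<in> piece k" "x \<in> piece j" "x + 1/2 \<in> piece k"
        "x \<in> piece j'" "x + 1/2 \<in> piece k'" "b \<in> piece j'" "b + 1/2 \<in> piece k'"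
        using ab jk jk' by (auto simp: piece_def)
      then have "\<bar>\<psi> x - \<psi> a\<bar> \<le> 39/20 * pi * (x - a)" "\<bar>\<psi> b - \<psi> x\<bar> \<le> 39/20 * pi * (b - x)"
        using psi_local ab by blast+
      moreover have "39/20 * pi * (b - a) = 39/20 * pi * (x - a) + 39/20 * pi * (b - x)" unfolding distrib_left[symmetric] by simp
      ultimately show ?thesis by linarith
    qed
    ultimately show ?case by blast
  qed
qed

text \<open>The difference \<open>E\<close> of the two sides vanishes at both ends of the
  semicircle, because their doubles agree modulo 1 and the functional equation holds at both. From
  either end towards \<open>c\<close> the logarithmic part gains at least \<open>2 * pi\<close> per
  unit, while \<open>\<psi>\<close> varies by at most \<open>39/20 * pi\<close>. The point
  \<open>c\<close> is excluded since its antipode is a zero of the cosine, where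
  \<open>lncos\<close> takes its default value.\<close>

lemma off_semicircle:
  assumes x: "x \<in> {\<theta>..\<theta> + 1/2}" and "x \<noteq> c"
  shows "\<phi> (x + 1/2) + lncos c (x + 1/2) \<le> \<phi> x + lncos c x"
proof -
  define E where "E x = \<psi> x + (lncos c x - lncos c (x + 1/2))" for x
  have tol: "\<bar>\<theta> - c + 1/4\<bar> < 1/12" by (rule theta_tol)
  have "\<phi> (2 * (\<theta> + 1/2)) = \<phi> (2 * \<theta>)" using phi_add_1[of "2 * \<theta>"] by (simp add: algebra_simps)
  then have E0: "E \<theta> = 0"
    using phi_double[of \<theta>] phi_double[of "\<theta> + 1/2"] by (simp add: E_def \<psi>_def)
  have "E (\<theta> + 1/2) = - E \<theta>"
    using phi_add_1[of \<theta>] lncos_add_1[of c \<theta>] by (simp add: E_def \<psi>_def add.assoc)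
  with E0 have E1: "E (\<theta> + 1/2) = 0" by simp
  have gap: "39/20 * pi * l \<le> 2 * pi * l" if "l \<ge> 0" for l :: real
    using that by (intro mult_right_mono) auto
  have "E x \<ge> 0"
  proof (cases "x < c")
    case True
    then have "2 * pi * (x - \<theta>) \<le> (lncos c x - lncos c (x + 1/2)) - (lncos c \<theta> - lncos c (\<theta> + 1/2))"
      using x tol True unfolding atLeastAtMost_iff by (intro lncos_half_diff) linarith+
    moreover have "\<bar>\<psi> x - \<psi> \<theta>\<bar> \<le> 2 * pi * (x - \<theta>)"
      by (rule order_trans[OF psi_lipschitz gap]) (use x in simp_all)
    ultimately show ?thesis using E0 unfolding E_def by linarith
  next
    case False
    have shift: "lncos c (y - 1/2 + 1/2) - lncos c (y - 1/2) = lncos c y - lncos c (y + 1/2)" for y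
    proof -
      have "y - 1/2 + 1 = y + 1/2" "y - 1/2 + 1/2 = y" by simp_all
      then show ?thesis using lncos_add_1[of c "y - 1/2"] by (simp only:)
    qed
    have "2 * pi * ((\<theta> + 1/2 - 1/2) - (x - 1/2)) \<le>
        (lncos c (\<theta> + 1/2 - 1/2) - lncos c (\<theta> + 1/2 - 1/2 + 1/2)) - (lncos c (x - 1/2) - lncos c (x - 1/2 + 1/2))"
      using x tol False \<open>x \<noteq> c\<close> unfolding atLeastAtMost_iff by (intro lncos_half_diff) linarith+
    then have "2 * pi * (\<theta> + 1/2 - x) \<le> (lncos c x - lncos c (x + 1/2)) - (lncos c (\<theta> + 1/2) - lncos c (\<theta> + 1/2 + 1/2))"
      using shift[of x] shift[of "\<theta> + 1/2"] by (simp add: algebra_simps)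
    moreover have "\<bar>\<psi> (\<theta> + 1/2) - \<psi> x\<bar> \<le> 2 * pi * (\<theta> + 1/2 - x)"
      by (rule order_trans[OF psi_lipschitz gap]) (use x in simp_all)
    ultimately show ?thesis using E1 unfolding E_def by linarith
  qed
  then show ?thesis by (simp add: E_def \<psi>_def)
qed

lemma subaction:
  "\<bar>cos (pi * (x - c))\<bar> * exp (\<phi> x) \<le> exp \<beta> * exp (\<phi> (2 * x))"
proof (cases "cos (pi * (x - c)) = 0")
  case False
  have le: "\<phi> y + lncos c y \<le> \<beta> + \<phi> (2 * y)" if y: "y \<in> {\<theta>..<\<theta> + 1}" "cos (pi * (y - c)) \<noteq> 0" for y
  proof (cases "y \<le> \<theta> + 1/2")
    case True
    then show ?thesis using phi_double[of y] y by simp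
  next
    case False
    \<comment> \<open>Beyond the semicircle \<open>y\<close> is compared with its antipode, which
      lies on the semicircle and has the same double modulo 1.\<close>
    define x where "x = y - 1/2"
    have x: "x \<in> {\<theta>..\<theta> + 1/2}" using y False by (auto simp: x_def)
    have "x \<noteq> c" using y(2) by (auto simp: x_def)
    have "\<phi> (2 * y) = \<phi> (2 * x)" using phi_add_1[of "2 * x"] by (simp add: x_def)
    then show ?thesis using phi_double[OF x] off_semicircle[OF x \<open>x \<noteq> c\<close>] by (simp add: x_def)
  qed
  define k where "k = \<lfloor>x - \<theta>\<rfloor>"
  define y where "y = x - of_int k"
  have y: "y \<in> {\<theta>..<\<theta> + 1}" unfolding y_def k_def by (simp; linarith)
  have "\<bar>cos (pi * ((y - c) + of_int k))\<bar> = \<bar>cos (pi * (y - c))\<bar>" by (rule abs_cos_pi_add_int)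
  then have "cos (pi * (y - c)) \<noteq> 0" using False by (auto simp: y_def)
  from le[OF y this] have "\<phi> y + lncos c y \<le> \<beta> + \<phi> (2 * y)" .
  moreover have "\<phi> y = \<phi> x" "\<phi> (2 * y) = \<phi> (2 * x)" "lncos c y = lncos c x"
    using phi_add_int[of y k] phi_add_int[of "2 * y" "2 * k"] lncos_add_int[of c y k]
    by (simp_all add: y_def algebra_simps)
  ultimately have "exp (lncos c x + \<phi> x) \<le> exp (\<beta> + \<phi> (2 * x))" by simp
  then show ?thesis unfolding exp_add exp_lncos[OF False] .
qed simp

end

section \<open>The sign of the obstruction\<close>

text \<open>The mixed derivative of \<open>ln (cos (pi * (x - c)))\<close> in \<open>x\<close> and
  \<open>c\<close> is positive. Exponentiated, the claim compares two products of cosines whose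
  difference is \<open>sin (pi * (r - l)) * sin (pi * (c2 - c1))\<close>.\<close>

lemma lncos_diff_mono_param:
  assumes lr: "l \<le> r" and c: "c1 \<le> c2"
    and h: "c2 - l < 1/2" "r - c1 < 1/2"
  shows "lncos c1 r - lncos c1 l \<le> lncos c2 r - lncos c2 l"
proof -
  have ab: "\<bar>l - c1\<bar> < 1/2" "\<bar>l - c2\<bar> < 1/2" "\<bar>r - c1\<bar> < 1/2" "\<bar>r - c2\<bar> < 1/2"
    using assms by linarith+
  have pos: "cos (pi * (l - c1)) > 0" "cos (pi * (l - c2)) > 0" "cos (pi * (r - c1)) > 0" "cos (pi * (r - c2)) > 0"
    using ab by (simp_all only: cos_pi_pos)
  have "0 \<le> sin (pi * (r - l))" "0 \<le> sin (pi * (c2 - c1))"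
    using assms by (intro sin_ge_zero mult_nonneg_nonneg; simp)+
  then have "0 \<le> sin (pi * (r - l)) * sin (pi * (c2 - c1))" by simp
  also have "\<dots> = cos (pi * (r - c2)) * cos (pi * (l - c1)) - cos (pi * (r - c1)) * cos (pi * (l - c2))"
    unfolding right_diff_distrib sin_diff cos_diff by (simp add: algebra_simps sin_squared_eq power2_eq_square)
  finally have "cos (pi * (r - c1)) * cos (pi * (l - c2)) \<le> cos (pi * (r - c2)) * cos (pi * (l - c1))" by simp
  then have "ln (cos (pi * (r - c1)) * cos (pi * (l - c2))) \<le> ln (cos (pi * (r - c2)) * cos (pi * (l - c1)))"
    using pos by simp
  then show ?thesis
    using pos by (simp add: lncos_eq[OF ab(1)] lncos_eq[OF ab(2)] lncos_eq[OF ab(3)] lncos_eq[OF ab(4)] ln_mult)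
qed

lemma lncos_chord_left:
  assumes "z - A \<le> l" "l \<le> z" "\<bar>z - A - c\<bar> < 1/2" "\<bar>z - c\<bar> < 1/2"
  shows "A * (lncos c z - lncos c l) \<le> (z - l) * (lncos c z - lncos c (z - A))"
proof -
  define g where "g = - pi * tan (pi * (l - c))"
  have l: "\<bar>l - c\<bar> < 1/2" using assms by linarith
  have "lncos c z - lncos c l \<le> (z - l) * g" "(l - (z - A)) * g \<le> lncos c l - lncos c (z - A)"
    unfolding g_def using assms l by (intro lncos_diff_bounds; simp)+
  then have "(l - (z - A)) * (lncos c z - lncos c l) \<le> (l - (z - A)) * ((z - l) * g)"
    "(z - l) * ((l - (z - A)) * g) \<le> (z - l) * (lncos c l - lncos c (z - A))"
    using assms by (intro mult_left_mono; simp)+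
  then show ?thesis by (simp add: algebra_simps)
qed

lemma lncos_chord_right:
  assumes "z \<le> r" "r \<le> z + A" "\<bar>z + A - c\<bar> < 1/2" "\<bar>z - c\<bar> < 1/2"
  shows "(r - z) * (lncos c (z + A) - lncos c z) \<le> A * (lncos c r - lncos c z)"
proof -
  define g where "g = - pi * tan (pi * (r - c))"
  have l: "\<bar>r - c\<bar> < 1/2" using assms by linarith
  have "lncos c (z + A) - lncos c r \<le> (z + A - r) * g" "(r - z) * g \<le> lncos c r - lncos c z"
    unfolding g_def using assms l by (intro lncos_diff_bounds; simp)+
  then have "(r - z) * (lncos c (z + A) - lncos c r) \<le> (r - z) * ((z + A - r) * g)"
    "(z + A - r) * ((r - z) * g) \<le> (z + A - r) * (lncos c r - lncos c z)"
    using assms by (intro mult_left_mono; simp)+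
  then show ?thesis by (simp add: algebra_simps)
qed

text \<open>Slopes of secants of a concave function decrease as their ends move to the right. The
  part right of \<open>z\<close> is compared through the tangent at \<open>z\<close>, the part left
  of it by the chord estimate.\<close>

lemma lncos_secant_left:
  assumes A: "A > 0" and ab: "0 \<le> a" "0 \<le> b" "b \<le> A"
    and c: "\<bar>z - A - c\<bar> < 1/2" "\<bar>z + a - c\<bar> < 1/2"
  shows "A * (lncos c (z + a) - lncos c (z - b)) \<le> (a + b) * (lncos c z - lncos c (z - A))"
proof -
  define g where "g = - pi * tan (pi * (z - c))"
  have z: "\<bar>z - c\<bar> < 1/2" using assms by linarith
  have "lncos c (z + a) - lncos c z \<le> a * g"
    using lncos_diff_bounds(1)[of z "z + a" z "z + a" c] z c ab by (simp add: g_def)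
  moreover have "A * g \<le> lncos c z - lncos c (z - A)"
    using lncos_diff_bounds(2)[of "z - A" z "z - A" z c] z c A by (simp add: g_def)
  ultimately have "A * (lncos c (z + a) - lncos c z) \<le> A * (a * g)"
    "a * (A * g) \<le> a * (lncos c z - lncos c (z - A))"
    using A ab by (intro mult_left_mono; simp)+
  then have "A * (lncos c (z + a) - lncos c z) \<le> a * (lncos c z - lncos c (z - A))"
    by (simp add: mult.left_commute)
  moreover have "A * (lncos c z - lncos c (z - b)) \<le> b * (lncos c z - lncos c (z - A))"
    using lncos_chord_left[of z A "z - b" c] z c ab by simp
  ultimately show ?thesis by (simp add: algebra_simps)
qed

lemma lncos_secant_right:
  assumes A: "A > 0" and ab: "0 \<le> a" "0 \<le> b" "a \<le> A"
    and c: "\<bar>z - b - c\<bar> < 1/2" "\<bar>z + A - c\<bar> < 1/2"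
  shows "(a + b) * (lncos c (z + A) - lncos c z) \<le> A * (lncos c (z + a) - lncos c (z - b))"
proof -
  define g where "g = - pi * tan (pi * (z - c))"
  have z: "\<bar>z - c\<bar> < 1/2" using assms by linarith
  have "b * g \<le> lncos c z - lncos c (z - b)"
    using lncos_diff_bounds(2)[of "z - b" z "z - b" z c] z c ab by (simp add: g_def)
  moreover have "lncos c (z + A) - lncos c z \<le> A * g"
    using lncos_diff_bounds(1)[of z "z + A" z "z + A" c] z c A by (simp add: g_def)
  ultimately have "A * (b * g) \<le> A * (lncos c z - lncos c (z - b))"
    "b * (lncos c (z + A) - lncos c z) \<le> b * (A * g)"
    using A ab by (intro mult_left_mono; simp)+
  then have "b * (lncos c (z + A) - lncos c z) \<le> A * (lncos c z - lncos c (z - b))"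
    by (simp add: mult.left_commute)
  moreover have "a * (lncos c (z + A) - lncos c z) \<le> A * (lncos c (z + a) - lncos c z)"
    using lncos_chord_right[of z "z + a" A c] z c ab by simp
  ultimately show ?thesis by (simp add: algebra_simps)
qed

text \<open>A series that is constant on blocks of length \<open>q\<close> and starts inside the
  first block, with \<open>e\<close> of its entries skipped.\<close>

lemma suminf_div_blocks:
  fixes x :: "nat \<Rightarrow> real"
  assumes q: "q > 0" and e: "e \<le> q" and s: "summable (\<lambda>n. x ((n + e) div q))"
  shows "summable x"
    and "(\<Sum>n. x ((n + e) div q)) = real (q - e) * x 0 + real q * (\<Sum>k. x (Suc k))"
proof -
  have s': "summable (\<lambda>n. x (n div q))" using s by (simp add: summable_iff_shift[of "\<lambda>n. x (n div q)" e])
  have "(\<Sum>i = k * q..<k * q + q. x (i div q)) = real q * x k" for k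
  proof -
    have "(\<Sum>i = k * q..<k * q + q. x (i div q)) = (\<Sum>i = k * q..<k * q + q. x k)"
    proof (intro sum.cong refl)
      fix i assume "i \<in> {k * q..<k * q + q}"
      then have "i div q = k" by (intro div_nat_eqI) (auto simp: algebra_simps)
      then show "x (i div q) = x k" by simp
    qed
    then show ?thesis by simp
  qed
  with sums_group[OF summable_sums[OF s'] q]
  have g: "(\<lambda>k. real q * x k) sums (\<Sum>n. x (n div q))" by simp
  then have "summable (\<lambda>k. real q * x k)" by (simp add: sums_iff)
  then show sx: "summable x" using q by (auto dest: summable_mult_D)
  have "(\<Sum>n. x (n div q)) = real q * suminf x"
    using g sx by (simp add: sums_iff suminf_mult)
  also have "suminf x = x 0 + (\<Sum>k. x (Suc k))" using suminf_split_head[OF sx] by simp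
  moreover have "(\<Sum>n. x (n div q)) = (\<Sum>n. x ((n + e) div q)) + (\<Sum>n<e. x (n div q))"
    using suminf_split_initial_segment[OF s', of e] by simp
  moreover have "(\<Sum>n<e. x (n div q)) = real e * x 0"
    using e by (simp add: sum.cong[of "{..<e}" "{..<e}" "\<lambda>n. x (n div q)" "\<lambda>n. x 0"])
  ultimately show "(\<Sum>n. x ((n + e) div q)) = real (q - e) * x 0 + real q * (\<Sum>k. x (Suc k))"
    using e by (simp add: of_nat_diff algebra_simps)
qed

section \<open>The obstruction as a series and its block structure\<close>

context rotation
begin

text \<open>Pulling back \<open>n\<close> times along the orbit into \<open>z i\<close> shrinks the
  gap on its right to \<open>offset n i\<close> and the gap on its left to
  \<open>offset n (i - 1)\<close>.\<close>

definition "offset n i = gap (i + int n * int p) / 2 ^ n"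

lemma gap_le_1: "gap i \<le> 1"
proof -
  have "(2::real) ^ (q - 1 - idx i) \<le> 2 ^ (q - 1)" by (intro power_increasing) auto
  moreover have "(2::real) ^ (q - 1) \<le> M" using power_q one_le_power[of "2::real" "q - 1"] by linarith
  ultimately have "2 ^ (q - 1 - idx i) \<le> M" by (rule order_trans)
  then show ?thesis using M_ge_1 by (simp add: gap_eq divide_le_eq)
qed

lemma offset_bounds: "0 < offset n i" "offset n i \<le> 1 / 2 ^ n"
  using gap_pos gap_le_1 by (simp_all add: offset_def divide_right_mono)

lemma offset_add_q: "offset n (i + int q) = offset n i"
  using gap_add_q[of "i + int n * int p"] by (simp add: offset_def algebra_simps)

lemma idx_add_q: "idx (j + int q) = idx j"
proof (rule idx_eqI[OF idx_less])
  have "j + int q + 1 + int (idx j) * int p = (j + 1 + int (idx j) * int p) + int q" by simp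
  then show "int q dvd j + int q + 1 + int (idx j) * int p" using idx_dvd[of j] by (simp only: dvd_add_triv_right_iff)
qed

lemma dvd_iff_idx: "int q dvd i + 1 + int n * int p \<longleftrightarrow> n mod q = idx i"
proof -
  define a b where "a = n div q" and "b = n mod q"
  have "n = q * a + b" by (simp add: a_def b_def)
  then have "i + 1 + int n * int p = (i + 1 + int b * int p) + int q * (int a * int p)"
    by (simp add: algebra_simps)
  then have "i + 1 + int n * int p = (i + 1 + int (n mod q) * int p) + int q * (int (n div q) * int p)"
    by (simp only: a_def b_def)
  moreover have "int q dvd x + int q * y \<longleftrightarrow> int q dvd x" for x y by (simp add: dvd_add_left_iff)
  ultimately have "int q dvd i + 1 + int n * int p \<longleftrightarrow> int q dvd i + 1 + int (n mod q) * int p"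
    by (simp only:)
  also have "\<dots> \<longleftrightarrow> n mod q = idx i"
    using idx_eqI[of "n mod q" i] idx_dvd[of i] q_pos by auto
  finally show ?thesis .
qed

lemma offset_Suc: "offset (Suc n) i = offset n i / (if n mod q = idx i then 2 ^ q else 1)"
proof -
  have eq: "i + int (Suc n) * int p = (i + int n * int p) + int p" by (simp add: algebra_simps)
  have dvd: "int q dvd (i + int n * int p) + 1 \<longleftrightarrow> n mod q = idx i"
    using dvd_iff_idx[of i n] by (simp add: algebra_simps)
  show ?thesis
  proof (cases "n mod q = idx i")
    case False
    then have "gap (i + int n * int p + int p) = 2 * gap (i + int n * int p)"
      using gap_double[of "i + int n * int p"] dvd by simp
    then show ?thesis using False unfolding offset_def eq by simp
  next
    case True
    have "idx (i + int n * int p) = 0" using True dvd q_pos by (intro idx_eqI) auto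
    then have g: "gap (i + int n * int p) = 2 ^ (q - 1) / M" by (simp add: gap_eq)
    have "gap (i + int n * int p + int p) = 2 * gap (i + int n * int p) - 1"
      using gap_double[of "i + int n * int p"] True dvd by simp
    also have "\<dots> = 2 * gap (-1) - 1" by (simp add: g gap_last)
    also have "\<dots> = 1 / M" using gap_double[of "-1"] gap_p by simp
    finally have "gap (i + int n * int p + int p) = 1 / M" .
    moreover have "1 / (2 * N - 1) / (2 * m) = N / (2 * N - 1) / m / (2 * N)" if "N \<ge> 1" for N m :: real
      using that by simp
    from this[of "2 ^ (q - 1)" "2 ^ n"] have "1 / M / (2 * 2 ^ n) = 2 ^ (q - 1) / M / 2 ^ n / 2 ^ q"
      unfolding power_q by simp
    ultimately show ?thesis using True unfolding offset_def eq g by simp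
  qed
qed

text \<open>Pulling back halves distances, but the gap that is pulled back doubles as
  \<open>n\<close> grows. The effects cancel except when the largest gap is passed, once in
  \<open>q\<close> steps, and then the offset drops by \<open>2 ^ q\<close>.\<close>

lemma offset_eq: "offset n i = gap i / 2 ^ (q * ((n + (q - 1 - idx i)) div q))"
proof (induction n)
  case 0
  have "(q - 1 - idx i) div q = 0" using q_pos by simp
  then show ?case by (simp add: offset_def)
next
  case (Suc n)
  let ?m = "n + (q - 1 - idx i)"
  have "Suc ?m mod q = 0 \<longleftrightarrow> n mod q = idx i"
  proof -
    have "Suc ?m + idx i = n + q" using idx_less[of i] by simp
    then have "int (Suc ?m) = (int n - int (idx i)) + int q" by linarith
    then have "int q dvd int (Suc ?m) \<longleftrightarrow> int q dvd int n - int (idx i)"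
      by (simp only: dvd_add_triv_right_iff)
    also have "\<dots> \<longleftrightarrow> int n mod int q = int (idx i) mod int q" by (simp add: mod_eq_dvd_iff)
    also have "\<dots> \<longleftrightarrow> n mod q = idx i mod q" by (metis of_nat_eq_iff of_nat_mod)
    finally show ?thesis using idx_less[of i] by (metis dvd_eq_mod_eq_0 int_dvd_int_iff mod_less)
  qed
  then show ?case
    unfolding offset_Suc Suc by (simp add: div_Suc power_add)
qed

definition "series t c = (\<Sum>n. \<Sum>i<q. lncos c (z (int i) + t * offset (Suc n) (int i))
  - lncos c (z (int i) - (1 - t) * offset (Suc n) (int i - 1)))"

end

context rotation_cut
begin

lemma d_eq: "d (j - 1) = z j - (1 - t) * gap (j - 1)"
  by (simp add: d_def gap_def algebra_simps)

lemma back_d: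
  "back n (i + int n * int p) (d (i + int n * int p)) = z i + t * offset n i"
  "back n (i + int n * int p) (d (i + int n * int p - 1)) = z i - (1 - t) * offset n (i - 1)"
  unfolding back_def d_eq offset_def by (simp_all add: d_def diff_divide_distrib algebra_simps)

lemma offset_in_K:
  "z i + t * offset (Suc n) i - of_int (i div int q) \<in> {\<theta>..\<theta> + 1/2}"
  "z i - (1 - t) * offset (Suc n) (i - 1) - of_int (i div int q) \<in> {\<theta>..\<theta> + 1/2}"
proof -
  let ?j = "i + int (Suc n) * int p"
  have "d ?j \<in> piece ?j" "d (?j - 1) \<in> piece ?j" using d_in_piece[of ?j] d_in_piece[of "?j - 1"] by simp_all
  from this[THEN back_in_K, of n]
  show "z i + t * offset (Suc n) i - of_int (i div int q) \<in> {\<theta>..\<theta> + 1/2}"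
    "z i - (1 - t) * offset (Suc n) (i - 1) - of_int (i div int q) \<in> {\<theta>..\<theta> + 1/2}"
    unfolding back_d by simp_all
qed

lemma z_in_K: "z i - of_int (i div int q) \<in> {\<theta>..\<theta> + 1/2}"
  using back_in_K[OF z_in_piece[of "i + int p"], of 0] unfolding back_z by simp

text \<open>A cyclic shift pairs the values of one \<open>\<Phi> j\<close> at both ends of its own
  piece, so the normalisation at \<open>z j\<close> cancels. A second shift, by
  \<open>Suc n * p\<close>, labels each term by the orbit point next to the preimages instead of the
  one they come from.\<close>

lemma series_eq:
  "(\<Sum>j<q. \<Phi> (int j) (d (int j)) - \<Phi> (int j + 1) (d (int j))) = series t c"
proof -
  define F where "F j = \<Phi> j (d (j - 1))" for j
  have "F (j + int q) = F j" for j
    using Phi_add_q[of j "d (j - 1)"] d_add_q[of "j - 1"] by (simp add: F_def algebra_simps)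
  then have "(\<Sum>j<q. F (int j + 1)) = (\<Sum>j<q. F (int j))" by (rule sum_int_periodic_shift)
  then have "(\<Sum>j<q. \<Phi> (int j) (d (int j)) - \<Phi> (int j + 1) (d (int j)))
      = (\<Sum>j<q. \<Phi> (int j) (d (int j)) - \<Phi> (int j) (d (int j - 1)))"
    by (simp add: F_def sum_subtractf)
  also have "\<dots> = (\<Sum>j<q. \<Sum>n. lncos c (back (Suc n) (int j) (d (int j)))
      - lncos c (back (Suc n) (int j) (d (int j - 1))))"
    by (intro sum.cong refl Phi_diff) (use d_in_piece(2)[of "_ - 1"] d_in_piece(1) in simp_all)
  also have "\<dots> = (\<Sum>n. \<Sum>j<q. lncos c (back (Suc n) (int j) (d (int j)))
      - lncos c (back (Suc n) (int j) (d (int j - 1))))"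
    by (intro suminf_sum[symmetric] summable_back) (use d_in_piece(2)[of "_ - 1"] d_in_piece(1) in simp_all)
  also have "\<dots> = series t c"
    unfolding series_def
  proof (intro arg_cong[of _ _ suminf] ext)
    fix n
    define G where "G i = lncos c (z i + t * offset (Suc n) i) - lncos c (z i - (1 - t) * offset (Suc n) (i - 1))" for i
    have per: "G (i + int q) = G i" for i
    proof -
      have "z i + 1 + t * offset (Suc n) i = (z i + t * offset (Suc n) i) + 1"
        "z i + 1 - (1 - t) * offset (Suc n) (i - 1) = (z i - (1 - t) * offset (Suc n) (i - 1)) + 1"
        "offset (Suc n) (i + int q - 1) = offset (Suc n) (i - 1)"
        using offset_add_q[of "Suc n" "i - 1"] by (simp_all add: algebra_simps)
      then show ?thesis unfolding G_def z_add_q offset_add_q by (simp only: lncos_add_1)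
    qed
    have "lncos c (back (Suc n) j (d j)) - lncos c (back (Suc n) j (d (j - 1))) = G (j + (- int (Suc n) * int p))" for j
    proof -
      define i where "i = j + (- int (Suc n) * int p)"
      have "i + int (Suc n) * int p = j" by (simp add: i_def algebra_simps)
      then show ?thesis using back_d[of "Suc n" i] unfolding i_def[symmetric] G_def by (simp only:)
    qed
    then show "(\<Sum>j<q. lncos c (back (Suc n) (int j) (d (int j))) - lncos c (back (Suc n) (int j) (d (int j - 1))))
        = (\<Sum>i<q. lncos c (z (int i) + t * offset (Suc n) (int i))
            - lncos c (z (int i) - (1 - t) * offset (Suc n) (int i - 1)))"
      using sum_int_periodic_shift[of G, OF per] by (simp only: G_def[symmetric])
  qed
  finally show ?thesis .
qed

lemma offset_summable:
  "summable (\<lambda>n. lncos c (z i + t * offset (Suc n) i) - lncos c (z i))"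
  "summable (\<lambda>n. lncos c (z i - (1 - t) * offset (Suc n) (i - 1)) - lncos c (z i))"
proof -
  have lip: "lip \<ge> 0" by (simp add: lip_def)
  have 1: "\<bar>d j - z j\<bar> \<le> 1" for j
  proof -
    have "t * gap j \<le> 1 * 1" using t01 gap_le_1[of j] gap_pos[of j] by (intro mult_mono) auto
    then show ?thesis using t01 gap_pos[of j] by (simp add: d_def)
  qed
  have 2: "\<bar>d (j - 1) - z j\<bar> \<le> 1" for j
  proof -
    have "(1 - t) * gap (j - 1) \<le> 1 * 1" using t01 gap_le_1[of "j - 1"] gap_pos[of "j - 1"] by (intro mult_mono) auto
    moreover have "0 \<le> (1 - t) * gap (j - 1)" using t01 gap_pos[of "j - 1"] by simp
    ultimately show ?thesis by (simp add: d_eq)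
  qed
  have b: "\<bar>lncos c (back (Suc n) j x) - lncos c (z (j - int (Suc n) * int p))\<bar> \<le> lip / 2 ^ Suc n"
    if "x \<in> piece j" "\<bar>x - z j\<bar> \<le> 1" for n j x
  proof -
    have "lip * \<bar>x - z j\<bar> / 2 ^ Suc n \<le> lip * 1 / 2 ^ Suc n"
      using that lip by (intro divide_right_mono mult_left_mono) auto
    then show ?thesis using back_lip[OF z_in_piece that(1), of n] unfolding back_z by simp
  qed
  show "summable (\<lambda>n. lncos c (z i + t * offset (Suc n) i) - lncos c (z i))"
  proof (rule summable_comparison_test'[OF summable_geo[of lip], of 0])
    fix n
    let ?j = "i + int (Suc n) * int p"
    show "norm (lncos c (z i + t * offset (Suc n) i) - lncos c (z i)) \<le> lip / 2 ^ Suc n"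
      using b[OF d_in_piece(1)[of ?j] 1, of n] unfolding back_d by simp
  qed
  show "summable (\<lambda>n. lncos c (z i - (1 - t) * offset (Suc n) (i - 1)) - lncos c (z i))"
  proof (rule summable_comparison_test'[OF summable_geo[of lip], of 0])
    fix n
    let ?j = "i + int (Suc n) * int p"
    have "d (?j - 1) \<in> piece ?j" using d_in_piece(2)[of "?j - 1"] by simp
    from b[OF this 2, of n]
    show "norm (lncos c (z i - (1 - t) * offset (Suc n) (i - 1)) - lncos c (z i)) \<le> lip / 2 ^ Suc n"
      unfolding back_d by simp
  qed
qed

definition "right_term i k = lncos c (z i + t * (gap i / 2 ^ (q * k))) - lncos c (z i)"
definition "left_term i k = lncos c (z i - (1 - t) * (gap (i - 1) / 2 ^ (q * k))) - lncos c (z i)"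

lemma offset_block_sums:
  "summable (right_term i)" "summable (left_term i)"
  "(\<Sum>n. lncos c (z i + t * offset (Suc n) i) - lncos c (z i))
    = real (idx i) * right_term i 0 + real q * (\<Sum>k. right_term i (Suc k))"
  "(\<Sum>n. lncos c (z i - (1 - t) * offset (Suc n) (i - 1)) - lncos c (z i))
    = real (idx (i - 1)) * left_term i 0 + real q * (\<Sum>k. left_term i (Suc k))"
proof -
  have e: "(Suc n + (q - 1 - idx j)) = n + (q - idx j)" for n j using idx_less[of j] by simp
  have x: "lncos c (z i + t * offset (Suc n) i) - lncos c (z i) = right_term i ((n + (q - idx i)) div q)" for n
    unfolding offset_eq e right_term_def ..
  have y: "lncos c (z i - (1 - t) * offset (Suc n) (i - 1)) - lncos c (z i)
      = left_term i ((n + (q - idx (i - 1))) div q)" for n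
    unfolding offset_eq e left_term_def ..
  have d: "q - (q - idx j) = idx j" for j using idx_less[of j] by simp
  note bx = suminf_div_blocks[OF q_pos diff_le_self[of q "idx i"] offset_summable(1)[of i, unfolded x], unfolded d]
  note by' = suminf_div_blocks[OF q_pos diff_le_self[of q "idx (i - 1)"] offset_summable(2)[of i, unfolded y], unfolded d]
  show "summable (right_term i)" by (rule bx(1))
  show "summable (left_term i)" by (rule by'(1))
  show "(\<Sum>n. lncos c (z i + t * offset (Suc n) i) - lncos c (z i))
    = real (idx i) * right_term i 0 + real q * (\<Sum>k. right_term i (Suc k))"
    unfolding x by (rule bx(2))
  show "(\<Sum>n. lncos c (z i - (1 - t) * offset (Suc n) (i - 1)) - lncos c (z i))
    = real (idx (i - 1)) * left_term i 0 + real q * (\<Sum>k. left_term i (Suc k))"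
    unfolding y by (rule by'(2))
qed

lemma right_left_diff:
  "right_term i k - left_term i k = lncos c (z i + t * (gap i / 2 ^ (q * k)))
    - lncos c (z i - (1 - t) * (gap (i - 1) / 2 ^ (q * k)))"
  by (simp add: right_term_def left_term_def)

lemma block_summable:
  "summable (\<lambda>k. lncos c (z i + t * (gap i / 2 ^ (q * Suc k))) - lncos c (z i - (1 - t) * (gap (i - 1) / 2 ^ (q * Suc k))))"
  unfolding right_left_diff[symmetric]
  by (intro summable_diff offset_block_sums(1,2)[THEN summable_Suc_iff[THEN iffD2]])

text \<open>The block \<open>k = 0\<close> sits at the cut points themselves. Each
  \<open>d i\<close> occurs on the right of \<open>z i\<close> and on the left of
  \<open>z (i + 1)\<close>, both times with weight \<open>idx i\<close>, so these values cancel
  cyclically, and an integer combination of orbit values is all that this block leaves.\<close>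

lemma series_closed_form:
  "series t c = (\<Sum>i<q. (real (idx (int i - 1)) - real (idx (int i))) * lncos c (z (int i)) +
     real q * (\<Sum>k. lncos c (z (int i) + t * (gap (int i) / 2 ^ (q * Suc k)))
        - lncos c (z (int i) - (1 - t) * (gap (int i - 1) / 2 ^ (q * Suc k)))))"
proof -
  have "series t c = (\<Sum>n. \<Sum>i<q. (lncos c (z (int i) + t * offset (Suc n) (int i)) - lncos c (z (int i)))
      - (lncos c (z (int i) - (1 - t) * offset (Suc n) (int i - 1)) - lncos c (z (int i))))"
    unfolding series_def by simp
  also have "\<dots> = (\<Sum>i<q. \<Sum>n. (lncos c (z (int i) + t * offset (Suc n) (int i)) - lncos c (z (int i)))
      - (lncos c (z (int i) - (1 - t) * offset (Suc n) (int i - 1)) - lncos c (z (int i))))"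
    by (intro suminf_sum summable_diff offset_summable)
  also have "\<dots> = (\<Sum>i<q. (real (idx (int i)) * right_term (int i) 0 + real q * (\<Sum>k. right_term (int i) (Suc k)))
      - (real (idx (int i - 1)) * left_term (int i) 0 + real q * (\<Sum>k. left_term (int i) (Suc k))))"
    unfolding offset_block_sums(3,4)[symmetric]
    by (intro sum.cong refl suminf_diff[symmetric] offset_summable)
  also have "\<dots> = (\<Sum>i<q. (real (idx (int i - 1)) - real (idx (int i))) * lncos c (z (int i)) +
      real q * ((\<Sum>k. right_term (int i) (Suc k)) - (\<Sum>k. left_term (int i) (Suc k)))
      + (real (idx (int i)) * lncos c (d (int i)) - real (idx (int i - 1)) * lncos c (d (int i - 1))))"
    by (intro sum.cong refl) (simp add: right_term_def left_term_def d_eq, simp add: d_def algebra_simps)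
  also have "\<dots> = (\<Sum>i<q. (real (idx (int i - 1)) - real (idx (int i))) * lncos c (z (int i)) +
      real q * ((\<Sum>k. right_term (int i) (Suc k)) - (\<Sum>k. left_term (int i) (Suc k))))
      + ((\<Sum>i<q. real (idx (int i)) * lncos c (d (int i))) - (\<Sum>i<q. real (idx (int i - 1)) * lncos c (d (int i - 1))))"
    by (simp add: sum.distrib sum_subtractf)
  finally have eq: "series t c = \<dots>" .
  have shift: "(\<Sum>i<q. real (idx (int i - 1)) * lncos c (d (int i - 1))) = (\<Sum>i<q. real (idx (int i)) * lncos c (d (int i)))"
    using sum_int_periodic_shift[of "\<lambda>i. real (idx i) * lncos c (d i)" q "-1"]
    by (simp add: idx_add_q d_add_q)
  have sd: "(\<Sum>k. right_term i (Suc k)) - (\<Sum>k. left_term i (Suc k)) =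
      (\<Sum>k. lncos c (z i + t * (gap i / 2 ^ (q * Suc k))) - lncos c (z i - (1 - t) * (gap (i - 1) / 2 ^ (q * Suc k))))" for i
    unfolding right_left_diff[symmetric]
    by (intro suminf_diff offset_block_sums(1,2)[THEN summable_Suc_iff[THEN iffD2]])
  show ?thesis unfolding eq shift sd by simp
qed

end

section \<open>Truncating the series by secants\<close>

context rotation
begin

text \<open>The width for which the secant bound of the tail beyond \<open>K\<close> exact terms has coefficient \<open>1\<close>.\<close>

definition "chord t K i = real q * (t * gap i + (1 - t) * gap (i - 1)) / (2 ^ (q * K) * M)"

definition "exact_part t c K i = (\<Sum>k<K. lncos c (z i + t * (gap i / 2 ^ (q * Suc k)))
  - lncos c (z i - (1 - t) * (gap (i - 1) / 2 ^ (q * Suc k))))"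

lemma block_weights_sums: "(\<lambda>k. 1 / 2 ^ (q * Suc (k + K))) sums (1 / (2 ^ (q * K) * M))"
proof -
  have "(2::real) ^ q > 1" using q_pos by (intro one_less_power) auto
  then have "\<bar>1 / 2 ^ q :: real\<bar> < 1" by simp
  from sums_mult[OF geometric_sums[OF this[folded real_norm_def]], of "1 / 2 ^ (q * K) * (1 / 2 ^ q)"]
  have "(\<lambda>k. 1 / 2 ^ (q * K) * (1 / 2 ^ q) * (1 / 2 ^ q) ^ k :: real) sums
      (1 / 2 ^ (q * K) * (1 / 2 ^ q) * (1 / (1 - 1 / 2 ^ q)))" .
  moreover have "1 / 2 ^ (q * K) * (1 / 2 ^ q) * (1 / 2 ^ q) ^ k = 1 / (2::real) ^ (q * Suc (k + K))" for k
    by (simp add: power_divide power_add distrib_left flip: power_mult)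
  moreover have "1 / 2 ^ (q * K) * (1 / 2 ^ q) * (1 / (1 - 1 / 2 ^ q)) = 1 / (2 ^ (q * K) * M)"
    using \<open>2 ^ q > 1\<close> by (simp add: field_simps)
  ultimately show ?thesis by (simp only:)
qed

end

context rotation_cut
begin

lemma block_in_K:
  "z i + t * (gap i / 2 ^ (q * Suc k)) - of_int (i div int q) \<in> {\<theta>..\<theta> + 1/2}"
  "z i - (1 - t) * (gap (i - 1) / 2 ^ (q * Suc k)) - of_int (i div int q) \<in> {\<theta>..\<theta> + 1/2}"
proof -
  have Suc: "q * Suc k = Suc (q * Suc k - 1)" using q_pos by simp
  have "offset (q * Suc k) j = gap j / 2 ^ (q * Suc k)" for j
  proof -
    have "(q * Suc k + (q - 1 - idx j)) div q = Suc k"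
      using q_pos by (intro div_nat_eqI) (simp_all add: algebra_simps)
    then show ?thesis unfolding offset_eq by simp
  qed
  then have *: "offset (Suc (q * Suc k - 1)) j = gap j / 2 ^ (q * Suc k)" for j
    unfolding Suc[symmetric] .
  show "z i + t * (gap i / 2 ^ (q * Suc k)) - of_int (i div int q) \<in> {\<theta>..\<theta> + 1/2}"
    "z i - (1 - t) * (gap (i - 1) / 2 ^ (q * Suc k)) - of_int (i div int q) \<in> {\<theta>..\<theta> + 1/2}"
    using offset_in_K[of i "q * Suc k - 1"] unfolding * by simp_all
qed

lemma K_third: "x \<in> {\<theta>..\<theta> + 1/2} \<Longrightarrow> \<bar>x - c\<bar> < 1/3"
  unfolding atLeastAtMost_iff using theta_tol by linarith

lemma weight_pos: "t * gap i + (1 - t) * gap (i - 1) > 0"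
  using t01 gap_pos[of i] gap_pos[of "i - 1"]
  by (cases "t = 0") (auto intro!: add_pos_nonneg)

lemma chord_pos: "chord t K i > 0"
proof -
  have "M > 0" using M_ge_1 by linarith
  with weight_pos[of i] show ?thesis unfolding chord_def using q_pos by simp
qed

lemma chord_ge:
  assumes "0 \<le> w" "w \<le> t * gap i + (1 - t) * gap (i - 1)"
  shows "w / 2 ^ (q * Suc (k + K)) \<le> chord t K i"
proof -
  define v where "v = t * gap i + (1 - t) * gap (i - 1)"
  have M: "M > 0" "M \<le> 2 ^ q" using M_ge_1 by linarith+
  have "(2::real) ^ (q * K) * M \<le> 2 ^ (q * K) * 2 ^ q" using M by (intro mult_left_mono) auto
  also have "\<dots> = 2 ^ (q * Suc K)" by (simp add: power_add)
  also have "\<dots> \<le> 2 ^ (q * Suc (k + K))" by (intro power_increasing mult_le_mono2) auto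
  finally have "(2::real) ^ (q * K) * M \<le> 2 ^ (q * Suc (k + K))" .
  then have "w / 2 ^ (q * Suc (k + K)) \<le> v / (2 ^ (q * K) * M)"
    using assms M by (intro frac_le) (auto simp: v_def)
  also have "\<dots> \<le> real q * v / (2 ^ (q * K) * M)"
    using q_pos M assms mult_right_mono[of 1 "real q" v] by (intro divide_right_mono) (auto simp: v_def)
  finally show ?thesis by (simp add: chord_def v_def)
qed

lemma tail_weight: "real q * ((t * gap i + (1 - t) * gap (i - 1)) * s / chord t K i * (1 / (2 ^ (q * K) * M))) = s"
proof -
  define m where "m = 2 ^ (q * K) * M"
  have "M > 0" using M_ge_1 by linarith
  then have "m > 0" unfolding m_def by (intro mult_pos_pos) simp_all
  then show ?thesis
    unfolding chord_def m_def[symmetric] using weight_pos[of i] q_pos by simp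
qed

text \<open>Each tail term is at most its length times the slope of the secant over the interval of
  width \<open>chord\<close> left of the orbit point. Weighted by \<open>q\<close>, these lengths
  add up to exactly \<open>chord\<close>, so the whole tail costs one more difference of
  \<open>lncos\<close>.\<close>

lemma series_le:
  assumes dom: "\<And>i. i < q \<Longrightarrow> \<bar>z (int i) - chord t K (int i) - c\<bar> < 1/2"
  shows "series t c \<le> (\<Sum>i<q. (real (idx (int i - 1)) - real (idx (int i))) * lncos c (z (int i))
    + real q * exact_part t c K (int i) + (lncos c (z (int i)) - lncos c (z (int i) - chord t K (int i))))"
  unfolding series_closed_form
proof (intro sum_mono)
  fix j assume "j \<in> {..<q}"
  then have "j < q" by simp
  define i where "i = int j"
  have i0: "i div int q = 0" using \<open>j < q\<close> by (simp add: i_def)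
  define A where "A = chord t K i"
  define a b where "a = t * gap i" and "b = (1 - t) * gap (i - 1)"
  define s where "s = lncos c (z i) - lncos c (z i - A)"
  define x where "x k = lncos c (z i + t * (gap i / 2 ^ (q * Suc k))) - lncos c (z i - (1 - t) * (gap (i - 1) / 2 ^ (q * Suc k)))" for k
  have A: "A > 0" unfolding A_def by (rule chord_pos)
  have ab: "a \<ge> 0" "b \<ge> 0" using t01 gap_pos[of i] gap_pos[of "i - 1"] by (auto simp: a_def b_def)
  have sx: "summable x" unfolding x_def by (rule block_summable)
  have "x (k + K) \<le> (a + b) * s / A * (1 / 2 ^ (q * Suc (k + K)))" for k
  proof -
    let ?r = "2 ^ (q * Suc (k + K)) :: real"
    have "A * (lncos c (z i + a / ?r) - lncos c (z i - b / ?r)) \<le> (a / ?r + b / ?r) * (lncos c (z i) - lncos c (z i - A))"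
    proof (rule lncos_secant_left[OF A])
      show "b / ?r \<le> A" unfolding A_def by (rule chord_ge) (use ab in \<open>auto simp: a_def b_def\<close>)
      show "\<bar>z i - A - c\<bar> < 1/2" using dom[OF \<open>j < q\<close>] by (simp add: A_def i_def)
      show "\<bar>z i + a / ?r - c\<bar> < 1/2"
        using K_third[OF block_in_K(1)[of i "k + K"]] by (simp add: a_def i0)
    qed (use ab in auto)
    then have "A * x (k + K) \<le> (a + b) / ?r * s"
      by (simp add: x_def s_def a_def b_def add_divide_distrib)
    then show ?thesis using A by (simp add: field_simps)
  qed
  then have "(\<Sum>k. x (k + K)) \<le> (a + b) * s / A * (1 / (2 ^ (q * K) * M))"
    by (intro sums_le[OF _ summable_sums sums_mult[OF block_weights_sums]])
       (use sx in \<open>simp_all only: summable_iff_shift\<close>)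
  then have "real q * (\<Sum>k. x (k + K)) \<le> real q * ((a + b) * s / A * (1 / (2 ^ (q * K) * M)))"
    by (intro mult_left_mono) auto
  also have "\<dots> = s" unfolding a_def b_def A_def by (rule tail_weight)
  finally have "real q * suminf x \<le> real q * exact_part t c K i + s"
    using suminf_split_initial_segment[OF sx, of K] by (simp add: x_def exact_part_def algebra_simps)
  then show "(real (idx (int j - 1)) - real (idx (int j))) * lncos c (z (int j)) +
      real q * (\<Sum>k. lncos c (z (int j) + t * (gap (int j) / 2 ^ (q * Suc k)))
        - lncos c (z (int j) - (1 - t) * (gap (int j - 1) / 2 ^ (q * Suc k))))
    \<le> (real (idx (int j - 1)) - real (idx (int j))) * lncos c (z (int j))
    + real q * exact_part t c K (int j) + (lncos c (z (int j)) - lncos c (z (int j) - chord t K (int j)))"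
    unfolding x_def s_def A_def i_def by linarith
qed

text \<open>The mirror image: slopes are bounded from below by the secant on the right of the orbit
  point.\<close>

lemma series_ge:
  assumes dom: "\<And>i. i < q \<Longrightarrow> \<bar>z (int i) + chord t K (int i) - c\<bar> < 1/2"
  shows "series t c \<ge> (\<Sum>i<q. (real (idx (int i - 1)) - real (idx (int i))) * lncos c (z (int i))
    + real q * exact_part t c K (int i) + (lncos c (z (int i) + chord t K (int i)) - lncos c (z (int i))))"
  unfolding series_closed_form
proof (intro sum_mono)
  fix j assume "j \<in> {..<q}"
  then have "j < q" by simp
  define i where "i = int j"
  have i0: "i div int q = 0" using \<open>j < q\<close> by (simp add: i_def)
  define A where "A = chord t K i"
  define a b where "a = t * gap i" and "b = (1 - t) * gap (i - 1)"
  define s where "s = lncos c (z i + A) - lncos c (z i)"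
  define x where "x k = lncos c (z i + t * (gap i / 2 ^ (q * Suc k))) - lncos c (z i - (1 - t) * (gap (i - 1) / 2 ^ (q * Suc k)))" for k
  have A: "A > 0" unfolding A_def by (rule chord_pos)
  have ab: "a \<ge> 0" "b \<ge> 0" using t01 gap_pos[of i] gap_pos[of "i - 1"] by (auto simp: a_def b_def)
  have sx: "summable x" unfolding x_def by (rule block_summable)
  have "(a + b) * s / A * (1 / 2 ^ (q * Suc (k + K))) \<le> x (k + K)" for k
  proof -
    let ?r = "2 ^ (q * Suc (k + K)) :: real"
    have "(a / ?r + b / ?r) * (lncos c (z i + A) - lncos c (z i)) \<le> A * (lncos c (z i + a / ?r) - lncos c (z i - b / ?r))"
    proof (rule lncos_secant_right[OF A])
      show "a / ?r \<le> A" unfolding A_def by (rule chord_ge) (use ab in \<open>auto simp: a_def b_def\<close>)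
      show "\<bar>z i + A - c\<bar> < 1/2" using dom[OF \<open>j < q\<close>] by (simp add: A_def i_def)
      show "\<bar>z i - b / ?r - c\<bar> < 1/2"
        using K_third[OF block_in_K(2)[of i "k + K"]] by (simp add: b_def i0)
    qed (use ab in auto)
    then have "(a + b) / ?r * s \<le> A * x (k + K)"
      by (simp add: x_def s_def a_def b_def add_divide_distrib)
    then show ?thesis using A by (simp add: field_simps)
  qed
  then have "(a + b) * s / A * (1 / (2 ^ (q * K) * M)) \<le> (\<Sum>k. x (k + K))"
    by (intro sums_le[OF _ sums_mult[OF block_weights_sums] summable_sums])
       (use sx in \<open>simp_all only: summable_iff_shift\<close>)
  then have "real q * ((a + b) * s / A * (1 / (2 ^ (q * K) * M))) \<le> real q * (\<Sum>k. x (k + K))"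
    by (intro mult_left_mono) auto
  also have "real q * ((a + b) * s / A * (1 / (2 ^ (q * K) * M))) = s" unfolding a_def b_def A_def by (rule tail_weight)
  finally have "real q * suminf x \<ge> real q * exact_part t c K i + s"
    using suminf_split_initial_segment[OF sx, of K] by (simp add: x_def exact_part_def algebra_simps)
  then show "(real (idx (int j - 1)) - real (idx (int j))) * lncos c (z (int j))
    + real q * exact_part t c K (int j) + (lncos c (z (int j) + chord t K (int j)) - lncos c (z (int j)))
   \<le> (real (idx (int j - 1)) - real (idx (int j))) * lncos c (z (int j)) +
      real q * (\<Sum>k. lncos c (z (int j) + t * (gap (int j) / 2 ^ (q * Suc k)))
        - lncos c (z (int j) - (1 - t) * (gap (int j - 1) / 2 ^ (q * Suc k))))"
    unfolding x_def s_def A_def i_def by linarith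
qed

lemma series_summable:
  "summable (\<lambda>n. \<Sum>i<q. lncos c (z (int i) + t * offset (Suc n) (int i))
     - lncos c (z (int i) - (1 - t) * offset (Suc n) (int i - 1)))"
proof (intro summable_sum)
  fix i
  show "summable (\<lambda>n. lncos c (z (int i) + t * offset (Suc n) (int i))
     - lncos c (z (int i) - (1 - t) * offset (Suc n) (int i - 1)))"
    using summable_diff[OF offset_summable[of "int i"]] by simp
qed

lemma offset_third:
  assumes "i < q"
  shows "\<bar>z (int i) + t * offset (Suc n) (int i) - c\<bar> < 1/3"
    and "\<bar>z (int i) - (1 - t) * offset (Suc n) (int i - 1) - c\<bar> < 1/3"
  using K_third[OF offset_in_K(1)[of "int i" n]] K_third[OF offset_in_K(2)[of "int i" n]] assms by simp_all

lemma offset_nonneg: "0 \<le> t * offset n i" "0 \<le> (1 - t) * offset n i"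
  using t01 offset_bounds(1)[of n i] by simp_all

lemma orbit_third: "i < q \<Longrightarrow> \<bar>z (int i) - c\<bar> < 1/3"
  using K_third[OF z_in_K[of "int i"]] by simp

end

section \<open>Monotonicity in \<open>c\<close>, continuity in \<open>t\<close>\<close>

context rotation
begin

lemma series_mono:
  assumes c: "c1 \<le> c2" and "rotation_cut p q t c1" "rotation_cut p q t c2"
  shows "series t c1 \<le> series t c2"
proof -
  interpret A: rotation_cut p q t c1 by fact
  interpret B: rotation_cut p q t c2 by fact
  show ?thesis
    unfolding series_def
  proof (intro suminf_le A.series_summable B.series_summable sum_mono)
    fix n i assume "i \<in> {..<q}"
    then have i: "i < q" by simp
    show "lncos c1 (z (int i) + t * offset (Suc n) (int i)) - lncos c1 (z (int i) - (1 - t) * offset (Suc n) (int i - 1))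
      \<le> lncos c2 (z (int i) + t * offset (Suc n) (int i)) - lncos c2 (z (int i) - (1 - t) * offset (Suc n) (int i - 1))"
      using c A.offset_nonneg(1)[of "Suc n" "int i"] A.offset_nonneg(2)[of "Suc n" "int i - 1"]
        A.offset_third[OF i, of n] B.offset_third[OF i, of n]
      by (intro lncos_diff_mono_param) linarith+
  qed
qed

text \<open>All arguments stay within \<open>1/3\<close> of \<open>c\<close>, which gives one
  Lipschitz constant, and the distances are at most \<open>1 / 2 ^ Suc n\<close> for every
  \<open>t\<close>; hence the convergence is uniform.\<close>

lemma series_continuous:
  assumes "\<And>t. t \<in> T \<Longrightarrow> rotation_cut p q t c"
  shows "continuous_on T (\<lambda>t. series t c)"
proof -
  define C where "C = \<bar>- pi * tan (pi * (c - 1/3 - c))\<bar> + \<bar>- pi * tan (pi * (c + 1/3 - c))\<bar>"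
  let ?f = "\<lambda>n t. \<Sum>i<q. lncos c (z (int i) + t * offset (Suc n) (int i))
      - lncos c (z (int i) - (1 - t) * offset (Suc n) (int i - 1))"
  have C: "C \<ge> 0" by (simp add: C_def)
  have bound: "\<bar>?f n t\<bar> \<le> (real q * C) / 2 ^ Suc n" if t: "t \<in> T" for n t
  proof -
    interpret rotation_cut p q t c using assms[OF t] .
    have "\<bar>?f n t\<bar> \<le> (\<Sum>i<q. \<bar>lncos c (z (int i) + t * offset (Suc n) (int i))
      - lncos c (z (int i) - (1 - t) * offset (Suc n) (int i - 1))\<bar>)" by (rule sum_abs)
    also have "\<dots> \<le> (\<Sum>i<q. C / 2 ^ Suc n)"
    proof (intro sum_mono)
      fix i assume "i \<in> {..<q}"
      then have i: "i < q" by simp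
      define r where "r = z (int i) + t * offset (Suc n) (int i)"
      define l where "l = z (int i) - (1 - t) * offset (Suc n) (int i - 1)"
      have lr: "l \<le> r" using offset_nonneg(1)[of "Suc n" "int i"] offset_nonneg(2)[of "Suc n" "int i - 1"]
        unfolding l_def r_def by linarith
      have in3: "c - 1/3 \<le> l" "r \<le> c + 1/3" using offset_third[OF i, of n] unfolding l_def r_def by linarith+
      have "lncos c r - lncos c l \<le> (r - l) * (- pi * tan (pi * (c - 1/3 - c)))"
        "(r - l) * (- pi * tan (pi * (c + 1/3 - c))) \<le> lncos c r - lncos c l"
        by (rule lncos_diff_bounds[OF lr in3]; simp)+
      moreover have "(r - l) * (- pi * tan (pi * (c - 1/3 - c))) \<le> (r - l) * C"
        "(r - l) * (- C) \<le> (r - l) * (- pi * tan (pi * (c + 1/3 - c)))"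
        using lr by (intro mult_left_mono; simp add: C_def; linarith)+
      ultimately have "\<bar>lncos c r - lncos c l\<bar> \<le> (r - l) * C" by (simp add: abs_le_iff)
      also have "r - l \<le> 1 / 2 ^ Suc n"
      proof -
        have "t * offset (Suc n) (int i) \<le> t * (1 / 2 ^ Suc n)"
          "(1 - t) * offset (Suc n) (int i - 1) \<le> (1 - t) * (1 / 2 ^ Suc n)"
          by (rule mult_left_mono[OF offset_bounds(2)], use t01 in simp)+
        then have "r - l \<le> t * (1 / 2 ^ Suc n) + (1 - t) * (1 / 2 ^ Suc n)" unfolding r_def l_def by linarith
        also have "\<dots> = 1 / 2 ^ Suc n" unfolding distrib_right[symmetric] by simp
        finally show ?thesis .
      qed
      then have "(r - l) * C \<le> 1 / 2 ^ Suc n * C" using C by (intro mult_right_mono)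
      finally show "\<bar>lncos c (z (int i) + t * offset (Suc n) (int i))
          - lncos c (z (int i) - (1 - t) * offset (Suc n) (int i - 1))\<bar> \<le> C / 2 ^ Suc n"
        by (simp add: r_def l_def)
    qed
    also have "\<dots> = (real q * C) / 2 ^ Suc n" by simp
    finally show ?thesis .
  qed
  have "summable (\<lambda>n. (real q * C) / 2 ^ Suc n)"
    using sums_mult[OF power_half_series, of "real q * C"] by (auto simp: summable_def power_divide)
  with bound have ul: "uniform_limit T (\<lambda>n t. \<Sum>i<n. ?f i t) (\<lambda>t. series t c) sequentially"
    unfolding series_def by (intro Weierstrass_m_test) auto
  have cont: "continuous_on T (\<lambda>t. lncos c (g t))"
    if "continuous_on T g" "\<And>t. t \<in> T \<Longrightarrow> \<bar>g t - c\<bar> < 1/3" for g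
  proof -
    have "cos (pi * (g t - c)) \<noteq> 0" if "t \<in> T" for t
      using cos_pi_pos[of "g t - c"] \<open>\<And>t. t \<in> T \<Longrightarrow> \<bar>g t - c\<bar> < 1/3\<close>[OF that] by simp
    then show ?thesis unfolding lncos_def by (intro continuous_intros that(1)) auto
  qed
  have cf: "continuous_on T (?f n)" for n
  proof (intro continuous_on_sum continuous_on_diff cont continuous_intros)
    fix i t assume "i \<in> {..<q}" "t \<in> T"
    then show "\<bar>z (int i) + t * offset (Suc n) (int i) - c\<bar> < 1/3"
      "\<bar>z (int i) - (1 - t) * offset (Suc n) (int i - 1) - c\<bar> < 1/3"
      using rotation_cut.offset_third[OF assms, of t i n] by auto
  qed
  have "continuous_on T (\<lambda>t. \<Sum>i<n. ?f i t)" for n by (rule continuous_on_sum) (rule cf)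
  then show ?thesis
    by (intro uniform_limit_theorem[OF _ ul]) auto
qed

lemma orbit_doubling: "\<exists>k. 2 ^ n * z 0 = z (int n * int p) + of_int k"
proof (induction n)
  case 0
  then show ?case by (auto intro: exI[of _ 0])
next
  case (Suc n)
  then obtain k where k: "2 ^ n * z 0 = z (int n * int p) + of_int k" by blast
  have "2 ^ Suc n * z 0 = 2 * (2 ^ n * z 0)" by simp
  also have "\<dots> = 2 * z (int n * int p) + of_int (2 * k)" unfolding k by simp
  also have "\<dots> = z (int n * int p + int p) + of_int (int n * int p div int q + 2 * k)"
    unfolding z_double by simp
  also have "int n * int p + int p = int (Suc n) * int p" by (simp add: algebra_simps)
  finally show ?case by blast
qed

end

section \<open>The exponent as an orbit mean\<close>

context rotation_balanced
begin

lemma orbit_pt_in_K: "\<exists>k. 2 ^ n * z 0 - of_int k \<in> {\<theta>..\<theta> + 1/2}"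
proof -
  obtain k where k: "2 ^ n * z 0 = z (int n * int p) + of_int k" using orbit_doubling by blast
  have "2 ^ n * z 0 - of_int (int n * int p div int q + k) \<in> {\<theta>..\<theta> + 1/2}"
    using z_in_K[of "int n * int p"] unfolding k by simp
  then show ?thesis by blast
qed

lemma gelfond_exponent_eq: "gelfond_exponent c = 1 + (\<Sum>j<q. lncos c (z (int j))) / (real q * ln 2)"
proof -
  obtain k where "2 ^ q * z 0 = z (int q * int p) + of_int k" using orbit_doubling by blast
  moreover have "z (int q * int m) = z 0 + real m" for m
  proof (induction m)
    case (Suc m)
    then show ?case using z_add_q[of "int q * int m"] by (simp add: algebra_simps)
  qed simp
  ultimately have per: "2 ^ q * z 0 = z 0 + of_int (int p + k)" by simp
  \<comment> \<open>Iterating the functional equation telescopes. After \<open>q\<close> steps the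
    point returns modulo 1, so the orbit sum is \<open>real q * \<beta>\<close>, obtained without
    matching the order of doubling to the spatial order in \<open>beta_mean\<close>.\<close>
  have phi_orbit: "\<phi> (2 ^ n * z 0) = \<phi> (z 0) + (\<Sum>j<n. lncos c (2 ^ j * z 0)) - real n * \<beta>" for n
  proof (induction n)
    case (Suc n)
    obtain k where k: "2 ^ n * z 0 - of_int k \<in> {\<theta>..\<theta> + 1/2}" using orbit_pt_in_K by blast
    have "\<phi> (2 * (2 ^ n * z 0)) = \<phi> (2 * (2 ^ n * z 0 - of_int k))"
      using phi_add_int[of "2 * (2 ^ n * z 0 - of_int k)" "2 * k"] by (simp add: algebra_simps)
    also have "\<dots> = \<phi> (2 ^ n * z 0 - of_int k) + lncos c (2 ^ n * z 0 - of_int k) - \<beta>" by (rule phi_double[OF k])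
    also have "\<phi> (2 ^ n * z 0 - of_int k) = \<phi> (2 ^ n * z 0)"
      using phi_add_int[of "2 ^ n * z 0 - of_int k" k] by simp
    finally show ?case using Suc by (simp add: lncos_diff_int algebra_simps)
  qed simp
  have qb: "(\<Sum>j<q. lncos c (2 ^ j * z 0)) = real q * \<beta>"
    using phi_orbit[of q] phi_add_int[of "z 0" "int p + k"] unfolding per by simp
  have prod: "(\<Prod>j<q. 2 * \<bar>cos (pi * (2 ^ j * z 0 - c))\<bar>) = (2 * exp \<beta>) ^ q"
  proof -
    have "\<bar>cos (pi * (2 ^ j * z 0 - c))\<bar> = exp (lncos c (2 ^ j * z 0))" for j
    proof -
      obtain k where "2 ^ j * z 0 - of_int k \<in> {\<theta>..\<theta> + 1/2}" using orbit_pt_in_K by blast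
      from K_third[OF this] have "cos (pi * (2 ^ j * z 0 - of_int k - c)) > 0" by (intro cos_pi_pos) simp
      moreover have "\<bar>cos (pi * ((2 ^ j * z 0 - c) + of_int (- k)))\<bar> = \<bar>cos (pi * (2 ^ j * z 0 - c))\<bar>"
        by (rule abs_cos_pi_add_int)
      ultimately have "cos (pi * (2 ^ j * z 0 - c)) \<noteq> 0" by (auto simp: algebra_simps)
      from exp_lncos[OF this] show ?thesis by simp
    qed
    then have "(\<Prod>j<q. 2 * \<bar>cos (pi * (2 ^ j * z 0 - c))\<bar>) = 2 ^ q * exp (\<Sum>j<q. lncos c (2 ^ j * z 0))"
      by (simp add: prod.distrib exp_sum)
    also have "\<dots> = (2 * exp \<beta>) ^ q" unfolding qb by (simp add: power_mult_distrib exp_of_nat_mult)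
    finally show ?thesis .
  qed
  \<comment> \<open>Within \<open>1/3\<close> of \<open>c\<close> the cosine exceeds
    \<open>1/2\<close>; so the growth rate \<open>2 * exp \<beta>\<close> exceeds 1, as the upper
    bound for the sums demands.\<close>
  have "- ln 2 < lncos c (z (int j))" if "j < q" for j
  proof -
    have lt: "\<bar>z (int j) - c\<bar> < 1/3" by (rule orbit_third[OF that])
    then have "pi * \<bar>z (int j) - c\<bar> < pi * (1/3)" by (intro mult_strict_left_mono) auto
    then have "cos (pi / 3) < cos \<bar>pi * (z (int j) - c)\<bar>"
      by (intro cos_monotone_0_pi) (auto simp: abs_mult)
    then have "1/2 < cos (pi * (z (int j) - c))" by (simp add: cos_60 cos_abs_real)
    then have "ln (1/2) < ln (cos (pi * (z (int j) - c)))" by simp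
    then show ?thesis using lt by (subst lncos_eq) (auto simp: ln_div)
  qed
  then have "(\<Sum>j<q. - ln 2) < (\<Sum>j<q. lncos c (z (int j)))" using q_pos by (intro sum_strict_mono) auto
  then have "real q * (- ln 2) < real q * \<beta>" by (simp add: beta_mean)
  then have beta: "- ln 2 < \<beta>" using q_pos by (simp only: mult_less_cancel_left_pos of_nat_0_less_iff)
  have "1 = 2 * exp (- ln (2::real))" by (simp add: exp_minus)
  also have "\<dots> < 2 * exp \<beta>" using beta by simp
  finally have lam: "1 < 2 * exp \<beta>" .
  obtain B where B: "\<And>x. \<bar>\<phi> x\<bar> \<le> B" using phi_bounded by blast
  have "gelfond_exponent c = log 2 (2 * exp \<beta>)"
  proof (rule gelfond_exponent_eqI[OF lam, where h = "\<lambda>x. exp (\<phi> x)" and m = "exp (- B)" and B = "exp B"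
        and q = q and x = "z 0" and k = "int p + k"])
    show "exp (- B) \<le> exp (\<phi> x)" "exp (\<phi> x) \<le> exp B" for x using B[of x] by (simp_all add: abs_le_iff)
    show "2 * \<bar>cos (pi * (x - c))\<bar> * exp (\<phi> x) \<le> 2 * exp \<beta> * exp (\<phi> (2 * x))" for x
      using subaction[of x] by (simp add: mult.assoc)
  qed (use q_pos per prod in simp_all)
  also have "\<dots> = 1 + \<beta> / ln 2" by (simp add: log_def ln_mult add_divide_distrib)
  also have "\<beta> = (\<Sum>j<q. lncos c (z (int j))) / real q" using beta_mean q_pos by (simp add: field_simps)
  finally show ?thesis by simp
qed

end

text \<open>Monotonicity transfers both signs to every \<open>c\<close> in the interval, and the
  intermediate value theorem in \<open>t\<close> yields a balanced cut. Since
  \<open>\<theta>\<close> grows with \<open>t\<close>, the tolerance is tested only at the extreme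
  corners, \<open>t1\<close> with \<open>chi\<close> and \<open>t2\<close> with
  \<open>clo\<close>.\<close>

theorem (in rotation) gelfond_exponent_range:
  assumes t: "0 \<le> t1" "t1 \<le> t2" "t2 \<le> 1" and c: "clo \<le> c" "c \<le> chi"
    and tol1: "- 1/12 < z 0 - (1 - t1) / (2 * M) - chi + 1/4"
    and tol2: "z 0 - (1 - t2) / (2 * M) - clo + 1/4 < 1/12"
    and lo: "0 \<le> series t1 clo" and hi: "series t2 chi \<le> 0"
  shows "gelfond_exponent c = 1 + (\<Sum>j<q. lncos c (z (int j))) / (real q * ln 2)"
    and "\<And>j. j < q \<Longrightarrow> \<bar>z (int j) - c\<bar> < 1/3"
proof -
  have cut: "rotation_cut p q t c'" if "t1 \<le> t" "t \<le> t2" "clo \<le> c'" "c' \<le> chi" for t c'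
  proof unfold_locales
    show "0 \<le> t" "t \<le> 1" using that t by linarith+
    have "(1 - t) / (2 * M) \<le> (1 - t1) / (2 * M)" "(1 - t2) / (2 * M) \<le> (1 - t) / (2 * M)"
      using that M_ge_1 by (intro divide_right_mono; simp)+
    then show "\<bar>z 0 - (1 - t) / (2 * M) - c' + 1/4\<bar> < 1/12"
      using tol1 tol2 that by linarith
  qed
  have "0 \<le> series t1 c" using lo series_mono[of clo c t1] cut c t by force
  moreover have "series t2 c \<le> 0" using hi series_mono[of c chi t2] cut c t by force
  moreover have "continuous_on {t1..t2} (\<lambda>t. series t c)"
    using cut c by (intro series_continuous) auto
  ultimately obtain t where "t1 \<le> t" "t \<le> t2" "series t c = 0"
    using IVT2'[of "\<lambda>t. series t c" t2 0 t1] t by auto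
  then have ct: "rotation_cut p q t c" using cut c by blast
  interpret rotation_cut p q t c by (rule ct)
  interpret rotation_balanced p q t c
    by unfold_locales (simp add: series_eq \<open>series t c = 0\<close>)
  show "gelfond_exponent c = 1 + (\<Sum>j<q. lncos c (z (int j))) / (real q * ln 2)"
    by (rule gelfond_exponent_eq)
  show "\<And>j. j < q \<Longrightarrow> \<bar>z (int j) - c\<bar> < 1/3" by (rule orbit_third)
qed

section \<open>Verification in fixed-point arithmetic\<close>

text \<open>Values are scaled by \<open>2 ^ 26\<close>, their squares by \<open>2 ^ 52\<close>. The constants bound
  \<open>2 ^ 26 * \<pi> ^ (2 * k) / (2 * k)!\<close>; those of the innermost Horner step also absorb the Taylor remainder.\<close>

definition fx_cos_hi :: "int \<Rightarrow> int" where
  "fx_cos_hi y = (let w = y * y;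
     v = 15792772 - drop_bit 52 (w * 1699498);
     v = 89607967 - drop_bit 52 (w * v) - 1;
     v = 272375561 - drop_bit 52 (w * v);
     v = 331168969 - drop_bit 52 (w * v) - 1
   in 67108864 - drop_bit 52 (w * v))"

definition fx_cos_lo :: "int \<Rightarrow> int" where
  "fx_cos_lo y = (let w = y * y;
     v = 15792771 - drop_bit 52 (w * 1764245) - 1;
     v = 89607968 - drop_bit 52 (w * v);
     v = 272375560 - drop_bit 52 (w * v) - 1;
     v = 331168970 - drop_bit 52 (w * v)
   in 67108864 - drop_bit 52 (w * v) - 1)"

fun mul_pow_hi :: "nat \<Rightarrow> int \<Rightarrow> int \<Rightarrow> int" where
  "mul_pow_hi 0 v a = a"
| "mul_pow_hi (Suc n) v a = mul_pow_hi n v (drop_bit 26 (a * v) + 1)"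

fun mul_pow_lo :: "nat \<Rightarrow> int \<Rightarrow> int \<Rightarrow> int" where
  "mul_pow_lo 0 v a = a"
| "mul_pow_lo (Suc n) v a = mul_pow_lo n v (drop_bit 26 (a * v))"

text \<open>Decides a product inequality without division: factors with nonnegative exponent go into
  an upper bound \<open>a\<close> of the left side, the others, inverted, into a lower bound
  \<open>b\<close> of the right side. The guard on \<open>y\<close> keeps the cosine
  positive.\<close>

fun cos_prod_le :: "int \<Rightarrow> (int \<times> int) list \<Rightarrow> int \<Rightarrow> int \<Rightarrow> bool" where
  "cos_prod_le D [] a b \<longleftrightarrow> a \<le> b"
| "cos_prod_le D ((n, y) # xs) a b \<longleftrightarrow> 2 * \<bar>y\<bar> < D \<and>
    (if 0 \<le> n then cos_prod_le D xs (mul_pow_hi (nat n) (fx_cos_hi (\<bar>y\<bar> * 67108864 div D)) a) b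
     else let v = fx_cos_lo (\<bar>y\<bar> * 67108864 div D + 1) in
       0 \<le> v \<and> cos_prod_le D xs a (mul_pow_lo (nat (- n)) v b))"

text \<open>Here \<open>r\<close> is an inverse of \<open>p\<close> modulo \<open>q\<close>, \<open>t = T / S\<close> and \<open>c = C / B\<close>. A pair \<open>(n, y)\<close> stands for the
  factor \<open>cos (\<pi> y / D) ^ n\<close> with a common denominator \<open>D\<close>; the sign \<open>sg\<close> is \<open>1\<close> to certify \<open>series t c \<le> 0\<close>
  and \<open>- 1\<close> to certify \<open>series t c \<ge> 0\<close>.\<close>

definition gap_num :: "nat \<Rightarrow> int \<Rightarrow> int \<Rightarrow> int" where
  "gap_num q r i = 2 ^ (q - 1 - nat (- (i + 1) * r mod int q))"

fun orbit_sum :: "nat \<Rightarrow> int \<Rightarrow> nat \<Rightarrow> int" where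
  "orbit_sum q r 0 = 0"
| "orbit_sum q r (Suc n) = orbit_sum q r n + gap_num q r (int n)"

text \<open>Over the common denominator, \<open>y\<close> encodes \<open>z i - c\<close> and
  \<open>A\<close> the width \<open>chord\<close>. The tail bound contributes exponent 1 at
  \<open>z i\<close> and -1 at distance \<open>A\<close> from it; negating the lower bound for
  \<open>sg = - 1\<close> leads to the same exponents, so one format serves both signs.\<close>

definition entries_at :: "nat \<Rightarrow> int \<Rightarrow> int \<Rightarrow> int \<Rightarrow> int \<Rightarrow> int \<Rightarrow> nat \<Rightarrow> int \<Rightarrow> int \<Rightarrow> nat \<Rightarrow> (int \<times> int) list" where
  "entries_at q r T S C B K sg z0 i =
    (let M = 2 ^ q - 1; g = gap_num q r (int i); g' = gap_num q r (int i - 1);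
       y = ((z0 + orbit_sum q r i) * B - C * M) * (M * 2 ^ (q * K) * S);
       A = int q * (T * g + (S - T) * g') * B;
       u = T * g * M * B; v = (S - T) * g' * M * B
     in (sg * ((- int i * r) mod int q - (- (int i + 1) * r) mod int q) + 1, y) # (-1, y - sg * A) #
       concat (map (\<lambda>k. [(sg * int q, y + u * 2 ^ (q * (K - 1 - k))), (- sg * int q, y - v * 2 ^ (q * (K - 1 - k)))]) [0..<K]))"

definition entries :: "nat \<Rightarrow> nat \<Rightarrow> int \<Rightarrow> int \<Rightarrow> int \<Rightarrow> int \<Rightarrow> int \<Rightarrow> nat \<Rightarrow> int \<Rightarrow> (int \<times> int) list" where
  "entries p q r T S C B K sg =
    (let z0 = orbit_sum q r p in concat (map (entries_at q r T S C B K sg z0) [0..<q]))"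

text \<open>Both accumulators start at \<open>2 ^ 60\<close>, which makes their integer roundings
  negligible beside the resolution of the cosines, scaled by \<open>2 ^ 26\<close>.\<close>

definition sign_check :: "nat \<Rightarrow> nat \<Rightarrow> int \<Rightarrow> int \<Rightarrow> int \<Rightarrow> int \<Rightarrow> int \<Rightarrow> nat \<Rightarrow> int \<Rightarrow> bool" where
  "sign_check p q r T S C B K sg \<longleftrightarrow>
     cos_prod_le ((2 ^ q - 1) * (2 ^ q - 1) * 2 ^ (q * K) * S * B) (entries p q r T S C B K sg)
       1152921504606846976 1152921504606846976"

text \<open>The two strict inequalities are the tolerance conditions of
  \<open>gelfond_exponent_range\<close> multiplied by \<open>24 * S * M * B\<close>. Writing
  \<open>1 mod int q\<close> admits the fixed point, with \<open>p = 0\<close> and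
  \<open>q = 1\<close>.\<close>

definition range_check :: "nat \<Rightarrow> nat \<Rightarrow> int \<Rightarrow> int \<Rightarrow> int \<Rightarrow> int \<Rightarrow> int \<Rightarrow> int \<Rightarrow> int \<Rightarrow> nat \<Rightarrow> nat \<Rightarrow> bool" where
  "range_check p q r T1 T2 S C1 C2 B K1 K2 \<longleftrightarrow>
     p < q \<and> (int p * r) mod int q = 1 mod int q \<and> 0 < S \<and> 0 < B \<and> 0 \<le> T1 \<and> T1 \<le> T2 \<and> T2 \<le> S \<and> C1 \<le> C2 \<and>
     (let M = 2 ^ q - 1; z0 = orbit_sum q r p in
        - 2 * S * M * B < 24 * S * B * z0 - 12 * (S - T1) * B - 24 * S * M * C2 + 6 * S * M * B \<and>
        24 * S * B * z0 - 12 * (S - T2) * B - 24 * S * M * C1 + 6 * S * M * B < 2 * S * M * B) \<and>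
     sign_check p q r T1 S C1 B K1 (-1) \<and> sign_check p q r T2 S C2 B K2 1"

section \<open>Soundness of the rounded arithmetic\<close>

lemma drop_bit_real_bounds:
  "real_of_int (drop_bit n x) \<le> of_int x / 2 ^ n" "of_int x / 2 ^ n < real_of_int (drop_bit n x) + 1"
proof -
  have "drop_bit n x = \<lfloor>real_of_int x / real_of_int (2 ^ n)\<rfloor>"
    by (simp only: floor_divide_of_int_eq drop_bit_eq_div)
  then show "real_of_int (drop_bit n x) \<le> of_int x / 2 ^ n" "of_int x / 2 ^ n < real_of_int (drop_bit n x) + 1"
    by simp_all
qed

lemma pi_power_ge: "x \<le> 3.141592653588 ^ n \<Longrightarrow> x \<le> pi ^ n"
  and pi_power_le: "3.1415926535899 ^ n \<le> x \<Longrightarrow> pi ^ n \<le> x"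
  using power_mono[OF pi_approx(1), of n] power_mono[OF pi_approx(2), of n] by simp_all

text \<open>Taylor's formula of order 12 with the remainder folded into the innermost coefficient.
  There it carries a factor \<open>y\<^sup>2\<close>, at most \<open>1/4\<close>, which explains the
  denominator \<open>1916006400\<close>, four times the factorial of 12.\<close>

lemma cos_horner:
  fixes y :: real
  assumes "\<bar>y\<bar> \<le> 1/2"
  obtains v where "pi ^ 10 / 3628800 - pi ^ 12 / 1916006400 \<le> v" "v \<le> pi ^ 10 / 3628800 + pi ^ 12 / 1916006400"
    "cos (pi * y) = 1 - y\<^sup>2 * (pi ^ 2 / 2 - y\<^sup>2 * (pi ^ 4 / 24 - y\<^sup>2 * (pi ^ 6 / 720 - y\<^sup>2 * (pi ^ 8 / 40320 - y\<^sup>2 * v))))"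
proof -
  obtain s where s: "cos (pi * y) = (\<Sum>m<12. cos_coeff m * (pi * y) ^ m) + cos (s + 1/2 * real 12 * pi) / fact 12 * (pi * y) ^ 12"
    using Maclaurin_cos_expansion[of "pi * y" 12] by blast
  define R where "R = cos (s + 1/2 * real 12 * pi)"
  define v where "v = pi ^ 10 / 3628800 - y\<^sup>2 * (pi ^ 12 / 479001600 * R)"
  have R: "\<bar>R\<bar> \<le> 1" by (simp add: R_def)
  have y2: "y\<^sup>2 \<le> (1/2)\<^sup>2" using assms by (intro power2_le_iff_abs_le[THEN iffD2]) auto
  have "\<bar>y\<^sup>2 * (pi ^ 12 / 479001600 * R)\<bar> = y\<^sup>2 * (pi ^ 12 / 479001600) * \<bar>R\<bar>" by (simp add: abs_mult)
  also have "\<dots> \<le> (1/2)\<^sup>2 * (pi ^ 12 / 479001600) * 1"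
    using R y2 by (intro mult_mono) auto
  also have "\<dots> = pi ^ 12 / 1916006400" by (simp add: power2_eq_square)
  finally have "pi ^ 10 / 3628800 - pi ^ 12 / 1916006400 \<le> v" "v \<le> pi ^ 10 / 3628800 + pi ^ 12 / 1916006400"
    unfolding v_def by linarith+
  moreover have "cos (pi * y) = 1 - y\<^sup>2 * (pi ^ 2 / 2 - y\<^sup>2 * (pi ^ 4 / 24 - y\<^sup>2 * (pi ^ 6 / 720 - y\<^sup>2 * (pi ^ 8 / 40320 - y\<^sup>2 * v))))"
  proof -
    have "(\<Sum>m<12. cos_coeff m * x ^ m) = 1 - x ^ 2 / 2 + x ^ 4 / 24 - x ^ 6 / 720 + x ^ 8 / 40320 - x ^ 10 / 3628800" for x :: real
      by (simp add: lessThan_nat_numeral cos_coeff_def fact_numeral)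
    from this[of "pi * y"] have "(\<Sum>m<12. cos_coeff m * (pi * y) ^ m) = 1 - (pi * y) ^ 2 / 2 + (pi * y) ^ 4 / 24 - (pi * y) ^ 6 / 720
        + (pi * y) ^ 8 / 40320 - (pi * y) ^ 10 / 3628800"
      .
    moreover have "fact 12 = (479001600::real)" by (simp add: fact_numeral)
    ultimately have "cos (pi * y) = 1 - (pi * y) ^ 2 / 2 + (pi * y) ^ 4 / 24 - (pi * y) ^ 6 / 720
        + (pi * y) ^ 8 / 40320 - (pi * y) ^ 10 / 3628800 + R / 479001600 * (pi * y) ^ 12"
      unfolding s R_def by simp
    moreover have "1 - u / 2 + u ^ 2 / 24 - u ^ 3 / 720 + u ^ 4 / 40320 - u ^ 5 / 3628800 + R / 479001600 * u ^ 6
      = 1 - w * (s / 2 - w * (s ^ 2 / 24 - w * (s ^ 3 / 720 - w * (s ^ 4 / 40320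
        - w * (s ^ 5 / 3628800 - w * (s ^ 6 / 479001600 * R))))))" if "u = s * w" for u s w :: real
      unfolding that by (simp add: power_mult_distrib right_diff_distrib eval_nat_numeral mult_ac)
    from this[of "(pi * y)\<^sup>2" "pi\<^sup>2" "y\<^sup>2"]
    have "1 - (pi * y) ^ 2 / 2 + (pi * y) ^ 4 / 24 - (pi * y) ^ 6 / 720
        + (pi * y) ^ 8 / 40320 - (pi * y) ^ 10 / 3628800 + R / 479001600 * (pi * y) ^ 12 =
      1 - y\<^sup>2 * (pi ^ 2 / 2 - y\<^sup>2 * (pi ^ 4 / 24 - y\<^sup>2 * (pi ^ 6 / 720 - y\<^sup>2 * (pi ^ 8 / 40320 - y\<^sup>2 * v))))"
      by (simp add: v_def power_mult_distrib flip: power_mult)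
    ultimately show ?thesis by (rule trans)
  qed
  ultimately show ?thesis by (rule that)
qed

text \<open>Subtracting a product that was rounded down rounds the result up, so upper steps need no
  correction and lower steps subtract 1. Each step negates the inner value, hence the two kinds
  alternate in the nest.\<close>

lemma horner_step_hi:
  fixes w v c :: real
  assumes "c \<le> of_int c'" "of_int v' \<le> v * 67108864" "0 \<le> w'" and w: "w = of_int w' / 4503599627370496"
  shows "(c / 67108864 - w * v) * 67108864 \<le> of_int (c' - drop_bit 52 (w' * v'))"
proof -
  have "of_int w' * of_int v' \<le> of_int w' * (v * 67108864)"
    using assms by (intro mult_left_mono) auto
  then have "of_int (w' * v') / 2 ^ 52 \<le> w * v * 67108864" by (simp add: w field_simps)
  moreover have "(c / 67108864 - w * v) * 67108864 = c - w * v * 67108864" by (simp add: left_diff_distrib)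
  ultimately show ?thesis
    using assms(1) drop_bit_real_bounds(1)[of 52 "w' * v'"] unfolding of_int_diff by linarith
qed

lemma horner_step_lo:
  fixes w v c :: real
  assumes "of_int c' \<le> c" "v * 67108864 \<le> of_int v'" "0 \<le> w'" and w: "w = of_int w' / 4503599627370496"
  shows "of_int (c' - drop_bit 52 (w' * v') - 1) \<le> (c / 67108864 - w * v) * 67108864"
proof -
  have "of_int w' * (v * 67108864) \<le> of_int w' * of_int v'"
    using assms by (intro mult_left_mono) auto
  then have "w * v * 67108864 \<le> of_int (w' * v') / 2 ^ 52" by (simp add: w field_simps)
  moreover have "(c / 67108864 - w * v) * 67108864 = c - w * v * 67108864" by (simp add: left_diff_distrib)
  ultimately show ?thesis
    using assms(1) drop_bit_real_bounds(2)[where n = 52 and x = "w' * v'"] unfolding of_int_diff by linarith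
qed

lemma fx_cos:
  assumes "0 \<le> y" "y \<le> 33554432"
  shows "67108864 * cos (pi * (of_int y / 67108864)) \<le> of_int (fx_cos_hi y)"
    and "of_int (fx_cos_lo y) \<le> 67108864 * cos (pi * (of_int y / 67108864))"
proof -
  define x where "x = real_of_int y / 67108864"
  have "\<bar>x\<bar> \<le> 1/2" using assms by (simp add: x_def)
  then obtain v where v: "pi ^ 10 / 3628800 - pi ^ 12 / 1916006400 \<le> v" "v \<le> pi ^ 10 / 3628800 + pi ^ 12 / 1916006400"
    and cos: "cos (pi * x) = 1 - x\<^sup>2 * (pi ^ 2 / 2 - x\<^sup>2 * (pi ^ 4 / 24 - x\<^sup>2 * (pi ^ 6 / 720 - x\<^sup>2 * (pi ^ 8 / 40320 - x\<^sup>2 * v))))"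
    using cos_horner by blast
  have w: "x\<^sup>2 = of_int (y * y) / 4503599627370496" by (simp add: x_def power2_eq_square)
  have y: "0 \<le> y * y" by simp
  define c1 c2 c3 c4 where "c1 = pi ^ 2 / 2 * 67108864" and "c2 = pi ^ 4 / 24 * 67108864"
    and "c3 = pi ^ 6 / 720 * 67108864" and "c4 = pi ^ 8 / 40320 * 67108864"
  have cos': "67108864 * cos (pi * x) = (67108864 / 67108864 - x\<^sup>2 * (c1 / 67108864 - x\<^sup>2 * (c2 / 67108864
      - x\<^sup>2 * (c3 / 67108864 - x\<^sup>2 * (c4 / 67108864 - x\<^sup>2 * v))))) * 67108864"
    unfolding cos by (simp add: c1_def c2_def c3_def c4_def)
  have pi_powers: "331168969 / 33554432 \<le> pi ^ 2" "pi ^ 2 \<le> 331168970 / 33554432"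
    "272375560 * 24 / 67108864 \<le> pi ^ 4" "pi ^ 4 \<le> 272375561 * 24 / 67108864"
    "89607967 * 720 / 67108864 \<le> pi ^ 6" "pi ^ 6 \<le> 89607968 * 720 / 67108864"
    "15792771 * 40320 / 67108864 \<le> pi ^ 8" "pi ^ 8 \<le> 15792772 * 40320 / 67108864"
    "93648.047 \<le> pi ^ 10" "pi ^ 10 \<le> 93648.048" "pi ^ 12 \<le> 924269.182"
    by (rule pi_power_ge pi_power_le; simp add: power_divide)+
  have v5: "of_int 1699498 \<le> v * 67108864" "v * 67108864 \<le> of_int 1764245"
    using v pi_powers(9-11) by simp_all
  have c: "of_int 331168969 \<le> c1" "c1 \<le> of_int 331168970" "of_int 272375560 \<le> c2" "c2 \<le> of_int 272375561"
    "of_int 89607967 \<le> c3" "c3 \<le> of_int 89607968" "of_int 15792771 \<le> c4" "c4 \<le> of_int 15792772"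
    unfolding c1_def c2_def c3_def c4_def
    using pi_powers(1-8) by simp_all
  have c0: "67108864 \<le> real_of_int 67108864" "real_of_int 67108864 \<le> 67108864" by simp_all
  note hi = horner_step_hi[OF _ _ y w] and lo = horner_step_lo[OF _ _ y w]
  show "67108864 * cos (pi * (of_int y / 67108864)) \<le> of_int (fx_cos_hi y)"
    unfolding x_def[symmetric] cos' fx_cos_hi_def Let_def
    by (intro hi lo c c0 v5)
  show "of_int (fx_cos_lo y) \<le> 67108864 * cos (pi * (of_int y / 67108864))"
    unfolding x_def[symmetric] cos' fx_cos_lo_def Let_def
    by (intro hi lo c c0 v5)
qed

lemma mul_pow_hi:
  "0 \<le> v \<Longrightarrow> 0 \<le> a \<Longrightarrow> of_int a * (of_int v / 67108864) ^ n \<le> real_of_int (mul_pow_hi n v a)"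
proof (induction n arbitrary: a)
  case (Suc n)
  let ?a = "drop_bit 26 (a * v) + 1"
  have "of_int (a * v) / 2 ^ 26 \<le> real_of_int ?a" using drop_bit_real_bounds(2)[of "a * v" 26] by simp
  then have "of_int a * (of_int v / 67108864) * (of_int v / 67108864) ^ n \<le> real_of_int ?a * (of_int v / 67108864) ^ n"
    using Suc.prems by (intro mult_right_mono) auto
  also have "\<dots> \<le> real_of_int (mul_pow_hi n v ?a)"
    using Suc.prems by (intro Suc.IH) auto
  finally show ?case by (simp add: mult.assoc)
qed simp

lemma mul_pow_lo:
  "0 \<le> v \<Longrightarrow> 0 \<le> a \<Longrightarrow> 0 \<le> mul_pow_lo n v a \<and> real_of_int (mul_pow_lo n v a) \<le> of_int a * (of_int v / 67108864) ^ n"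
proof (induction n arbitrary: a)
  case (Suc n)
  let ?a = "drop_bit 26 (a * v)"
  have "real_of_int ?a \<le> of_int (a * v) / 2 ^ 26" by (rule drop_bit_real_bounds)
  then have "real_of_int ?a * (of_int v / 67108864) ^ n \<le> of_int a * (of_int v / 67108864) * (of_int v / 67108864) ^ n"
    using Suc.prems by (intro mult_right_mono) auto
  moreover have "0 \<le> ?a" using Suc.prems by simp
  ultimately show ?case using Suc.IH[of ?a] Suc.prems by (simp add: mult.assoc)
qed simp

lemma fx_cos_div:
  assumes "2 * \<bar>y\<bar> < D"
  defines "k \<equiv> \<bar>y\<bar> * 67108864 div D"
  shows "67108864 * cos (pi * (of_int y / of_int D)) \<le> of_int (fx_cos_hi k)"
    and "of_int (fx_cos_lo (k + 1)) \<le> 67108864 * cos (pi * (of_int y / of_int D))"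
    and "cos (pi * (of_int y / of_int D)) > 0" and "\<bar>of_int y / real_of_int D\<bar> < 1/2"
proof -
  define x where "x = \<bar>real_of_int y / of_int D\<bar>"
  have D: "D > 0" using assms by linarith
  have k: "k = \<lfloor>x * 67108864\<rfloor>"
    using D floor_divide_of_int_eq[of "\<bar>y\<bar> * 67108864" D, where 'a = real] by (simp add: k_def x_def)
  have "real_of_int (2 * \<bar>y\<bar>) < of_int D" using assms(1) by (simp only: of_int_less_iff)
  then have x: "0 \<le> x" "x < 1/2" using D by (simp_all add: x_def divide_less_eq)
  have fl: "of_int k \<le> x * 67108864" "x * 67108864 < of_int (k + 1)" unfolding k by simp_all
  have "real_of_int k < of_int 33554432" using fl x by linarith
  \<comment> \<open>The strict bound \<open>x < 1/2\<close> puts the floor \<open>k\<close> below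
    \<open>2 ^ 25\<close>, so \<open>k + 1\<close>, used for the lower bound, is still an admissible
    argument of \<open>fx_cos\<close>.\<close>
  then have k0: "0 \<le> k" "k + 1 \<le> 33554432" using x by (simp_all add: k)
  have kx: "of_int k / 67108864 \<le> x" "x \<le> of_int (k + 1) / 67108864" using fl by simp_all
  have cosx: "cos (pi * (of_int y / of_int D)) = cos (pi * x)"
    using cos_abs_real[of "pi * (of_int y / of_int D)"] by (simp add: x_def abs_mult)
  have pi1: "pi * z \<le> pi" if "z \<le> 1" for z using that by simp
  show "\<bar>of_int y / real_of_int D\<bar> < 1/2" using x by (simp add: x_def)
  show "cos (pi * (of_int y / of_int D)) > 0" unfolding cosx using x by (intro cos_pi_pos) simp
  have "cos (pi * x) \<le> cos (pi * (of_int k / 67108864))"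
    using kx k0 x by (intro cos_monotone_0_pi_le mult_left_mono pi1) auto
  then show "67108864 * cos (pi * (of_int y / of_int D)) \<le> of_int (fx_cos_hi k)"
    unfolding cosx using fx_cos(1)[of k] k0 by simp
  have "real_of_int (k + 1) \<le> 33554432" using k0 by simp
  then have "cos (pi * (of_int (k + 1) / 67108864)) \<le> cos (pi * x)"
    using kx k0 x by (intro cos_monotone_0_pi_le mult_left_mono pi1) auto
  then show "of_int (fx_cos_lo (k + 1)) \<le> 67108864 * cos (pi * (of_int y / of_int D))"
    unfolding cosx using fx_cos(2)[of "k + 1"] k0 by simp
qed

text \<open>\<open>\<alpha>\<close> and \<open>\<gamma>\<close> are the exact values that
  \<open>a\<close> and \<open>b\<close> bound; generalising over them lets every factor move into
  one of them. The second conjunct later supplies the domain conditions of \<open>series_le\<close>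
  and \<open>series_ge\<close>.\<close>

lemma cos_prod_le_sound:
  assumes "cos_prod_le D xs a b" "0 < \<alpha>" "\<alpha> \<le> of_int a" "0 \<le> b" "of_int b \<le> \<gamma>" "0 < \<gamma>"
  shows "ln \<alpha> + (\<Sum>(n, y)\<leftarrow>xs. of_int n * ln (cos (pi * (of_int y / of_int D)))) \<le> ln \<gamma>
    \<and> (\<forall>(n, y)\<in>set xs. \<bar>of_int y / real_of_int D\<bar> < 1/2)"
  using assms
proof (induction xs arbitrary: a b \<alpha> \<gamma>)
  case Nil
  then have "\<alpha> \<le> \<gamma>" by (metis cos_prod_le.simps(1) of_int_le_iff order_trans)
  then show ?case using Nil by simp
next
  case (Cons x xs)
  obtain n y where x: "x = (n, y)" by force
  define k where "k = \<bar>y\<bar> * 67108864 div D"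
  define C where "C = cos (pi * (of_int y / of_int D))"
  have y: "2 * \<bar>y\<bar> < D" using Cons.prems by (simp add: x)
  note fx = fx_cos_div[OF y, folded k_def C_def]
  note half = fx_cos_div(4)[OF y]
  show ?case
  proof (cases "0 \<le> n")
    case True
    define a' where "a' = mul_pow_hi (nat n) (fx_cos_hi k) a"
    have rec: "cos_prod_le D xs a' b" using Cons.prems True by (simp add: x a'_def k_def)
    have v: "real_of_int (fx_cos_hi k) \<ge> 0" using fx by linarith
    have a0: "0 \<le> a" using Cons.prems by linarith
    have "\<alpha> * C ^ nat n \<le> of_int a * (of_int (fx_cos_hi k) / 67108864) ^ nat n"
      using Cons.prems fx by (intro mult_mono power_mono) auto
    also have "\<dots> \<le> of_int a'" unfolding a'_def using v a0 by (intro mul_pow_hi) auto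
    finally have "\<alpha> * C ^ nat n \<le> of_int a'" .
    from Cons.IH[OF rec _ this] Cons.prems fx
    have "ln (\<alpha> * C ^ nat n) + (\<Sum>(n, y)\<leftarrow>xs. of_int n * ln (cos (pi * (of_int y / of_int D)))) \<le> ln \<gamma>
      \<and> (\<forall>(n, y)\<in>set xs. \<bar>of_int y / real_of_int D\<bar> < 1/2)" by simp
    moreover have "ln (\<alpha> * C ^ nat n) = ln \<alpha> + of_int n * ln C"
      using Cons.prems fx True by (simp add: ln_mult ln_realpow)
    ultimately show ?thesis using half by (simp add: x C_def)
  next
    case False
    define v where "v = fx_cos_lo (k + 1)"
    define b' where "b' = mul_pow_lo (nat (- n)) v b"
    have v: "0 \<le> v" and rec: "cos_prod_le D xs a b'"
      using Cons.prems False by (auto simp: x b'_def k_def v_def Let_def)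
    have lo: "0 \<le> b'" "real_of_int b' \<le> of_int b * (of_int v / 67108864) ^ nat (- n)"
      unfolding b'_def using mul_pow_lo[OF v, of b "nat (- n)"] Cons.prems by auto
    have "of_int b * (of_int v / 67108864) ^ nat (- n) \<le> \<gamma> * C ^ nat (- n)"
      using Cons.prems fx v by (intro mult_mono power_mono) (auto simp: v_def)
    with lo have "real_of_int b' \<le> \<gamma> * C ^ nat (- n)" by linarith
    from Cons.IH[OF rec _ _ lo(1) this] Cons.prems fx
    have "ln \<alpha> + (\<Sum>(n, y)\<leftarrow>xs. of_int n * ln (cos (pi * (of_int y / of_int D)))) \<le> ln (\<gamma> * C ^ nat (- n))
      \<and> (\<forall>(n, y)\<in>set xs. \<bar>of_int y / real_of_int D\<bar> < 1/2)" by simp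
    moreover have "ln (\<gamma> * C ^ nat (- n)) = ln \<gamma> - of_int n * ln C"
      using Cons.prems fx False by (simp add: ln_mult ln_realpow)
    ultimately show ?thesis using half by (simp add: x C_def)
  qed
qed

section \<open>Gaps and orbit points from integer data\<close>

context rotation
begin

lemma idx_eq_inverse:
  assumes r: "(int p * r) mod int q = 1 mod int q"
  shows "int (idx i) = (- (i + 1) * r) mod int q"
proof -
  define n where "n = nat ((- (i + 1) * r) mod int q)"
  have n: "int n = (- (i + 1) * r) mod int q" using q_pos by (simp add: n_def)
  then have "n < q" using q_pos by (metis of_nat_0_less_iff of_nat_less_iff pos_mod_bound)
  obtain k where k: "int n = - (i + 1) * r - int q * k"
    using n by (metis minus_mult_div_eq_mod)
  have "int q dvd int p * r - 1" using r by (simp add: mod_eq_dvd_iff)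
  then obtain l where l: "int p * r = 1 + int q * l" by (auto simp: dvd_def algebra_simps)
  have "i + 1 + int n * int p = (i + 1) * (1 - int p * r) - int q * k * int p"
    unfolding k by (simp add: algebra_simps)
  also have "\<dots> = int q * (- (i + 1) * l - k * int p)"
    unfolding l by (simp add: algebra_simps)
  finally have "int q dvd i + 1 + int n * int p" by (rule dvdI)
  with \<open>n < q\<close> have "idx i = n" by (rule idx_eqI)
  with n show ?thesis by simp
qed

end

locale rotation_inverse = rotation +
  fixes r :: int
  assumes inverse: "(int p * r) mod int q = 1 mod int q"
begin

lemma gap_num: "gap i = of_int (gap_num q r i) / M"
proof -
  have "nat (- (i + 1) * r mod int q) = idx i" using idx_eq_inverse[OF inverse, of i] by linarith
  then show ?thesis by (simp add: gap_eq gap_num_def)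
qed

lemma orbit_sum: "z (int n) = z 0 + of_int (orbit_sum q r n) / M"
proof (induction n)
  case (Suc n)
  have "z (int (Suc n)) = z (int n) + gap (int n)" by (simp add: gap_def add.commute)
  also have "\<dots> = z 0 + of_int (orbit_sum q r n) / M + of_int (gap_num q r (int n)) / M"
    using Suc gap_num by simp
  finally show ?case by (simp add: add_divide_distrib)
qed simp

text \<open>\<open>z 0\<close> doubles to \<open>z p\<close> without wrapping, so it equals its
  distance to \<open>z p\<close>, a sum of \<open>p\<close> gaps. This replaces the evaluation of
  the floor sums.\<close>

lemma z_0: "z 0 = of_int (orbit_sum q r p) / M"
  using z_double[of 0] orbit_sum[of p] by simp

lemma z_num: "z (int n) = of_int (orbit_sum q r p + orbit_sum q r n) / M"
  using orbit_sum[of n] z_0 by (simp add: add_divide_distrib)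

definition "den K S B = ((2 ^ q - 1) * (2 ^ q - 1) * 2 ^ (q * K) * S * B :: int)"

definition "entry_sum D xs = (\<Sum>(n, y)\<leftarrow>xs. of_int n * ln (cos (pi * (of_int y / of_int D))))"

lemma entry_sum_simps:
  "entry_sum D [] = 0"
  "entry_sum D ((n, y) # xs) = of_int n * ln (cos (pi * (of_int y / of_int D))) + entry_sum D xs"
  "entry_sum D (xs @ ys) = entry_sum D xs + entry_sum D ys"
  by (simp_all add: entry_sum_def)

lemma entry_sum_concat: "entry_sum D (concat (map f [0..<n])) = (\<Sum>i<n. entry_sum D (f i))"
  by (induction n) (simp_all add: entry_sum_simps)

lemma entries_at_sum:
  fixes T S C B :: int
  assumes S: "S > 0" and B: "B > 0" and i: "i < q"
    and half: "\<forall>(n, y)\<in>set (entries_at q r T S C B K sg (orbit_sum q r p) i). \<bar>of_int y / real_of_int (den K S B)\<bar> < 1/2"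
  defines "t \<equiv> of_int T / of_int S" and "c \<equiv> of_int C / of_int B"
  shows "entry_sum (den K S B) (entries_at q r T S C B K sg (orbit_sum q r p) i)
      = of_int sg * ((real (idx (int i - 1)) - real (idx (int i))) * lncos c (z (int i))
        + real q * exact_part t c K (int i))
        + (lncos c (z (int i)) - lncos c (z (int i) - of_int sg * chord t K (int i)))"
    and "\<bar>z (int i) - of_int sg * chord t K (int i) - c\<bar> < 1/2"
proof -
  define N where "N = (2 ^ q - 1 :: int)"
  have N: "real_of_int N = M" by (simp add: N_def)
  have pos: "M > 0" "real_of_int S > 0" "real_of_int B > 0" using M_ge_1 S B by simp_all
  define D where "D = den K S B"
  have D: "real_of_int D = M * M * 2 ^ (q * K) * of_int S * of_int B" by (simp add: D_def den_def)
  define g where "g = gap_num q r (int i)"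
  define g' where "g' = gap_num q r (int i - 1)"
  define y where "y = ((orbit_sum q r p + orbit_sum q r i) * B - C * N) * (N * 2 ^ (q * K) * S)"
  define A where "A = int q * (T * g + (S - T) * g') * B"
  define u where "u = T * g * N * B"
  define v where "v = (S - T) * g' * N * B"
  have gaps: "gap (int i) = of_int g / M" "gap (int i - 1) = of_int g' / M"
    by (simp_all add: gap_num g_def g'_def)
  have ty: "1 - t = (of_int S - of_int T) / of_int S" using pos by (simp add: t_def field_simps)
  have yD: "of_int y / real_of_int D = z (int i) - c"
  proof -
    have "((a + a') * b - c * m) * (m * k * s) / (m * m * k * s * b) = (a + a') / m - c / b"
      if "m > 0" "k > 0" "s > 0" "b > 0" for a a' b c m k s :: real
      using that by (simp add: field_simps)
    from this[of M "2 ^ (q * K)" "of_int S" "of_int B" "of_int (orbit_sum q r p)" "of_int (orbit_sum q r i)" "of_int C"]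
    show ?thesis using pos unfolding D y_def c_def z_num by (simp only: N of_int_add of_int_diff of_int_mult of_int_power of_int_numeral) simp
  qed
  have AD: "of_int A / real_of_int D = chord t K (int i)"
  proof -
    have "n * (a * h + (s - a) * h') * b / (m * m * k * s * b) = n * (a / s * (h / m) + (s - a) / s * (h' / m)) / (k * m)"
      if "m > 0" "k > 0" "s > 0" "b > 0" for a b h h' n m k s :: real
      using that by (simp add: field_simps)
    from this[of M "2 ^ (q * K)" "of_int S" "of_int B"]
    show ?thesis unfolding D A_def chord_def ty gaps unfolding t_def using pos
      by (simp only: of_int_add of_int_diff of_int_mult of_int_of_nat_eq) simp
  qed
  have uD: "of_int (u * 2 ^ (q * (K - 1 - k))) / real_of_int D = t * (gap (int i) / 2 ^ (q * Suc k))"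
    and vD: "of_int (v * 2 ^ (q * (K - 1 - k))) / real_of_int D = (1 - t) * (gap (int i - 1) / 2 ^ (q * Suc k))"
    if "k < K" for k
  proof -
    \<comment> \<open>Block \<open>k\<close> has denominator \<open>2 ^ (q * Suc k)\<close>; over
      the common \<open>2 ^ (q * K)\<close> its numerator receives the missing power.\<close>
    have "K = (K - 1 - k) + Suc k" using that by simp
    then have "q * K = q * (K - 1 - k) + q * Suc k" by (metis add_mult_distrib2)
    then have "(2::real) ^ (q * K) = 2 ^ (q * (K - 1 - k)) * 2 ^ (q * Suc k)" by (simp only: power_add)
    then have D': "real_of_int D = M * M * (2 ^ (q * (K - 1 - k)) * 2 ^ (q * Suc k)) * of_int S * of_int B"
      unfolding D by simp
    have u: "x * h * m * b * w / (m * m * (w * w') * s * b) = x / s * (h / m / w')"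
      if "m > 0" "w > 0" "w' > 0" "s > 0" "b > 0" for x h m b w w' s :: real
      using that by (simp add: field_simps)
    note u = u[OF pos(1) _ _ pos(2,3), of "2 ^ (q * (K - 1 - k))" "2 ^ (q * Suc k)"]
    show "of_int (u * 2 ^ (q * (K - 1 - k))) / real_of_int D = t * (gap (int i) / 2 ^ (q * Suc k))"
      unfolding D' u_def gaps t_def of_int_mult of_int_power of_int_numeral N by (rule u) simp_all
    show "of_int (v * 2 ^ (q * (K - 1 - k))) / real_of_int D = (1 - t) * (gap (int i - 1) / 2 ^ (q * Suc k))"
      unfolding D' v_def gaps ty of_int_mult of_int_power of_int_numeral of_int_diff N by (rule u) simp_all
  qed
  have id: "real_of_int ((- int i * r) mod int q - (- (int i + 1) * r) mod int q) = real (idx (int i - 1)) - real (idx (int i))"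
    using idx_eq_inverse[OF inverse, of "int i - 1"]
    unfolding idx_eq_inverse[OF inverse, of "int i", symmetric] diff_add_cancel
    by (metis of_int_diff of_int_of_nat_eq)
  have E: "entries_at q r T S C B K sg (orbit_sum q r p) i =
    (sg * ((- int i * r) mod int q - (- (int i + 1) * r) mod int q) + 1, y) # (-1, y - sg * A) #
       concat (map (\<lambda>k. [(sg * int q, y + u * 2 ^ (q * (K - 1 - k))), (- sg * int q, y - v * 2 ^ (q * (K - 1 - k)))]) [0..<K])"
    unfolding entries_at_def Let_def y_def A_def u_def v_def g_def g'_def N_def ..
  have ln_cos: "ln (cos (pi * (of_int w / of_int D))) = lncos c x"
    if "\<bar>of_int w / real_of_int D\<bar> < 1/2" "of_int w / real_of_int D = x - c" for w x
    using that lncos_eq[of x c] by simp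
  have half': "\<bar>of_int w / real_of_int D\<bar> < 1/2" if "(n, w) \<in> set (entries_at q r T S C B K sg (orbit_sum q r p) i)" for n w
    using half that unfolding D_def by blast
  have y_half: "\<bar>of_int y / real_of_int D\<bar> < 1/2" and A_half: "\<bar>of_int (y - sg * A) / real_of_int D\<bar> < 1/2"
    by (rule half', unfold E, rule list.set_intros(1) list.set_intros(2)[OF list.set_intros(1)])+
  have yA: "of_int (y - sg * A) / real_of_int D = (z (int i) - of_int sg * chord t K (int i)) - c"
    unfolding of_int_diff of_int_mult diff_divide_distrib yD AD[symmetric] by simp
  show "\<bar>z (int i) - of_int sg * chord t K (int i) - c\<bar> < 1/2" using A_half unfolding yA .
  have blocks: "entry_sum D [(sg * int q, y + u * 2 ^ (q * (K - 1 - k))), (- sg * int q, y - v * 2 ^ (q * (K - 1 - k)))]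
    = of_int sg * real q * (lncos c (z (int i) + t * (gap (int i) / 2 ^ (q * Suc k)))
      - lncos c (z (int i) - (1 - t) * (gap (int i - 1) / 2 ^ (q * Suc k))))" if "k < K" for k
  proof -
    have "\<bar>of_int (y + u * 2 ^ (q * (K - 1 - k))) / real_of_int D\<bar> < 1/2"
      by (rule half'[of "sg * int q"]) (use that in \<open>auto simp: E\<close>)
    moreover have "of_int (y + u * 2 ^ (q * (K - 1 - k))) / real_of_int D
        = (z (int i) + t * (gap (int i) / 2 ^ (q * Suc k))) - c"
      unfolding of_int_add add_divide_distrib yD uD[OF that] by simp
    ultimately have 1: "ln (cos (pi * (of_int (y + u * 2 ^ (q * (K - 1 - k))) / of_int D)))
        = lncos c (z (int i) + t * (gap (int i) / 2 ^ (q * Suc k)))" by (rule ln_cos)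
    have "\<bar>of_int (y - v * 2 ^ (q * (K - 1 - k))) / real_of_int D\<bar> < 1/2"
      by (rule half'[of "- sg * int q"]) (use that in \<open>auto simp: E\<close>)
    moreover have "of_int (y - v * 2 ^ (q * (K - 1 - k))) / real_of_int D
        = (z (int i) - (1 - t) * (gap (int i - 1) / 2 ^ (q * Suc k))) - c"
      unfolding of_int_diff diff_divide_distrib yD vD[OF that] by simp
    ultimately have 2: "ln (cos (pi * (of_int (y - v * 2 ^ (q * (K - 1 - k))) / of_int D)))
        = lncos c (z (int i) - (1 - t) * (gap (int i - 1) / 2 ^ (q * Suc k)))" by (rule ln_cos)
    show ?thesis unfolding entry_sum_simps 1 2 by (simp add: algebra_simps)
  qed
  have blocks_sum: "entry_sum D (concat (map (\<lambda>k. [(sg * int q, y + u * 2 ^ (q * (K - 1 - k))), (- sg * int q, y - v * 2 ^ (q * (K - 1 - k)))]) [0..<K]))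
    = (\<Sum>k<K. of_int sg * real q * (lncos c (z (int i) + t * (gap (int i) / 2 ^ (q * Suc k)))
      - lncos c (z (int i) - (1 - t) * (gap (int i - 1) / 2 ^ (q * Suc k)))))"
    unfolding entry_sum_concat by (intro sum.cong refl blocks) simp
  have "entry_sum D (entries_at q r T S C B K sg (orbit_sum q r p) i)
      = (of_int sg * (real (idx (int i - 1)) - real (idx (int i))) + 1) * lncos c (z (int i))
        - lncos c (z (int i) - of_int sg * chord t K (int i))
        + (\<Sum>k<K. of_int sg * real q * (lncos c (z (int i) + t * (gap (int i) / 2 ^ (q * Suc k)))
      - lncos c (z (int i) - (1 - t) * (gap (int i - 1) / 2 ^ (q * Suc k)))))"
    unfolding E entry_sum_simps(2) blocks_sum ln_cos[OF y_half yD] ln_cos[OF A_half yA]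
      of_int_add of_int_mult of_int_1 id by simp
  then show "entry_sum (den K S B) (entries_at q r T S C B K sg (orbit_sum q r p) i)
      = of_int sg * ((real (idx (int i - 1)) - real (idx (int i))) * lncos c (z (int i))
        + real q * exact_part t c K (int i))
        + (lncos c (z (int i)) - lncos c (z (int i) - of_int sg * chord t K (int i)))"
    unfolding D_def exact_part_def by (simp add: sum_distrib_left algebra_simps)
qed

lemma sign_check_sound:
  fixes T S C B :: int
  assumes S: "S > 0" and B: "B > 0" and chk: "sign_check p q r T S C B K sg"
  defines "t \<equiv> of_int T / of_int S" and "c \<equiv> of_int C / of_int B"
  shows "(\<Sum>i<q. of_int sg * ((real (idx (int i - 1)) - real (idx (int i))) * lncos c (z (int i))
        + real q * exact_part t c K (int i))
        + (lncos c (z (int i)) - lncos c (z (int i) - of_int sg * chord t K (int i)))) \<le> 0"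
    and "\<And>i. i < q \<Longrightarrow> \<bar>z (int i) - of_int sg * chord t K (int i) - c\<bar> < 1/2"
proof -
  have "cos_prod_le (den K S B) (entries p q r T S C B K sg) 1152921504606846976 1152921504606846976"
    using chk by (simp add: sign_check_def den_def)
  from cos_prod_le_sound[OF this, of 1152921504606846976 1152921504606846976]
  have sum: "entry_sum (den K S B) (entries p q r T S C B K sg) \<le> 0"
    and half: "\<forall>(n, y)\<in>set (entries p q r T S C B K sg). \<bar>of_int y / real_of_int (den K S B)\<bar> < 1/2"
    by (simp_all add: entry_sum_def)
  have half': "\<forall>(n, y)\<in>set (entries_at q r T S C B K sg (orbit_sum q r p) i). \<bar>of_int y / real_of_int (den K S B)\<bar> < 1/2"
    if "i < q" for i
    using half that unfolding entries_def Let_def by fastforce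
  note at = entries_at_sum[OF S B _ half', folded t_def c_def]
  show "\<And>i. i < q \<Longrightarrow> \<bar>z (int i) - of_int sg * chord t K (int i) - c\<bar> < 1/2" by (rule at(2))
  have "entry_sum (den K S B) (entries p q r T S C B K sg)
      = (\<Sum>i<q. entry_sum (den K S B) (entries_at q r T S C B K sg (orbit_sum q r p) i))"
    unfolding entries_def Let_def by (rule entry_sum_concat)
  also have "\<dots> = (\<Sum>i<q. of_int sg * ((real (idx (int i - 1)) - real (idx (int i))) * lncos c (z (int i))
        + real q * exact_part t c K (int i))
        + (lncos c (z (int i)) - lncos c (z (int i) - of_int sg * chord t K (int i))))"
    by (intro sum.cong refl at(1)) auto
  finally show "(\<Sum>i<q. of_int sg * ((real (idx (int i - 1)) - real (idx (int i))) * lncos c (z (int i))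
        + real q * exact_part t c K (int i))
        + (lncos c (z (int i)) - lncos c (z (int i) - of_int sg * chord t K (int i)))) \<le> 0"
    using sum by simp
qed

end

theorem range_check_sound:
  assumes chk: "range_check p q r T1 T2 S C1 C2 B K1 K2"
    and c: "of_int C1 / of_int B \<le> c" "c \<le> of_int C2 / of_int B"
  shows "gelfond_exponent c = 1 + (\<Sum>j<q. lncos c (orbit_pt p q (int j))) / (real q * ln 2)"
    and "\<And>j. j < q \<Longrightarrow> \<bar>orbit_pt p q (int j) - c\<bar> < 1/3"
proof -
  have pq: "p < q" and inv: "(int p * r) mod int q = 1 mod int q" and S: "0 < S" and B: "0 < B"
    and T: "0 \<le> T1" "T1 \<le> T2" "T2 \<le> S"
    and tol: "- 2 * S * (2 ^ q - 1) * B < 24 * S * B * orbit_sum q r p - 12 * (S - T1) * B - 24 * S * (2 ^ q - 1) * C2 + 6 * S * (2 ^ q - 1) * B"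
      "24 * S * B * orbit_sum q r p - 12 * (S - T2) * B - 24 * S * (2 ^ q - 1) * C1 + 6 * S * (2 ^ q - 1) * B < 2 * S * (2 ^ q - 1) * B"
    and chk1: "sign_check p q r T1 S C1 B K1 (-1)" and chk2: "sign_check p q r T2 S C2 B K2 1"
    using chk unfolding range_check_def Let_def by blast+
  have "coprime (int p) (int q)"
  proof (rule coprimeI)
    fix x assume "x dvd int p" "x dvd int q"
    then have "x dvd int p * r" "x dvd int p * r - 1"
      using inv dvd_trans[of x "int q" "int p * r - 1"] by (auto simp: mod_eq_dvd_iff)
    then show "is_unit x" using dvd_diff[of x "int p * r" "int p * r - 1"] by simp
  qed
  then interpret rotation_inverse p q r
    by unfold_locales (use pq inv in auto)
  define t1 t2 where "t1 = real_of_int T1 / of_int S" and "t2 = real_of_int T2 / of_int S"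
  define clo chi where "clo = real_of_int C1 / of_int B" and "chi = real_of_int C2 / of_int B"
  have pos: "M > 0" "real_of_int S > 0" "real_of_int B > 0" using M_ge_1 S B by simp_all
  have t: "0 \<le> t1" "t1 \<le> t2" "t2 \<le> 1"
    using T pos by (simp_all add: t1_def t2_def divide_right_mono)
  have tol_eq: "24 * s * b * w - 12 * (s - u) * b - 24 * s * m * x + 6 * s * m * b
      = (24 * s * m * b) * (w / m - (1 - u / s) / (2 * m) - x / b + 1/4)"
    if "m > 0" "s > 0" "b > 0" for m s b w u x :: real
    using that by (simp add: field_simps)
  have scale: "24 * real_of_int S * M * of_int B > 0" using pos by simp
  have tol1: "- 1/12 < z 0 - (1 - t1) / (2 * M) - chi + 1/4"
  proof -
    have "(24 * real_of_int S * M * of_int B) * (- 1/12) = real_of_int (- 2 * S * (2 ^ q - 1) * B)" by simp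
    also have "\<dots> < of_int (24 * S * B * orbit_sum q r p - 12 * (S - T1) * B - 24 * S * (2 ^ q - 1) * C2 + 6 * S * (2 ^ q - 1) * B)"
      using tol(1) by (simp only: of_int_less_iff)
    also have "of_int (24 * S * B * orbit_sum q r p - 12 * (S - T1) * B - 24 * S * (2 ^ q - 1) * C2 + 6 * S * (2 ^ q - 1) * B)
      = (24 * real_of_int S * M * of_int B) * (z 0 - (1 - t1) / (2 * M) - chi + 1/4)"
    proof -
      have "real_of_int (24 * S * B * orbit_sum q r p - 12 * (S - T1) * B - 24 * S * (2 ^ q - 1) * C2 + 6 * S * (2 ^ q - 1) * B)
        = 24 * real_of_int S * of_int B * of_int (orbit_sum q r p) - 12 * (of_int S - of_int T1) * of_int B
          - 24 * of_int S * M * of_int C2 + 6 * of_int S * M * of_int B"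
        by (simp only: of_int_add of_int_diff of_int_mult of_int_power of_int_numeral of_int_1)
      from this[unfolded tol_eq[OF pos]] show ?thesis by (simp only: z_0 t1_def chi_def)
    qed
    finally have "(24 * real_of_int S * M * of_int B) * (- 1/12) < (24 * real_of_int S * M * of_int B) * (z 0 - (1 - t1) / (2 * M) - chi + 1/4)" .
    then show ?thesis using scale by (simp only: mult_less_cancel_left_pos)
  qed
  have tol2: "z 0 - (1 - t2) / (2 * M) - clo + 1/4 < 1/12"
  proof -
    have "(24 * real_of_int S * M * of_int B) * (z 0 - (1 - t2) / (2 * M) - clo + 1/4) =
      of_int (24 * S * B * orbit_sum q r p - 12 * (S - T2) * B - 24 * S * (2 ^ q - 1) * C1 + 6 * S * (2 ^ q - 1) * B)"
    proof -
      have "real_of_int (24 * S * B * orbit_sum q r p - 12 * (S - T2) * B - 24 * S * (2 ^ q - 1) * C1 + 6 * S * (2 ^ q - 1) * B)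
        = 24 * real_of_int S * of_int B * of_int (orbit_sum q r p) - 12 * (of_int S - of_int T2) * of_int B
          - 24 * of_int S * M * of_int C1 + 6 * of_int S * M * of_int B"
        by (simp only: of_int_add of_int_diff of_int_mult of_int_power of_int_numeral of_int_1)
      from this[unfolded tol_eq[OF pos]] show ?thesis by (simp only: z_0 t2_def clo_def)
    qed
    also have "\<dots> < real_of_int (2 * S * (2 ^ q - 1) * B)" using tol(2) by (simp only: of_int_less_iff)
    also have "\<dots> = (24 * real_of_int S * M * of_int B) * (1/12)" by simp
    finally have "(24 * real_of_int S * M * of_int B) * (z 0 - (1 - t2) / (2 * M) - clo + 1/4) < (24 * real_of_int S * M * of_int B) * (1/12)" .
    then show ?thesis using scale by (simp only: mult_less_cancel_left_pos)
  qed
  have c': "clo \<le> c" "c \<le> chi" using c by (simp_all add: clo_def chi_def)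
  have th: "(1 - t2) / (2 * M) \<le> (1 - t1) / (2 * M)" using t pos by (intro divide_right_mono) auto
  interpret A: rotation_cut p q t1 clo
    by unfold_locales (use t tol1 tol2 c' th in linarith)+
  interpret C: rotation_cut p q t2 chi
    by unfold_locales (use t tol1 tol2 c' th in linarith)+
  note s1 = sign_check_sound[OF S B chk1, folded t1_def clo_def]
  note s2 = sign_check_sound[OF S B chk2, folded t2_def chi_def]
  have "series t2 chi \<le> 0"
  proof -
    have "series t2 chi \<le> (\<Sum>i<q. (real (idx (int i - 1)) - real (idx (int i))) * lncos chi (z (int i))
      + real q * exact_part t2 chi K2 (int i) + (lncos chi (z (int i)) - lncos chi (z (int i) - chord t2 K2 (int i))))"
      using s2(2) by (intro C.series_le) simp
    also have "\<dots> \<le> 0" using s2(1) by simp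
    finally show ?thesis .
  qed
  moreover have "0 \<le> series t1 clo"
  proof -
    have "(\<Sum>i<q. (real (idx (int i - 1)) - real (idx (int i))) * lncos clo (z (int i))
      + real q * exact_part t1 clo K1 (int i) + (lncos clo (z (int i) + chord t1 K1 (int i)) - lncos clo (z (int i)))) \<le> series t1 clo"
      using s1(2) by (intro A.series_ge) simp
    moreover have "(\<Sum>i<q. (real (idx (int i - 1)) - real (idx (int i))) * lncos clo (z (int i))
      + real q * exact_part t1 clo K1 (int i) + (lncos clo (z (int i) + chord t1 K1 (int i)) - lncos clo (z (int i))))
      = - (\<Sum>i<q. of_int (-1) * ((real (idx (int i - 1)) - real (idx (int i))) * lncos clo (z (int i))
        + real q * exact_part t1 clo K1 (int i))
        + (lncos clo (z (int i)) - lncos clo (z (int i) - of_int (-1) * chord t1 K1 (int i))))"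
      unfolding sum_negf[symmetric] by (intro sum.cong refl) simp
    ultimately show ?thesis using s1(1) by linarith
  qed
  ultimately show "gelfond_exponent c = 1 + (\<Sum>j<q. lncos c (orbit_pt p q (int j))) / (real q * ln 2)"
    and "\<And>j. j < q \<Longrightarrow> \<bar>orbit_pt p q (int j) - c\<bar> < 1/3"
    using gelfond_exponent_range[OF t c' tol1 tol2] by blast+
qed

section \<open>Analyticity\<close>

lemma real_analytic_at_reflect:
  assumes "real_analytic_at f c" and sym: "\<And>x. f (s - x) = f x"
  shows "real_analytic_at f (s - c)"
proof -
  obtain a \<rho> where r: "\<rho> > 0" and a: "\<And>x. \<bar>x - c\<bar> < \<rho> \<Longrightarrow> (\<lambda>n. a n * (x - c) ^ n) sums f x"
    using assms(1) unfolding real_analytic_at_def by blast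
  have "(\<lambda>n. (a n * (-1) ^ n) * (x - (s - c)) ^ n) sums f x" if "\<bar>x - (s - c)\<bar> < \<rho>" for x
  proof -
    have "(\<lambda>n. a n * (s - x - c) ^ n) sums f (s - x)" using that by (intro a) (simp add: abs_minus_commute algebra_simps)
    moreover have "a n * (s - x - c) ^ n = (a n * (-1) ^ n) * (x - (s - c)) ^ n" for n
    proof -
      have "s - x - c = (-1) * (x - (s - c))" by simp
      then have "(s - x - c) ^ n = (-1) ^ n * (x - (s - c)) ^ n" by (metis power_mult_distrib)
      then show ?thesis by simp
    qed
    ultimately show ?thesis by (simp only: sym)
  qed
  with r show ?thesis unfolding real_analytic_at_def
    by (intro exI[of _ "\<lambda>n. a n * (-1) ^ n"] exI[of _ \<rho>] conjI allI impI)
qed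

text \<open>A holomorphic extension supplies the power series; at real points the powers of
  \<open>x - c\<close> are real, so the real parts of its Taylor coefficients suffice.\<close>

lemma real_analytic_at_complexI:
  fixes f :: "real \<Rightarrow> real" and F :: "complex \<Rightarrow> complex"
  assumes F: "F analytic_on {of_real c}" and ev: "\<epsilon> > 0" "\<And>x. \<bar>x - c\<bar> < \<epsilon> \<Longrightarrow> F (of_real x) = of_real (f x)"
  shows "real_analytic_at f c"
proof -
  obtain \<delta> where d: "\<delta> > 0" "F holomorphic_on ball (of_real c) \<delta>"
    using F by (auto simp: analytic_on_def)
  define a where "a n = Re ((deriv ^^ n) F (of_real c) / fact n)" for n
  have "(\<lambda>n. a n * (x - c) ^ n) sums f x" if x: "\<bar>x - c\<bar> < min \<delta> \<epsilon>" for x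
  proof -
    have "of_real x \<in> ball (complex_of_real c) \<delta>" using x by (simp add: dist_real_def abs_minus_commute)
    from sums_Re[OF holomorphic_power_series[OF d(2) this]]
    have "(\<lambda>n. Re ((deriv ^^ n) F (of_real c) / fact n * (of_real x - of_real c) ^ n)) sums Re (F (of_real x))" .
    moreover have "Re (w * (of_real x - of_real c) ^ n) = Re w * (x - c) ^ n" for w :: complex and n
      by (simp flip: of_real_diff of_real_power)
    moreover have "F (of_real x) = of_real (f x)" using ev(2)[of x] x by simp
    ultimately show ?thesis by (simp only: a_def Re_complex_of_real)
  qed
  then show ?thesis unfolding real_analytic_at_def using d(1) ev(1) by (intro exI[of _ a] exI[of _ "min \<delta> \<epsilon>"]) auto
qed

lemma analytic_lncos:
  assumes "\<bar>x - c\<bar> < 1/2"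
  shows "(\<lambda>w. Ln (cos (of_real pi * (of_real x - w)))) analytic_on {of_real c}"
proof -
  have "cos (of_real pi * (of_real x - of_real c)) = complex_of_real (cos (pi * (x - c)))"
    by (simp flip: of_real_diff of_real_mult add: cos_of_real)
  moreover have "cos (pi * (x - c)) > 0" using assms by (rule cos_pi_pos)
  ultimately have "cos (of_real pi * (of_real x - of_real c)) \<notin> (\<real>\<^sub>\<le>\<^sub>0 :: complex set)"
    by simp
  then show ?thesis by (intro analytic_intros) auto
qed

text \<open>Strictly between the ends, the explicit formula holds on a whole neighbourhood of
  \<open>c\<close>. Its complex extension is analytic because the orbit stays within
  \<open>1/3\<close> of \<open>c\<close>, where the cosine is positive and thus off the branch cut
  of \<open>Ln\<close>.\<close>

theorem range_check_analytic:
  assumes chk: "range_check p q r T1 T2 S C1 C2 B K1 K2"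
    and c: "of_int C1 / of_int B < c" "c < of_int C2 / of_int B"
  shows "real_analytic_at gelfond_exponent c"
proof -
  let ?F = "\<lambda>w. 1 + (\<Sum>j<q. Ln (cos (of_real pi * (of_real (orbit_pt p q (int j)) - w)))) / of_real (real q * ln 2)"
  let ?\<epsilon> = "min (c - of_int C1 / of_int B) (of_int C2 / of_int B - c)"
  have third: "\<bar>orbit_pt p q (int j) - x\<bar> < 1/3" if "j < q" "of_int C1 / of_int B < x" "x < of_int C2 / of_int B" for j x
    using range_check_sound(2)[OF chk, of x j] that by simp
  have q: "q > 0" using chk unfolding range_check_def by linarith
  have F: "?F analytic_on {of_real c}"
  proof (intro analytic_on_add analytic_on_const analytic_on_divide analytic_on_sum analytic_lncos)
    fix j assume "j \<in> {..<q}"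
    then show "\<bar>orbit_pt p q (int j) - c\<bar> < 1/2" using third[of j c] c by simp
  qed (use q in auto)
  have pos: "?\<epsilon> > 0" using c by simp
  have "?F (of_real x) = of_real (gelfond_exponent x)" if "\<bar>x - c\<bar> < ?\<epsilon>" for x
  proof -
    from that have x: "of_int C1 / of_int B < x" "x < of_int C2 / of_int B" by (simp_all add: abs_less_iff)
    have "Ln (cos (of_real pi * (of_real (orbit_pt p q (int j)) - of_real x))) = of_real (lncos x (orbit_pt p q (int j)))"
      if "j < q" for j
    proof -
      have h: "\<bar>orbit_pt p q (int j) - x\<bar> < 1/2" using third[OF that x] by simp
      have "cos (of_real pi * (of_real (orbit_pt p q (int j)) - of_real x)) = complex_of_real (cos (pi * (orbit_pt p q (int j) - x)))"
        by (simp flip: of_real_diff of_real_mult add: cos_of_real)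
      then show ?thesis using cos_pi_pos[OF h] by (simp add: lncos_eq[OF h] Ln_of_real)
    qed
    then have "?F (of_real x) = of_real (1 + (\<Sum>j<q. lncos x (orbit_pt p q (int j))) / (real q * ln 2))"
      by simp
    then show ?thesis using range_check_sound(1)[OF chk, of x] x by simp
  qed
  from F pos this show ?thesis by (rule real_analytic_at_complexI)
qed

text \<open>The intervals contain every grid point \<open>i / 1024 \<le> 1 / 2\<close> outside the exceptional set, and
  exceed these points by \<open>1 / 32768\<close> on both sides, which makes the points interior.\<close>

lemma cert_0_55: "range_check 0 1 0 29 42 64 (-1) 1761 32768 3 6"
  by code_simp

text \<open>For the fixed point the semicircle moves by \<open>1/2\<close> as \<open>t\<close> runs
  through \<open>{0..1}\<close>, three times the width of the tolerance band. So the windows for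
  \<open>t\<close> slide along with \<open>c\<close>, and this one orbit takes several
  certificates.\<close>

lemma cert_56_94: "range_check 0 1 0 34 49 64 1791 3009 32768 2 6"
  by code_simp

lemma cert_95_122: "range_check 0 1 0 37 54 64 3039 3905 32768 2 6"
  by code_simp

lemma cert_123_139: "range_check 0 1 0 39 57 64 3935 4449 32768 2 6"
  by code_simp

lemma cert_140_156: "range_check 0 1 0 41 60 64 4479 4993 32768 2 6"
  by code_simp

lemma cert_157_167: "range_check 0 1 0 43 62 64 5023 5345 32768 2 6"
  by code_simp

lemma cert_168_173: "range_check 0 1 0 44 63 64 5375 5537 32768 2 6"
  by code_simp

lemma cert_174_179: "range_check 0 1 0 44 64 64 5567 5729 32768 2 6"
  by code_simp

text \<open>For long periods the blocks shrink so fast that the secant bound works without exact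
  terms, and the semicircle moves so little that all of \<open>{0..1}\<close> is admissible for
  \<open>t\<close>.\<close>

lemma cert_180_180: "range_check 1 13 1 0 1 1 5759 5761 32768 0 0"
  by code_simp

lemma cert_181_181: "range_check 1 11 1 0 1 1 5791 5793 32768 0 0"
  by code_simp

lemma cert_182_183: "range_check 1 10 1 0 1 1 5823 5857 32768 0 0"
  by code_simp

lemma cert_184_186: "range_check 1 9 1 0 1 1 5887 5953 32768 0 0"
  by code_simp

lemma cert_187_191: "range_check 1 8 1 0 1 1 5983 6113 32768 1 1"
  by code_simp

lemma cert_193_201: "range_check 1 7 1 0 1 1 6175 6433 32768 1 1"
  by code_simp

lemma cert_202_218: "range_check 1 6 1 0 1 1 6463 6977 32768 1 1"
  by code_simp

lemma cert_219_219: "range_check 2 11 6 0 1 1 7007 7009 32768 0 0"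
  by code_simp

lemma cert_220_247: "range_check 1 5 1 0 1 1 7039 7905 32768 1 1"
  by code_simp

lemma cert_248_250: "range_check 2 9 5 0 1 1 7935 8001 32768 0 0"
  by code_simp

lemma cert_251_297: "range_check 1 4 1 0 1 1 8031 9505 32768 1 1"
  by code_simp

lemma cert_298_298: "range_check 3 11 4 0 1 1 9535 9537 32768 0 0"
  by code_simp

lemma cert_299_307: "range_check 2 7 4 0 1 1 9567 9825 32768 1 1"
  by code_simp

lemma cert_308_308: "range_check 3 10 7 0 1 1 9855 9857 32768 0 0"
  by code_simp

text \<open>At this end of the range of period 3, \<open>t = 1\<close> would violate the tolerance;
  the window stops at \<open>3/4\<close>.\<close>

lemma cert_310_318: "range_check 1 3 1 0 3 4 9919 10177 32768 2 1"
  by code_simp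

lemma cert_319_389: "range_check 1 3 1 0 1 1 10207 12449 32768 1 1"
  by code_simp

lemma cert_392_396: "range_check 3 8 3 0 1 1 12543 12673 32768 1 1"
  by code_simp

lemma cert_397_423: "range_check 2 5 3 0 1 1 12703 13537 32768 1 1"
  by code_simp

lemma cert_424_424: "range_check 5 12 5 0 1 1 13567 13569 32768 0 0"
  by code_simp

lemma cert_425_433: "range_check 3 7 5 0 1 1 13599 13857 32768 1 1"
  by code_simp

lemma cert_434_436: "range_check 4 9 7 0 1 1 13887 13953 32768 0 0"
  by code_simp

lemma cert_437_437: "range_check 5 11 9 0 1 1 13983 13985 32768 0 0"
  by code_simp

text \<open>For period 2 the semicircle moves by exactly the width \<open>1/6\<close> of the
  tolerance band, so the range of \<open>t\<close> has to be split.\<close>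

lemma cert_438_490: "range_check 1 2 1 0 1 2 14015 15681 32768 3 1"
  by code_simp

lemma cert_491_512: "range_check 1 2 1 1 3 5 15711 16385 32768 1 1"
  by code_simp

section \<open>Covering the grid\<close>

lemma real_analytic_at_grid:
  assumes "range_check p q r T1 T2 S C1 C2 32768 K1 K2" "C1 < 32 * int i" "32 * int i < C2"
  shows "real_analytic_at gelfond_exponent (real i / 1024)"
proof (rule range_check_analytic[OF assms(1)])
  have "real_of_int C1 < of_int (32 * int i)" "real_of_int (32 * int i) < of_int C2"
    using assms(2,3) by (simp_all only: of_int_less_iff)
  then show "of_int C1 / of_int 32768 < real i / 1024" "real i / 1024 < of_int C2 / of_int 32768"
    by simp_all
qed

lemma real_analytic_at_grid_half:
  assumes i: "i \<le> 512" and ex: "i \<notin> {192, 309, 390, 391}"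
  shows "real_analytic_at gelfond_exponent (real i / 1024)"
proof -
  have "i \<in> {0..55} \<or>
    i \<in> {56..94} \<or>
    i \<in> {95..122} \<or>
    i \<in> {123..139} \<or>
    i \<in> {140..156} \<or>
    i \<in> {157..167} \<or>
    i \<in> {168..173} \<or>
    i \<in> {174..179} \<or>
    i \<in> {180..180} \<or>
    i \<in> {181..181} \<or>
    i \<in> {182..183} \<or>
    i \<in> {184..186} \<or>
    i \<in> {187..191} \<or>
    i \<in> {193..201} \<or>
    i \<in> {202..218} \<or>
    i \<in> {219..219} \<or>
    i \<in> {220..247} \<or>
    i \<in> {248..250} \<or>
    i \<in> {251..297} \<or>
    i \<in> {298..298} \<or>
    i \<in> {299..307} \<or>
    i \<in> {308..308} \<or>
    i \<in> {310..318} \<or>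
    i \<in> {319..389} \<or>
    i \<in> {392..396} \<or>
    i \<in> {397..423} \<or>
    i \<in> {424..424} \<or>
    i \<in> {425..433} \<or>
    i \<in> {434..436} \<or>
    i \<in> {437..437} \<or>
    i \<in> {438..490} \<or>
    i \<in> {491..512}"
    using assms by simp presburger
  then show ?thesis
    by (elim disjE)
      (rule real_analytic_at_grid[OF cert_0_55], simp, simp,
       rule real_analytic_at_grid[OF cert_56_94], simp, simp,
       rule real_analytic_at_grid[OF cert_95_122], simp, simp,
       rule real_analytic_at_grid[OF cert_123_139], simp, simp,
       rule real_analytic_at_grid[OF cert_140_156], simp, simp,
       rule real_analytic_at_grid[OF cert_157_167], simp, simp,
       rule real_analytic_at_grid[OF cert_168_173], simp, simp,
       rule real_analytic_at_grid[OF cert_174_179], simp, simp,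
       rule real_analytic_at_grid[OF cert_180_180], simp, simp,
       rule real_analytic_at_grid[OF cert_181_181], simp, simp,
       rule real_analytic_at_grid[OF cert_182_183], simp, simp,
       rule real_analytic_at_grid[OF cert_184_186], simp, simp,
       rule real_analytic_at_grid[OF cert_187_191], simp, simp,
       rule real_analytic_at_grid[OF cert_193_201], simp, simp,
       rule real_analytic_at_grid[OF cert_202_218], simp, simp,
       rule real_analytic_at_grid[OF cert_219_219], simp, simp,
       rule real_analytic_at_grid[OF cert_220_247], simp, simp,
       rule real_analytic_at_grid[OF cert_248_250], simp, simp,
       rule real_analytic_at_grid[OF cert_251_297], simp, simp,
       rule real_analytic_at_grid[OF cert_298_298], simp, simp,
       rule real_analytic_at_grid[OF cert_299_307], simp, simp,
       rule real_analytic_at_grid[OF cert_308_308], simp, simp,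
       rule real_analytic_at_grid[OF cert_310_318], simp, simp,
       rule real_analytic_at_grid[OF cert_319_389], simp, simp,
       rule real_analytic_at_grid[OF cert_392_396], simp, simp,
       rule real_analytic_at_grid[OF cert_397_423], simp, simp,
       rule real_analytic_at_grid[OF cert_424_424], simp, simp,
       rule real_analytic_at_grid[OF cert_425_433], simp, simp,
       rule real_analytic_at_grid[OF cert_434_436], simp, simp,
       rule real_analytic_at_grid[OF cert_437_437], simp, simp,
       rule real_analytic_at_grid[OF cert_438_490], simp, simp,
       rule real_analytic_at_grid[OF cert_491_512], simp, simp)
qed

theorem mainTheorem4:
  shows "\<forall>c \<in> Lambda10 - Lambda10U. real_analytic_at gelfond_exponent c"
proof
  fix c assume c: "c \<in> Lambda10 - Lambda10U"
  then obtain i where i: "c = real i / 1024" "i \<le> 1023" by (auto simp: Lambda10_def)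
  have ex: "i \<notin> {192, 309, 390, 391, 832, 715, 634, 633}"
    using c i(1) by (auto simp: Lambda10U_def)
  show "real_analytic_at gelfond_exponent c"
  proof (cases "i \<le> 512")
    case True
    then show ?thesis using real_analytic_at_grid_half[of i] ex unfolding i(1) by simp
  next
    case False
    \<comment> \<open>The exponent is even with period 1, and the exceptional set is invariant under
      this reflection.\<close>
    define j where "j = 1024 - i"
    have j: "j \<le> 512" "j \<notin> {192, 309, 390, 391}" using False i(2) ex by (auto simp: j_def)
    have "gelfond_exponent (1 - x) = gelfond_exponent x" for x
      using gelfond_exponent_add_1[of "- x"] gelfond_exponent_minus[of x] by simp
    from real_analytic_at_reflect[OF real_analytic_at_grid_half[OF j] this]
    have "real_analytic_at gelfond_exponent (1 - real j / 1024)" .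
    moreover have "1 - real j / 1024 = c" using i by (simp add: j_def of_nat_diff field_simps)
    ultimately show ?thesis by simp
  qed
qed

end
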